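(* Let $s,t\in\mathbb{R}^2$ be two distinct fixed points, let $X_n$ be a homogeneous Poisson point process of intensity $n$ in $\mathbb{R}^2$, and let $X:=X_n\cup\{s,t\}$. Let $N_{s,t}$ be the number of edges of triangles of the Delaunay triangulation $\operatorname{Del}(X)$ such that the edge intersects the line segment $[s,t]$. Then, as $n\to\infty$, $$\mathbb{E}\left[\frac{N_{s,t}}{\|s-t\|}\right]=\frac{64}{3\pi^2}\sqrt{n}+O(1)\ (\simeq 2.1615\sqrt{n}).$$
   Context: $\|\cdot\|$ is the Euclidean norm. For a locally finite set $\chi\subset\mathbb{R}^2$ in general position (no three points on a line, no four points on a circle), the Delaunay triangulation $\operatorname{Del}(\chi)$ consists of the triangles with vertices $x_1,x_2,x_3\in\chi$ whose circumscribed disk contains no point of $\chi$ in its interior, together with the edges of these triangles. The points $s,t$ are fixed (independent of $n$). *)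

theory Defs
  imports "HOL-Probability.Probability" "HOL-Library.Landau_Symbols"
begin

section \<open>Homogeneous Poisson point processes\<close>

definition locally_finite_set :: "'a::metric_space set \<Rightarrow> bool" where
  "locally_finite_set S \<longleftrightarrow> (\<forall>B. bounded B \<longrightarrow> finite (S \<inter> B))"

text \<open>
  The process is simple, so it is represented by the random locally finite set of its atoms.
  The Poisson weights are written out because \<^const>\<open>poisson_pmf\<close> is only specified for a
  positive rate, whereas the count of a Lebesgue null set has rate \<open>0\<close>.
\<close>

definition homogeneous_poisson_process ::
  "'w measure \<Rightarrow> real \<Rightarrow> ('w \<Rightarrow> 'a::euclidean_space set) \<Rightarrow> bool" where
  "homogeneous_poisson_process M \<gamma> X \<longleftrightarrow>
     prob_space M \<and>
     (\<forall>\<omega>\<in>space M. locally_finite_set (X \<omega>)) \<and>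
     (\<forall>B. B \<in> sets borel \<and> bounded B \<longrightarrow>
        (\<lambda>\<omega>. card (X \<omega> \<inter> B)) \<in> measurable M (count_space UNIV) \<and>
        (\<forall>k. measure M {\<omega> \<in> space M. card (X \<omega> \<inter> B) = k} =
             (\<gamma> * measure lborel B) ^ k / fact k * exp (- (\<gamma> * measure lborel B)))) \<and>
     (\<forall>(I :: nat set) B. finite I \<and> disjoint_family_on B I \<and>
        (\<forall>i\<in>I. B i \<in> sets borel \<and> bounded (B i)) \<longrightarrow>
        prob_space.indep_vars M (\<lambda>_. count_space UNIV) (\<lambda>i \<omega>. card (X \<omega> \<inter> B i)) I)"


section \<open>Planar Delaunay triangulations\<close>

text \<open>
  For non-collinear \<open>a\<close>, \<open>b\<close>, \<open>c\<close> the circle through them is unique, so \<open>cball z r\<close> below is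
  their circumscribed disk and \<open>ball z r\<close> its interior.
\<close>

definition delaunay_triangle ::
  "(real ^ 2) set \<Rightarrow> real ^ 2 \<Rightarrow> real ^ 2 \<Rightarrow> real ^ 2 \<Rightarrow> bool" where
  "delaunay_triangle S a b c \<longleftrightarrow>
     {a, b, c} \<subseteq> S \<and> \<not> collinear {a, b, c} \<and>
     (\<exists>z r. {a, b, c} \<subseteq> sphere z r \<and> ball z r \<inter> S = {})"

text \<open>
  An edge is represented by the unordered pair of its endpoints; since \<^const>\<open>delaunay_triangle\<close>
  is symmetric in the three vertices, all three sides of each triangle are included.
\<close>

definition delaunay_edges :: "(real ^ 2) set \<Rightarrow> (real ^ 2) set set" where
  "delaunay_edges S = {{a, b} | a b c. delaunay_triangle S a b c}"

text \<open>
  \<^const>\<open>card\<close> of an infinite set is \<open>0\<close>; for a homogeneous Poisson process together with finitely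
  many fixed points, the set counted here is almost surely finite.
\<close>

definition num_crossing_edges :: "(real ^ 2) set \<Rightarrow> real ^ 2 \<Rightarrow> real ^ 2 \<Rightarrow> nat" where
  "num_crossing_edges S s t =
     card {e \<in> delaunay_edges S. convex hull e \<inter> closed_segment s t \<noteq> {}}"

end

theory Submission
  imports Defs "HOL-Real_Asymp.Real_Asymp"
begin

text \<open>
  Almost surely every edge \<open>ab\<close> of the Delaunay triangulation of the process \<open>X\<close> alone lies in exactly one
  triangle on each side. Hence twice the number of crossing edges is the number of triangles \<open>abc\<close> with
  \<open>c\<close> on the positive side of \<open>ab\<close> and \<open>ab\<close> crossing the segment. By the Mecke formula its mean is \<open>n\<^sup>3\<close> times
  the integral of \<open>exp (- n \<pi> r\<^sup>2)\<close> over such triples, where \<open>r\<close> is the circumradius. With \<open>b = a + v\<close>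
  and \<open>c = a + w\<close>, integrating over \<open>a\<close> gives the area of the parallelogram spanned by \<open>v\<close> and
  \<open>t - s\<close>. Writing the exponential as an integral over radii \<open>\<rho> > r\<close> reduces the integral over \<open>w\<close> to
  the area of a lune, and only integrals of polynomials and one Gaussian moment remain.

  Adding \<open>s\<close> and \<open>t\<close> changes the edge set only by edges at \<open>s\<close> or \<open>t\<close> and by edges \<open>xy\<close> with an empty
  disk around them whose closure contains \<open>s\<close> or \<open>t\<close>. A disk of radius at least \<open>R\<close> with \<open>x\<close> on its
  boundary contains one of four fixed disks of radius \<open>R / 4\<close> near \<open>x\<close>, so void probabilities and the
  Mecke formula bound the expected change independently of \<open>n\<close>.
\<close>

section \<open>The Mecke formula\<close>

text \<open>The points s and t are kept out of the main count because they are not typical: an edge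
  at s or t meets the segment automatically, so such edges are handled as a bounded perturbation.
  The perturbation bounds are free of n because each use of the Mecke formula contributes a factor
  n, while integrating a bound \<open>exp (- c * n * d^2)\<close> over the plane contributes pi / (c
  n).

  The circumradius is an awkward function of three vertices. In the layer-cake form it occurs only
  in a condition r < rho, whose solution set is explicit for a fixed chord v. Once the lune is
  replaced by a strip, the domain of v is constrained only through its length, so v can be
  integrated out before the remaining variables. With a = n pi the shape integral is 128/3 sqrt pi
  |t - s| a^(-5/2). Multiplied by n^3 this is 128/(3 pi^2) sqrt n |t - s|, and halving for the two
  orientations of an edge gives 64/(3 pi^2).

  Counts stay extended nonnegative numbers until the end, since their finiteness is only an almost
  sure statement.\<close>

text \<open>For locally finite sets the void events already generate all counting maps, see
  \<open>measurable_card_Int\<close>.\<close>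

definition config_algebra :: "'a::euclidean_space set measure" where
  "config_algebra = sigma (Collect locally_finite_set)
     {{S. locally_finite_set S \<and> S \<inter> V = {}} | V. V \<in> sets borel \<and> bounded V}"

lemma space_config_algebra [simp]: "space config_algebra = Collect locally_finite_set"
  unfolding config_algebra_def by (rule space_measure_of) auto

lemma sets_config_algebra:
  "sets config_algebra = sigma_sets (Collect locally_finite_set)
     {{S. locally_finite_set S \<and> S \<inter> V = {}} | V. V \<in> sets borel \<and> bounded V}"
  unfolding config_algebra_def by (rule sets_measure_of) auto

lemma void_in_sets:
  assumes "V \<in> sets borel" "bounded V"
  shows "{S. locally_finite_set S \<and> S \<inter> V = {}} \<in> sets config_algebra"
  unfolding sets_config_algebra using assms by (intro sigma_sets.Basic) auto

section \<open>Measurability of counts and of sums over configurations\<close>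

lemma locally_finite_set_Int: "locally_finite_set S \<Longrightarrow> bounded B \<Longrightarrow> finite (S \<inter> B)"
  by (auto simp: locally_finite_set_def)

lemma locally_finite_set_insert: "locally_finite_set S \<Longrightarrow> locally_finite_set (insert x S)"
  by (auto simp: locally_finite_set_def Int_insert_left)

text \<open>Balls of half the minimal distance are disjoint, and each contains a basic neighbourhood
  of its centre. Taking the neighbourhoods from a countable basis is what later keeps the union over
  all choices countable.\<close>

lemma finite_separating_basis:
  fixes F :: "'a::metric_space set"
  assumes "topological_basis Bs" "finite F"
  shows "\<exists>U. (\<forall>x\<in>F. U x \<in> Bs \<and> x \<in> U x) \<and> (\<forall>x\<in>F. \<forall>y\<in>F. x \<noteq> y \<longrightarrow> U x \<inter> U y = {})"
proof -
  obtain d where d: "d > 0" "\<And>x y. x \<in> F \<Longrightarrow> y \<in> F \<Longrightarrow> x \<noteq> y \<Longrightarrow> d \<le> dist x y"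
  proof -
    \<comment> \<open>The extra element 1 keeps the minimum defined when \<open>F\<close> has at
      most one point.\<close>
    define D where "D = insert 1 ((\<lambda>(x, y). dist x y) ` {(x, y) \<in> F \<times> F. x \<noteq> y})"
    have "finite {(x, y) \<in> F \<times> F. x \<noteq> y}"
      by (rule finite_subset[OF _ finite_cartesian_product[OF assms(2) assms(2)]]) auto
    then have "finite D" unfolding D_def by simp
    moreover have "D \<noteq> {}" "\<forall>e\<in>D. e > 0" by (auto simp: D_def)
    ultimately have "Min D > 0" by (subst Min_gr_iff) auto
    moreover have "Min D \<le> dist x y" if "x \<in> F" "y \<in> F" "x \<noteq> y" for x y
      using \<open>finite D\<close> that by (intro Min_le) (auto simp: D_def image_iff intro: bexI[of _ "(x, y)"])
    ultimately show ?thesis using that by blast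
  qed
  have "\<exists>V. V \<in> Bs \<and> x \<in> V \<and> V \<subseteq> ball x (d / 2)" for x
    using topological_basisE[OF assms(1) open_ball, of x x "d / 2"] d(1)
    by (metis centre_in_ball half_gt_zero_iff)
  then obtain U where U: "\<And>x. U x \<in> Bs" "\<And>x. x \<in> U x" "\<And>x. U x \<subseteq> ball x (d / 2)"
    by metis
  have "U x \<inter> U y = {}" if "x \<in> F" "y \<in> F" "x \<noteq> y" for x y
  proof (rule ccontr)
    assume "U x \<inter> U y \<noteq> {}"
    then obtain p where "p \<in> U x" "p \<in> U y" by auto
    then have "dist x p < d / 2" "dist y p < d / 2" using U(3) by (auto simp: subset_iff)
    moreover have "dist x y \<le> dist x p + dist y p" by (metis dist_triangle dist_commute)
    ultimately show False using d(2)[OF that] by simp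
  qed
  then show ?thesis using U by blast
qed

text \<open>There are at least k points in \<open>B\<close> exactly if some k pairwise disjoint
  basis sets are each hit inside \<open>B\<close>. Hitting is the complement of a void event, and
  there are only countably many lists of basis sets.\<close>

lemma measurable_card_Int:
  fixes B :: "'a::euclidean_space set"
  assumes B: "B \<in> sets borel" "bounded B"
  shows "(\<lambda>S. card (S \<inter> B)) \<in> measurable config_algebra (count_space UNIV)"
proof -
  obtain Bs :: "'a set set" where Bs: "countable Bs" "topological_basis Bs"
    using ex_countable_basis by auto
  have hit: "{S. locally_finite_set S \<and> S \<inter> (B \<inter> U) \<noteq> {}} \<in> sets config_algebra" if "U \<in> Bs" for U
  proof -
    have "B \<inter> U \<in> sets borel" using B that Bs(2) by (auto simp: topological_basis_open)
    moreover have "bounded (B \<inter> U)" using B by (auto intro: bounded_subset)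
    ultimately have "{S. locally_finite_set S \<and> S \<inter> (B \<inter> U) = {}} \<in> sets config_algebra"
      by (rule void_in_sets)
    then have "space config_algebra - {S. locally_finite_set S \<and> S \<inter> (B \<inter> U) = {}} \<in> sets config_algebra"
      by (rule sets.compl_sets)
    then show ?thesis by (rule back_subst[of "\<lambda>A. A \<in> _"]) auto
  qed
  have ge: "{S. locally_finite_set S \<and> k \<le> card (S \<inter> B)} \<in> sets config_algebra" for k
  proof -
    define I where "I = {Us \<in> lists Bs. length Us = k \<and> (\<forall>i<k. \<forall>j<k. i \<noteq> j \<longrightarrow> Us ! i \<inter> Us ! j = {})}"
    have "countable I" unfolding I_def
      by (rule countable_subset[OF _ countable_lists[OF Bs(1)]]) auto
    have "{S. locally_finite_set S \<and> k \<le> card (S \<inter> B)} =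
      (\<Union>Us\<in>I. {S \<in> space config_algebra. \<forall>i\<in>{..<k}. locally_finite_set S \<and> S \<inter> (B \<inter> Us ! i) \<noteq> {}})"
      (is "?L = ?R")
    proof (intro subset_antisym subsetI)
      fix S assume "S \<in> ?L"
      then have S: "locally_finite_set S" "k \<le> card (S \<inter> B)" by auto
      have "finite (S \<inter> B)" using S B by (auto intro: locally_finite_set_Int)
      then obtain F where F: "F \<subseteq> S \<inter> B" "card F = k" "finite F"
        using obtain_subset_with_card_n[OF S(2)] by metis
      obtain xs where xs: "set xs = F" "distinct xs" "length xs = k"
        using F finite_distinct_list distinct_card by metis
      obtain U where U: "\<forall>x\<in>F. U x \<in> Bs \<and> x \<in> U x" "\<forall>x\<in>F. \<forall>y\<in>F. x \<noteq> y \<longrightarrow> U x \<inter> U y = {}"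
        using finite_separating_basis[OF Bs(2) F(3)] by metis
      have in_F: "xs ! i \<in> F" if "i < k" for i using xs that nth_mem by blast
      moreover have "xs ! i \<noteq> xs ! j" if "i < k" "j < k" "i \<noteq> j" for i j
        using xs that by (simp add: nth_eq_iff_index_eq)
      ultimately have "map U xs \<in> I" using U xs unfolding I_def by auto
      moreover have "xs ! i \<in> S \<inter> (B \<inter> map U xs ! i)" if "i < k" for i
        using that xs F U in_F[OF that] by auto
      ultimately show "S \<in> ?R" using S by fastforce
    next
      fix S assume "S \<in> ?R"
      then obtain Us where Us: "Us \<in> I" "locally_finite_set S"
        "\<And>i. i < k \<Longrightarrow> S \<inter> (B \<inter> Us ! i) \<noteq> {}" by auto
      then have "\<forall>i. \<exists>x. i < k \<longrightarrow> x \<in> S \<inter> (B \<inter> Us ! i)" by blast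
      then obtain x where x: "\<And>i. i < k \<Longrightarrow> x i \<in> S \<inter> (B \<inter> Us ! i)" by metis
      have inj: "inj_on x {..<k}"
      proof (rule inj_onI)
        fix i j assume ij: "i \<in> {..<k}" "j \<in> {..<k}" "x i = x j"
        then have "x i \<in> Us ! i \<inter> Us ! j" using x[of i] x[of j] by auto
        then show "i = j" using Us(1) ij unfolding I_def by auto
      qed
      have "k = card (x ` {..<k})" using card_image[OF inj] by simp
      also have "\<dots> \<le> card (S \<inter> B)"
        using x Us(2) B by (intro card_mono locally_finite_set_Int) auto
      finally show "S \<in> ?L" using Us by auto
    qed
    also have "\<dots> \<in> sets config_algebra"
    proof (rule sets.countable_UN'[OF \<open>countable I\<close>], safe intro!: sets.sets_Collect_finite_All)
      fix Us i assume "Us \<in> I" "i < k"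
      then have "Us ! i \<in> Bs" by (auto simp: I_def)
      from hit[OF this] show "{S \<in> space config_algebra. locally_finite_set S \<and> S \<inter> (B \<inter> Us ! i) \<noteq> {}} \<in> sets config_algebra"
        by simp
    qed
    finally show ?thesis .
  qed
  show ?thesis
  proof (subst measurable_count_space_eq2_countable, safe)
    fix k
    have "(\<lambda>S. card (S \<inter> B)) -` {k} \<inter> space config_algebra =
      {S. locally_finite_set S \<and> k \<le> card (S \<inter> B)} - {S. locally_finite_set S \<and> Suc k \<le> card (S \<inter> B)}"
      by auto
    then show "(\<lambda>S. card (S \<inter> B)) -` {k} \<inter> space config_algebra \<in> sets config_algebra"
      using ge by auto
  qed auto
qed

lemma nn_integral_count_space_indicator_bounded:
  assumes "locally_finite_set S" "bounded C"
  shows "(\<integral>\<^sup>+y. indicator C y \<partial>count_space S) = of_nat (card (S \<inter> C))"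
proof -
  have fin: "finite (S \<inter> C)" using assms by (rule locally_finite_set_Int)
  have "(\<integral>\<^sup>+y. indicator C y \<partial>count_space S) = (\<integral>\<^sup>+y. indicator (S \<inter> C) y \<partial>count_space S)"
    by (intro nn_integral_cong) (auto split: split_indicator)
  also have "\<dots> = of_nat (card (S \<inter> C))"
    using fin by (subst nn_integral_indicator) (auto simp: emeasure_count_space)
  finally show ?thesis .
qed

lemma SUP_mult_indicator_ball:
  fixes c :: ennreal and x :: "'a::real_normed_vector"
  shows "(SUP j. c * indicator (ball 0 (real j)) x) = c"
proof (rule antisym)
  obtain j where "norm x < real j" using reals_Archimedean2 by blast
  then have "c \<le> c * indicator (ball 0 (real j)) x" by simp
  then show "c \<le> (SUP j. c * indicator (ball 0 (real j)) x)" by (rule SUP_upper2[rotated]) simp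
qed (auto intro!: SUP_least split: split_indicator)

lemma incseq_mult_indicator_ball:
  fixes c :: "'a::real_normed_vector \<Rightarrow> ennreal"
  shows "incseq (\<lambda>j x. c x * indicator (ball 0 (real j)) x)"
  by (auto simp: incseq_def le_fun_def split: split_indicator)

text \<open>Truncation to a ball makes the sum finite by local finiteness. Finiteness is what allows
  the complement step of the Dynkin argument, which subtracts one sum from another. The radius is
  sent to infinity only afterwards.\<close>

lemma borel_measurable_sum_config_indicator:
  fixes S :: "'k \<Rightarrow> 'a::euclidean_space set"
  assumes S: "S \<in> measurable K config_algebra" and A: "A \<in> sets (K \<Otimes>\<^sub>M borel)"
  shows "(\<lambda>p. \<integral>\<^sup>+y. indicator A (p, y) * indicator (ball 0 (real j)) y \<partial>count_space (S p))
    \<in> borel_measurable K" (is "?f A \<in> _")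
proof -
  have lf: "locally_finite_set (S p)" if "p \<in> space K" for p
    using measurable_space[OF S that] by simp
  have card_meas: "(\<lambda>p. of_nat (card (S p \<inter> B)) :: ennreal) \<in> borel_measurable K"
    if "B \<in> sets borel" "bounded B" for B
    using measurable_compose[OF measurable_compose[OF S measurable_card_Int[OF that]],
      of of_nat "borel :: ennreal measure"] by simp
  have ball_eq: "(\<integral>\<^sup>+y. indicator (ball 0 (real j)) y \<partial>count_space (S p)) = of_nat (card (S p \<inter> ball 0 (real j)))"
    if "p \<in> space K" for p
    by (rule nn_integral_count_space_indicator_bounded) (use lf[OF that] in auto)
  show ?thesis
    using Int_stable_pair_measure_generator pair_measure_closed A
    unfolding sets_pair_measure
  proof (induction rule: sigma_sets_induct_disjoint)
    case (basic A)
    then obtain a b where ab: "A = a \<times> b" "a \<in> sets K" "b \<in> sets borel" by auto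
    have "?f A p = indicator a p * of_nat (card (S p \<inter> (b \<inter> ball 0 (real j))))" if "p \<in> space K" for p
    proof -
      have "?f A p = (\<integral>\<^sup>+y. indicator a p * indicator (b \<inter> ball 0 (real j)) y \<partial>count_space (S p))"
        unfolding ab by (intro nn_integral_cong) (auto split: split_indicator)
      also have "\<dots> = indicator a p * (\<integral>\<^sup>+y. indicator (b \<inter> ball 0 (real j)) y \<partial>count_space (S p))"
        by (rule nn_integral_cmult) simp
      also have "(\<integral>\<^sup>+y. indicator (b \<inter> ball 0 (real j)) y \<partial>count_space (S p)) = of_nat (card (S p \<inter> (b \<inter> ball 0 (real j))))"
        by (rule nn_integral_count_space_indicator_bounded) (use lf[OF that] in \<open>auto intro: bounded_subset\<close>)
      finally show ?thesis .
    qed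
    moreover have "(\<lambda>p. indicator a p * of_nat (card (S p \<inter> (b \<inter> ball 0 (real j)))) :: ennreal) \<in> borel_measurable K"
      using ab card_meas[of "b \<inter> ball 0 (real j)"]
      by (intro borel_measurable_times_ennreal borel_measurable_indicator) (auto intro: bounded_subset)
    ultimately show ?case by (subst measurable_cong) auto
  next
    case empty
    then show ?case by simp
  next
    case (compl A)
    have fin: "?f A p \<noteq> \<infinity>" if "p \<in> space K" for p
    proof -
      have "?f A p \<le> (\<integral>\<^sup>+y. indicator (ball 0 (real j)) y \<partial>count_space (S p))"
        by (intro nn_integral_mono) (auto split: split_indicator)
      then show ?thesis unfolding ball_eq[OF that]
        by (metis ennreal_of_nat_neq_top infinity_ennreal_def neq_top_trans)
    qed
    have "?f (space K \<times> space borel - A) p = of_nat (card (S p \<inter> ball 0 (real j))) - ?f A p"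
      if "p \<in> space K" for p
      unfolding ball_eq[OF that, symmetric]
      by (subst nn_integral_diff[symmetric])
         (use fin[OF that] that in \<open>auto intro!: nn_integral_cong split: split_indicator\<close>)
    moreover have "(\<lambda>p. of_nat (card (S p \<inter> ball 0 (real j))) - ?f A p) \<in> borel_measurable K"
      by (intro borel_measurable_minus_ennreal compl card_meas) auto
    ultimately show ?case by (subst measurable_cong) auto
  next
    case (union A)
    have "?f (\<Union>i. A i) p = (\<Sum>i. ?f (A i) p)" for p
      by (subst nn_integral_suminf[symmetric])
         (auto intro!: nn_integral_cong simp: suminf_indicator[OF union(1), symmetric])
    with union show ?case by simp
  qed
qed

lemma borel_measurable_sum_config:
  fixes S :: "'k \<Rightarrow> 'a::euclidean_space set"
  assumes h: "h \<in> borel_measurable (K \<Otimes>\<^sub>M borel)" and S: "S \<in> measurable K config_algebra"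
  shows "(\<lambda>p. \<integral>\<^sup>+y. h (p, y) \<partial>count_space (S p)) \<in> borel_measurable K"
  using h
proof (induction rule: borel_measurable_induct)
  case (cong f g)
  then show ?case
    by (subst measurable_cong[of K _ "\<lambda>p. \<integral>\<^sup>+y. g (p, y) \<partial>count_space (S p)"])
       (auto intro!: nn_integral_cong simp: space_pair_measure)
next
  case (set A)
  have "(\<lambda>p. SUP j. \<integral>\<^sup>+y. indicator A (p, y) * indicator (ball 0 (real j)) y \<partial>count_space (S p))
      \<in> borel_measurable K"
    by (intro borel_measurable_SUP borel_measurable_sum_config_indicator S set) auto
  also have "(\<lambda>p. SUP j. \<integral>\<^sup>+y. indicator A (p, y) * indicator (ball 0 (real j)) y \<partial>count_space (S p)) =
    (\<lambda>p. \<integral>\<^sup>+y. indicator A (p, y) \<partial>count_space (S p))"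
    by (subst nn_integral_monotone_convergence_SUP[symmetric])
       (simp_all add: SUP_mult_indicator_ball incseq_mult_indicator_ball)
  finally show ?case .
next
  case (mult u c)
  then show ?case by (simp add: nn_integral_cmult)
next
  case (add u v)
  then show ?case by (simp add: nn_integral_add)
next
  case (seq U)
  have "(\<lambda>p. \<integral>\<^sup>+y. (SUP i. U i) (p, y) \<partial>count_space (S p)) = (\<lambda>p. SUP i. \<integral>\<^sup>+y. U i (p, y) \<partial>count_space (S p))"
    using seq(3) by (subst nn_integral_monotone_convergence_SUP[symmetric])
       (auto simp: incseq_def le_fun_def image_comp intro!: ext nn_integral_cong)
  with seq show ?case by simp
qed

section \<open>Adding a point, Poisson laws and the Mecke formula for one point\<close>

lemma measurable_config_algebraI:
  fixes S :: "'k \<Rightarrow> 'a::euclidean_space set"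
  assumes "\<And>p. p \<in> space K \<Longrightarrow> locally_finite_set (S p)"
    and "\<And>V. V \<in> sets borel \<Longrightarrow> bounded V \<Longrightarrow> {p \<in> space K. S p \<inter> V = {}} \<in> sets K"
  shows "S \<in> measurable K config_algebra"
  unfolding config_algebra_def
proof (rule measurable_measure_of)
  fix A :: "'a set set" assume "A \<in> {{S. locally_finite_set S \<and> S \<inter> V = {}} | V. V \<in> sets borel \<and> bounded V}"
  then obtain V where V: "A = {S. locally_finite_set S \<and> S \<inter> V = {}}" "V \<in> sets borel" "bounded V" by auto
  then have "S -` A \<inter> space K = {p \<in> space K. S p \<inter> V = {}}" using assms(1) by auto
  then show "S -` A \<inter> space K \<in> sets K" using assms(2)[OF V(2,3)] by simp
qed (use assms(1) in auto)

lemma measurable_insert_config: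
  fixes S :: "'k \<Rightarrow> 'a::euclidean_space set"
  assumes S: "S \<in> measurable K config_algebra" and x [measurable]: "x \<in> measurable K borel"
  shows "(\<lambda>p. insert (x p) (S p)) \<in> measurable K config_algebra"
proof (rule measurable_config_algebraI)
  fix V :: "'a set" assume [measurable]: "V \<in> sets borel" and "bounded V"
  from measurable_sets[OF S void_in_sets[OF this]]
  have "{p \<in> space K. S p \<inter> V = {}} \<in> sets K"
    by (rule back_subst[of "\<lambda>A. A \<in> sets K"]) (use measurable_space[OF S] in auto)
  moreover have "{p \<in> space K. x p \<notin> V} \<in> sets K" by measurable
  ultimately have "{p \<in> space K. S p \<inter> V = {}} \<inter> {p \<in> space K. x p \<notin> V} \<in> sets K" by auto
  then show "{p \<in> space K. insert (x p) (S p) \<inter> V = {}} \<in> sets K"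
    by (rule back_subst[of "\<lambda>A. A \<in> sets K"]) auto
qed (use measurable_space[OF S] in \<open>auto intro: locally_finite_set_insert\<close>)

text \<open>Working with the law on configurations makes \<open>insert x S\<close> a map of the
  sample space itself. The two numerical assumptions are what evaluates the two sides of the Mecke
  formula on the generator: a void probability, and the mean number of points of \<open>C\<close> on
  the event that a disjoint \<open>V\<close> is empty.\<close>

locale poisson_law = prob_space P
  for P :: "'a::euclidean_space set measure" and \<gamma> :: real +
  assumes sets_P: "sets P = sets config_algebra"
    and intensity_nonneg: "\<gamma> \<ge> 0"
    and emeasure_void: "V \<in> sets borel \<Longrightarrow> bounded V \<Longrightarrow>
      emeasure P {S. locally_finite_set S \<and> S \<inter> V = {}} = ennreal (exp (- (\<gamma> * measure lborel V)))"
    and mean_card_void: "C \<in> sets borel \<Longrightarrow> bounded C \<Longrightarrow> V \<in> sets borel \<Longrightarrow> bounded V \<Longrightarrow> C \<inter> V = {} \<Longrightarrow>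
      (\<integral>\<^sup>+S. of_nat (card (S \<inter> C)) * indicator {S. locally_finite_set S \<and> S \<inter> V = {}} S \<partial>P) =
      ennreal (\<gamma> * measure lborel C * exp (- (\<gamma> * measure lborel V)))"
begin

lemma space_P: "space P = Collect locally_finite_set"
  using sets_eq_imp_space_eq[OF sets_P] by simp

lemma measurable_config_ident: "(\<lambda>S. S) \<in> measurable P config_algebra"
  by (rule measurable_ident_sets[OF sets_P])

lemma pair_cong: "sets (P \<Otimes>\<^sub>M N) = sets (config_algebra \<Otimes>\<^sub>M N)"
  by (rule sets_pair_measure_cong) (auto simp: sets_P)

text \<open>Products of a Borel set with a void event form an intersection-stable generator, and on them the
  formula only involves mean numbers of points and void probabilities.\<close>

lemma mecke_indicator:
  assumes A: "A \<in> sets (config_algebra \<Otimes>\<^sub>M borel)"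
  shows "(\<integral>\<^sup>+S. \<integral>\<^sup>+x. indicator A (S, x) * indicator (ball 0 (real j)) x \<partial>count_space S \<partial>P) =
    ennreal \<gamma> * (\<integral>\<^sup>+x. \<integral>\<^sup>+S. indicator A (insert x S, x) * indicator (ball 0 (real j)) x \<partial>P \<partial>lborel)"
    (is "?L A = ennreal \<gamma> * ?R A")
proof -
  let ?voids = "{{S :: 'a set. locally_finite_set S \<and> S \<inter> V = {}} | V. V \<in> sets borel \<and> bounded V}"
  let ?G = "{a \<times> (b :: 'a set) | a b. a \<in> ?voids \<and> b \<in> sets borel}"
  let ?B = "ball (0::'a) (real j)"
  have B: "?B \<in> sets borel" "bounded ?B" "measure lborel ?B < \<infinity>" by auto
  have meas_L: "(\<lambda>S. \<integral>\<^sup>+x. indicator A (S, x) * indicator ?B x \<partial>count_space S) \<in> borel_measurable P"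
    if "A \<in> sets (config_algebra \<Otimes>\<^sub>M borel)" for A
    by (rule borel_measurable_sum_config_indicator[OF measurable_config_ident]) (simp only: pair_cong that)
  have meas_ins: "(\<lambda>(x, S). (insert x S, x)) \<in> measurable (lborel \<Otimes>\<^sub>M P) (config_algebra \<Otimes>\<^sub>M borel)"
    unfolding split_beta
    by (intro measurable_Pair measurable_insert_config measurable_compose[OF measurable_snd measurable_config_ident]) simp_all
  have meas_R2: "(\<lambda>(x, S). indicator A (insert x S, x) * indicator ?B x :: ennreal) \<in> borel_measurable (lborel \<Otimes>\<^sub>M P)"
    if "A \<in> sets (config_algebra \<Otimes>\<^sub>M borel)" for A
    using measurable_compose[OF meas_ins borel_measurable_indicator[OF that]]
    unfolding split_beta
    by (intro borel_measurable_times_ennreal measurable_compose[OF measurable_fst borel_measurable_indicator]) simp_all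
  have meas_R: "(\<lambda>x. \<integral>\<^sup>+S. indicator A (insert x S, x) * indicator ?B x \<partial>P) \<in> borel_measurable lborel"
    if "A \<in> sets (config_algebra \<Otimes>\<^sub>M borel)" for A
    using borel_measurable_nn_integral[OF meas_R2[OF that]] by simp
  have meas_R1: "(\<lambda>S. indicator A (insert x S, x) * indicator ?B x :: ennreal) \<in> borel_measurable P"
    if "A \<in> sets (config_algebra \<Otimes>\<^sub>M borel)" for A x
    using measurable_compose[OF measurable_Pair1' meas_R2[OF that], of x] by simp
  have gen: "sigma_sets (space config_algebra \<times> space borel) ?G = sets (config_algebra \<Otimes>\<^sub>M (borel :: 'a measure))"
  proof -
    have void_UNIV: "Collect locally_finite_set \<in> ?voids"
      by (rule CollectI, rule exI[of _ "{}"]) auto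
    have "sets (config_algebra \<Otimes>\<^sub>M (borel :: 'a measure)) = sets (sigma (space config_algebra \<times> space borel) ?G)"
      by (rule sets_pair_eq[where Ca = "{Collect locally_finite_set}" and Cb = "{UNIV}"])
         (use void_UNIV sets.sigma_sets_eq[of "borel :: 'a measure"] in \<open>auto simp: sets_config_algebra\<close>)
    also have "\<dots> = sigma_sets (space config_algebra \<times> space borel) ?G"
      by (rule sets_measure_of) auto
    finally show ?thesis by simp
  qed
  have stable: "Int_stable ?G"
  proof (rule Int_stableI)
    fix x y assume "x \<in> ?G" "y \<in> ?G"
    then obtain V b V' b' where *: "x = {S. locally_finite_set S \<and> S \<inter> V = {}} \<times> b" "V \<in> sets borel" "bounded V" "b \<in> sets borel"
      "y = {S. locally_finite_set S \<and> S \<inter> V' = {}} \<times> b'" "V' \<in> sets borel" "bounded V'" "b' \<in> sets borel"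
      by auto
    then have "x \<inter> y = {S. locally_finite_set S \<and> S \<inter> (V \<union> V') = {}} \<times> (b \<inter> b')" by auto
    moreover have "V \<union> V' \<in> sets borel" "bounded (V \<union> V')" "b \<inter> b' \<in> sets borel" using * by auto
    ultimately show "x \<inter> y \<in> ?G" by blast
  qed
  have closed: "?G \<subseteq> Pow (space config_algebra \<times> space borel)" by auto
  have full: "?L (space config_algebra \<times> space borel) = ennreal (\<gamma> * measure lborel ?B)"
  proof -
    have "?L (space config_algebra \<times> space borel) =
      (\<integral>\<^sup>+S. of_nat (card (S \<inter> ?B)) * indicator {S. locally_finite_set S \<and> S \<inter> {} = {}} S \<partial>P)"
      by (intro nn_integral_cong) (simp add: space_P nn_integral_count_space_indicator_bounded)
    also have "\<dots> = ennreal (\<gamma> * measure lborel ?B)"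
      using mean_card_void[of ?B "{}"] B by simp
    finally show ?thesis .
  qed
  have fullR: "ennreal \<gamma> * ?R (space config_algebra \<times> space borel) = ennreal (\<gamma> * measure lborel ?B)"
  proof -
    have "?R (space config_algebra \<times> space borel) = (\<integral>\<^sup>+x. \<integral>\<^sup>+S. indicator ?B x \<partial>P \<partial>lborel)"
      by (intro nn_integral_cong) (auto simp: space_P locally_finite_set_insert split: split_indicator)
    also have "\<dots> = ennreal (measure lborel ?B)"
      using B emeasure_bounded_finite[OF B(2)] by (simp add: emeasure_space_1 emeasure_eq_ennreal_measure)
    finally show ?thesis using intensity_nonneg by (simp add: ennreal_mult)
  qed
  have G_eq: "?L A = ennreal \<gamma> * ?R A" if A_G: "A \<in> ?G" for A
  proof -
    obtain V b where A: "A = {S. locally_finite_set S \<and> S \<inter> V = {}} \<times> b"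
      and V: "V \<in> sets borel" "bounded V" and b: "b \<in> sets borel"
      using A_G by auto
    \<comment> \<open>Removing \<open>V\<close> affects neither side: a configuration that misses
      \<open>V\<close> has no points there, and \<open>insert x S\<close> can miss \<open>V\<close>
      only if \<open>x\<close> lies outside it.\<close>
    let ?C = "b \<inter> ?B - V"
    have C: "?C \<in> sets borel" "bounded ?C" using V b by (auto intro: bounded_subset)
    have "?L A = (\<integral>\<^sup>+S. of_nat (card (S \<inter> ?C)) * indicator {S. locally_finite_set S \<and> S \<inter> V = {}} S \<partial>P)"
    proof (intro nn_integral_cong)
      fix S assume "S \<in> space P"
      then have S: "locally_finite_set S" by (simp add: space_P)
      have "(\<integral>\<^sup>+x. indicator A (S, x) * indicator ?B x \<partial>count_space S) =
        (\<integral>\<^sup>+x. indicator ?C x * indicator {S. locally_finite_set S \<and> S \<inter> V = {}} S \<partial>count_space S)"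
        unfolding A by (intro nn_integral_cong) (auto split: split_indicator)
      also have "\<dots> = (\<integral>\<^sup>+x. indicator ?C x \<partial>count_space S) * indicator {S. locally_finite_set S \<and> S \<inter> V = {}} S"
        by (rule nn_integral_multc) simp
      finally show "(\<integral>\<^sup>+x. indicator A (S, x) * indicator ?B x \<partial>count_space S) =
        of_nat (card (S \<inter> ?C)) * indicator {S. locally_finite_set S \<and> S \<inter> V = {}} S"
        using nn_integral_count_space_indicator_bounded[OF S C(2)] by simp
    qed
    also have "\<dots> = ennreal (\<gamma> * measure lborel ?C * exp (- (\<gamma> * measure lborel V)))"
      by (rule mean_card_void) (use C V in auto)
    finally have L: "?L A = \<dots>" .
    have "?R A = (\<integral>\<^sup>+x. \<integral>\<^sup>+S. indicator ?C x * indicator {S. locally_finite_set S \<and> S \<inter> V = {}} S \<partial>P \<partial>lborel)"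
      unfolding A by (intro nn_integral_cong) (auto simp: space_P locally_finite_set_insert split: split_indicator)
    also have "\<dots> = (\<integral>\<^sup>+x. indicator ?C x * ennreal (exp (- (\<gamma> * measure lborel V))) \<partial>lborel)"
      using V by (subst nn_integral_cmult_indicator) (simp_all add: sets_P void_in_sets emeasure_void)
    also have "\<dots> = emeasure lborel ?C * ennreal (exp (- (\<gamma> * measure lborel V)))"
      using C by (simp add: nn_integral_multc)
    also have "emeasure lborel ?C = ennreal (measure lborel ?C)"
      using emeasure_bounded_finite[OF C(2)] by (simp add: emeasure_eq_ennreal_measure)
    finally show ?thesis using L intensity_nonneg by (simp add: ennreal_mult mult.assoc)
  qed
  \<comment> \<open>Both sides are dominated by their values on the whole space, which are finite
    because of the ball. The complement step needs this to cancel a summand in the extended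
    reals.\<close>
  have fin: "?L A \<noteq> \<infinity>" "ennreal \<gamma> * ?R A \<noteq> \<infinity>" for A
  proof -
    have "?L A \<le> ?L (space config_algebra \<times> space borel)"
      by (intro nn_integral_mono) (auto simp: space_P split: split_indicator)
    then show "?L A \<noteq> \<infinity>" unfolding full by (auto simp: top_unique)
    have "?R A \<le> ?R (space config_algebra \<times> space borel)"
      by (intro nn_integral_mono) (auto simp: space_P locally_finite_set_insert split: split_indicator)
    then have "ennreal \<gamma> * ?R A \<le> ennreal \<gamma> * ?R (space config_algebra \<times> space borel)"
      by (rule mult_left_mono) simp
    then show "ennreal \<gamma> * ?R A \<noteq> \<infinity>" unfolding fullR by (auto simp: top_unique)
  qed
  show ?thesis
    using stable closed A[folded gen]
  proof (induction rule: sigma_sets_induct_disjoint)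
    case (basic A)
    then show ?case by (rule G_eq)
  next
    case empty
    then show ?case by simp
  next
    case (compl A)
    have A: "A \<in> sets (config_algebra \<Otimes>\<^sub>M borel)" using compl gen by simp
    let ?X = "space config_algebra \<times> space borel"
    have X: "?X \<in> sets (config_algebra \<Otimes>\<^sub>M borel)" using sets.top[of "config_algebra \<Otimes>\<^sub>M borel"]
      by (simp add: space_pair_measure)
    have "?L A + ?L (?X - A) = ?L ?X"
      by (subst nn_integral_add[symmetric], (intro meas_L sets.Diff A X)+,
          intro nn_integral_cong, subst nn_integral_add[symmetric])
         (auto intro!: nn_integral_cong simp: space_P split: split_indicator)
    moreover have "ennreal \<gamma> * ?R A + ennreal \<gamma> * ?R (?X - A) = ennreal \<gamma> * ?R ?X"
      unfolding distrib_left[symmetric]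
      by (subst nn_integral_add[symmetric], (intro meas_R sets.Diff A X)+,
          intro arg_cong[where f="\<lambda>x. _ * x"] nn_integral_cong, subst nn_integral_add[symmetric],
          (intro meas_R1 sets.Diff A X)+)
         (auto intro!: nn_integral_cong simp: space_P locally_finite_set_insert split: split_indicator)
    ultimately have "?L A + ?L (?X - A) = ?L A + ennreal \<gamma> * ?R (?X - A)"
      using full fullR compl by simp
    then show ?case using fin(1) by (simp add: ennreal_add_left_cancel)
  next
    case (union A)
    have A: "A i \<in> sets (config_algebra \<Otimes>\<^sub>M borel)" for i using union(2) gen by auto
    have "?L (\<Union>i. A i) = (\<Sum>i. ?L (A i))"
      by (subst nn_integral_suminf[symmetric, OF meas_L[OF A]], intro nn_integral_cong, subst nn_integral_suminf[symmetric])
         (auto intro!: nn_integral_cong simp: suminf_indicator[OF union(1), symmetric])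
    moreover have "?R (\<Union>i. A i) = (\<Sum>i. ?R (A i))"
      by (subst nn_integral_suminf[symmetric, OF meas_R[OF A]], intro nn_integral_cong, subst nn_integral_suminf[symmetric, OF meas_R1[OF A]])
         (auto intro!: nn_integral_cong simp: suminf_indicator[OF union(1), symmetric])
    ultimately show ?case using union(3) by (simp add: ennreal_suminf_cmult)
  qed
qed

theorem mecke:
  assumes f: "f \<in> borel_measurable (config_algebra \<Otimes>\<^sub>M borel)"
  shows "(\<integral>\<^sup>+S. \<integral>\<^sup>+x. f (S, x) \<partial>count_space S \<partial>P) =
    ennreal \<gamma> * (\<integral>\<^sup>+x. \<integral>\<^sup>+S. f (insert x S, x) \<partial>P \<partial>lborel)"
proof -
  have meas_L: "(\<lambda>S. \<integral>\<^sup>+x. f (S, x) \<partial>count_space S) \<in> borel_measurable P"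
    if "f \<in> borel_measurable (config_algebra \<Otimes>\<^sub>M borel)" for f
    by (rule borel_measurable_sum_config[OF _ measurable_config_ident])
       (use that in \<open>simp add: measurable_cong_sets[OF pair_cong refl]\<close>)
  have meas_ins: "(\<lambda>(x, S). (insert x S, x)) \<in> measurable (lborel \<Otimes>\<^sub>M P) (config_algebra \<Otimes>\<^sub>M borel)"
    unfolding split_beta
    by (intro measurable_Pair measurable_insert_config measurable_compose[OF measurable_snd measurable_config_ident]) simp_all
  have meas_R2: "(\<lambda>(x, S). f (insert x S, x)) \<in> borel_measurable (lborel \<Otimes>\<^sub>M P)"
    if "f \<in> borel_measurable (config_algebra \<Otimes>\<^sub>M borel)" for f :: "_ \<Rightarrow> ennreal"
    using measurable_compose[OF meas_ins that] by (simp add: split_beta)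
  have meas_R: "(\<lambda>x. \<integral>\<^sup>+S. f (insert x S, x) \<partial>P) \<in> borel_measurable lborel"
    if "f \<in> borel_measurable (config_algebra \<Otimes>\<^sub>M borel)" for f :: "_ \<Rightarrow> ennreal"
    using borel_measurable_nn_integral[OF meas_R2[OF that]] by simp
  have meas_R1: "(\<lambda>S. f (insert x S, x)) \<in> borel_measurable P"
    if "f \<in> borel_measurable (config_algebra \<Otimes>\<^sub>M borel)" for f :: "_ \<Rightarrow> ennreal" and x
    using measurable_compose[OF measurable_Pair1' meas_R2[OF that], of x] by simp
  \<comment> \<open>This monotone limit serves twice: for the growing balls that remove the
    truncation of an indicator, and for the suprema of the standard induction over nonnegative
    measurable functions.\<close>
  have seq_case: "(\<integral>\<^sup>+S. \<integral>\<^sup>+x. (SUP i. U i (S, x)) \<partial>count_space S \<partial>P) =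
    ennreal \<gamma> * (\<integral>\<^sup>+x. \<integral>\<^sup>+S. (SUP i. U i (insert x S, x)) \<partial>P \<partial>lborel)"
    if U: "\<And>i. U i \<in> borel_measurable (config_algebra \<Otimes>\<^sub>M borel)" "incseq U"
      and eq: "\<And>i. (\<integral>\<^sup>+S. \<integral>\<^sup>+x. U i (S, x) \<partial>count_space S \<partial>P) =
        ennreal \<gamma> * (\<integral>\<^sup>+x. \<integral>\<^sup>+S. U i (insert x S, x) \<partial>P \<partial>lborel)"
    for U :: "nat \<Rightarrow> 'a set \<times> 'a \<Rightarrow> ennreal"
  proof -
    have mono: "i \<le> j \<Longrightarrow> U i z \<le> U j z" for i j z using U(2) by (metis incseq_def le_funD)
    have "(\<integral>\<^sup>+S. \<integral>\<^sup>+x. (SUP i. U i (S, x)) \<partial>count_space S \<partial>P) =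
      (\<integral>\<^sup>+S. (SUP i. \<integral>\<^sup>+x. U i (S, x) \<partial>count_space S) \<partial>P)"
      using mono by (intro nn_integral_cong nn_integral_monotone_convergence_SUP) (auto simp: incseq_def le_fun_def)
    also have "\<dots> = (SUP i. \<integral>\<^sup>+S. \<integral>\<^sup>+x. U i (S, x) \<partial>count_space S \<partial>P)"
      using mono by (intro nn_integral_monotone_convergence_SUP meas_L U) (auto simp: incseq_def le_fun_def intro!: nn_integral_mono)
    also have "\<dots> = (SUP i. ennreal \<gamma> * (\<integral>\<^sup>+x. \<integral>\<^sup>+S. U i (insert x S, x) \<partial>P \<partial>lborel))"
      using eq by simp
    also have "\<dots> = ennreal \<gamma> * (SUP i. \<integral>\<^sup>+x. \<integral>\<^sup>+S. U i (insert x S, x) \<partial>P \<partial>lborel)"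
      by (simp add: SUP_mult_left_ennreal)
    also have "(SUP i. \<integral>\<^sup>+x. \<integral>\<^sup>+S. U i (insert x S, x) \<partial>P \<partial>lborel) =
      (\<integral>\<^sup>+x. (SUP i. \<integral>\<^sup>+S. U i (insert x S, x) \<partial>P) \<partial>lborel)"
      using mono by (intro nn_integral_monotone_convergence_SUP[symmetric] meas_R U) (auto simp: incseq_def le_fun_def intro!: nn_integral_mono)
    also have "\<dots> = (\<integral>\<^sup>+x. \<integral>\<^sup>+S. (SUP i. U i (insert x S, x)) \<partial>P \<partial>lborel)"
      using mono by (intro nn_integral_cong nn_integral_monotone_convergence_SUP[symmetric] meas_R1 U) (auto simp: incseq_def le_fun_def)
    finally show ?thesis .
  qed
  show ?thesis
    using f
  proof (induction rule: borel_measurable_induct)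
    case (cong f g)
    have "(\<integral>\<^sup>+S. \<integral>\<^sup>+x. f (S, x) \<partial>count_space S \<partial>P) = (\<integral>\<^sup>+S. \<integral>\<^sup>+x. g (S, x) \<partial>count_space S \<partial>P)"
      using cong(3) by (intro nn_integral_cong) (auto simp: space_pair_measure space_P)
    moreover have "(\<integral>\<^sup>+x. \<integral>\<^sup>+S. f (insert x S, x) \<partial>P \<partial>lborel) = (\<integral>\<^sup>+x. \<integral>\<^sup>+S. g (insert x S, x) \<partial>P \<partial>lborel)"
      using cong(3) by (intro nn_integral_cong) (auto simp: space_pair_measure space_P locally_finite_set_insert)
    ultimately show ?case using cong(4) by simp
  next
    case (set A)
    have "(\<lambda>z. indicator A z * indicator (ball 0 (real j)) (snd z) :: ennreal)
        \<in> borel_measurable (config_algebra \<Otimes>\<^sub>M (borel :: 'a measure))" for j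
      using set by (intro borel_measurable_times_ennreal borel_measurable_indicator
        measurable_compose[OF measurable_snd borel_measurable_indicator]) auto
    from seq_case[of "\<lambda>j z. indicator A z * indicator (ball 0 (real j)) (snd z)", OF this]
    show ?case using mecke_indicator[OF set]
      by (simp add: SUP_mult_indicator_ball)
         (auto simp: incseq_def le_fun_def split: split_indicator)
  next
    case (mult u c)
    have "(\<integral>\<^sup>+S. \<integral>\<^sup>+x. c * u (S, x) \<partial>count_space S \<partial>P) = c * (\<integral>\<^sup>+S. \<integral>\<^sup>+x. u (S, x) \<partial>count_space S \<partial>P)"
      by (simp add: nn_integral_cmult meas_L[OF mult(2)])
    moreover have "(\<integral>\<^sup>+x. \<integral>\<^sup>+S. c * u (insert x S, x) \<partial>P \<partial>lborel) = c * (\<integral>\<^sup>+x. \<integral>\<^sup>+S. u (insert x S, x) \<partial>P \<partial>lborel)"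
      by (subst nn_integral_cmult[OF meas_R[OF mult(2)], symmetric],
          intro nn_integral_cong nn_integral_cmult meas_R1 mult)
    ultimately show ?case using mult(4) by (simp add: ac_simps)
  next
    case (add u v)
    have "(\<integral>\<^sup>+S. \<integral>\<^sup>+x. v (S, x) + u (S, x) \<partial>count_space S \<partial>P) =
        (\<integral>\<^sup>+S. \<integral>\<^sup>+x. v (S, x) \<partial>count_space S \<partial>P) + (\<integral>\<^sup>+S. \<integral>\<^sup>+x. u (S, x) \<partial>count_space S \<partial>P)"
      by (simp add: nn_integral_add meas_L add)
    moreover have "(\<integral>\<^sup>+x. \<integral>\<^sup>+S. v (insert x S, x) + u (insert x S, x) \<partial>P \<partial>lborel) =
        (\<integral>\<^sup>+x. \<integral>\<^sup>+S. v (insert x S, x) \<partial>P \<partial>lborel) + (\<integral>\<^sup>+x. \<integral>\<^sup>+S. u (insert x S, x) \<partial>P \<partial>lborel)"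
      by (subst nn_integral_add[symmetric], (rule meas_R, rule add)+,
          intro nn_integral_cong nn_integral_add meas_R1 add)
    ultimately show ?case using add by (simp add: distrib_left)
  next
    case (seq U)
    then show ?case using seq_case[of U] by (simp add: image_comp)
  qed
qed

end

section \<open>From the process to its law on configurations\<close>

lemma measurable_homogeneous_poisson_process:
  fixes X :: "'w \<Rightarrow> 'a::euclidean_space set"
  assumes X: "homogeneous_poisson_process M \<gamma> X"
  shows "X \<in> measurable M config_algebra"
proof (rule measurable_config_algebraI)
  show lf: "locally_finite_set (X \<omega>)" if "\<omega> \<in> space M" for \<omega>
    using X that by (simp add: homogeneous_poisson_process_def)
  fix V :: "'a set" assume V: "V \<in> sets borel" "bounded V"
  then have "(\<lambda>\<omega>. card (X \<omega> \<inter> V)) \<in> measurable M (count_space UNIV)"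
    using X by (simp add: homogeneous_poisson_process_def)
  from measurable_sets[OF this, of "{0}"]
  show "{\<omega> \<in> space M. X \<omega> \<inter> V = {}} \<in> sets M"
    by (rule back_subst[of "\<lambda>A. A \<in> sets M"])
       (use locally_finite_set_Int[OF lf V(2)] in auto)
qed

lemma poisson_mean_sums: "(\<lambda>k. real k * (l ^ k / fact k * exp (- l))) sums l"
proof -
  have "(\<lambda>k. l * exp (- l) * (l ^ k /\<^sub>R fact k)) sums (l * exp (- l) * exp l)"
    by (intro sums_mult exp_converges)
  also have "l * exp (- l) * exp l = l" by (simp add: exp_minus)
  also have "(\<lambda>k. l * exp (- l) * (l ^ k /\<^sub>R fact k)) =
      (\<lambda>k. real (Suc k) * (l ^ Suc k / fact (Suc k) * exp (- l)))"
    by (auto simp: field_simps fact_Suc simp del: of_nat_Suc)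
  finally show ?thesis by (subst (asm) sums_Suc_iff) simp
qed

text \<open>The count of \<open>C\<close> is decomposed by its value k. Independence splits the
  probability of "k points in \<open>C\<close>, none in \<open>V\<close>" into a product, and
  summing k times the Poisson weights gives the rate of \<open>C\<close>.\<close>

lemma poisson_law_distr:
  fixes X :: "'w \<Rightarrow> 'a::euclidean_space set"
  assumes X: "homogeneous_poisson_process M \<gamma> X" and \<gamma>: "\<gamma> \<ge> 0"
  shows "poisson_law (distr M config_algebra X) \<gamma>"
proof -
  interpret M: prob_space M using X by (simp add: homogeneous_poisson_process_def)
  note Xm = measurable_homogeneous_poisson_process[OF X]
  have lf: "locally_finite_set (X \<omega>)" if "\<omega> \<in> space M" for \<omega>
    using X that by (simp add: homogeneous_poisson_process_def)
  have card_m: "(\<lambda>\<omega>. card (X \<omega> \<inter> B)) \<in> measurable M (count_space UNIV)"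
    and card_p: "M.prob {\<omega> \<in> space M. card (X \<omega> \<inter> B) = k} =
             (\<gamma> * measure lborel B) ^ k / fact k * exp (- (\<gamma> * measure lborel B))"
    if "B \<in> sets borel" "bounded B" for B k
    using X that by (auto simp: homogeneous_poisson_process_def)
  have indep: "M.indep_vars (\<lambda>_. count_space UNIV) (\<lambda>i \<omega>. card (X \<omega> \<inter> B i)) I"
    if "finite I" "disjoint_family_on B I" "\<And>i. i \<in> I \<Longrightarrow> B i \<in> sets borel" "\<And>i. i \<in> I \<Longrightarrow> bounded (B i)"
    for I :: "nat set" and B
  proof -
    have "\<forall>(I :: nat set) B. finite I \<and> disjoint_family_on B I \<and> (\<forall>i\<in>I. B i \<in> sets borel \<and> bounded (B i)) \<longrightarrow>
        M.indep_vars (\<lambda>_. count_space UNIV) (\<lambda>i \<omega>. card (X \<omega> \<inter> B i)) I"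
      using X unfolding homogeneous_poisson_process_def by (elim conjE) assumption
    then show ?thesis using that by simp
  qed
  interpret D: prob_space "distr M config_algebra X" by (rule M.prob_space_distr[OF Xm])
  have zero_iff: "card (X \<omega> \<inter> V) = 0 \<longleftrightarrow> X \<omega> \<inter> V = {}" if "\<omega> \<in> space M" "bounded V" for \<omega> V
    using locally_finite_set_Int[OF lf[OF that(1)] that(2)] by simp
  show ?thesis
  proof
    show "sets (distr M config_algebra X) = sets config_algebra" by simp
    show "\<gamma> \<ge> 0" by fact
  next
    fix V :: "'a set" assume V: "V \<in> sets borel" "bounded V"
    have "emeasure (distr M config_algebra X) {S. locally_finite_set S \<and> S \<inter> V = {}} =
      emeasure M {\<omega> \<in> space M. card (X \<omega> \<inter> V) = 0}"
      by (subst emeasure_distr[OF Xm void_in_sets[OF V]])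
         (auto intro!: arg_cong[where f="emeasure M"] simp: lf zero_iff V)
    then show "emeasure (distr M config_algebra X) {S. locally_finite_set S \<and> S \<inter> V = {}} =
      ennreal (exp (- (\<gamma> * measure lborel V)))"
      using card_p[OF V, of 0] by (simp add: M.emeasure_eq_measure)
  next
    fix C V :: "'a set" assume C: "C \<in> sets borel" "bounded C" and V: "V \<in> sets borel" "bounded V"
      and disj: "C \<inter> V = {}"
    \<comment> \<open>Independence is stated for families indexed by natural numbers, so the two
      disjoint sets are indexed by 0 and 1.\<close>
    let ?B = "\<lambda>i::nat. if i = 0 then C else V"
    let ?E = "\<lambda>k. {\<omega> \<in> space M. card (X \<omega> \<inter> C) = k \<and> card (X \<omega> \<inter> V) = 0}"
    have E: "?E k \<in> sets M" for k
      using card_m[OF C] card_m[OF V] by measurable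
    have "M.indep_vars (\<lambda>_. count_space UNIV) (\<lambda>i \<omega>. card (X \<omega> \<inter> ?B i)) {0, 1}"
    proof (rule indep)
      show "disjoint_family_on ?B {0, 1}" using disj by (auto simp: disjoint_family_on_def)
    qed (use C V in auto)
    then have "M.prob (\<Inter>i\<in>{0, 1}. (\<lambda>\<omega>. card (X \<omega> \<inter> ?B i)) -` {if i = 0 then k else 0} \<inter> space M) =
      (\<Prod>i\<in>{0, 1::nat}. M.prob ((\<lambda>\<omega>. card (X \<omega> \<inter> ?B i)) -` {if i = 0 then k else 0} \<inter> space M))" for k
      by (rule M.indep_varsD) auto
    moreover have "(\<Inter>i\<in>{0, 1::nat}. (\<lambda>\<omega>. card (X \<omega> \<inter> ?B i)) -` {if i = 0 then k else 0} \<inter> space M) = ?E k" for k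
      by auto
    moreover have "(\<lambda>\<omega>. card (X \<omega> \<inter> B)) -` {k} \<inter> space M = {\<omega> \<in> space M. card (X \<omega> \<inter> B) = k}" for B k
      by auto
    ultimately have prob_E: "M.prob (?E k) = (\<gamma> * measure lborel C) ^ k / fact k * exp (- (\<gamma> * measure lborel C)) *
        exp (- (\<gamma> * measure lborel V))" for k
      using card_p[OF C, of k] card_p[OF V, of 0] by simp
    have "(\<integral>\<^sup>+S. of_nat (card (S \<inter> C)) * indicator {S. locally_finite_set S \<and> S \<inter> V = {}} S \<partial>distr M config_algebra X) =
      (\<integral>\<^sup>+\<omega>. of_nat (card (X \<omega> \<inter> C)) * indicator {S. locally_finite_set S \<and> S \<inter> V = {}} (X \<omega>) \<partial>M)"
    proof (rule nn_integral_distr[OF Xm])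
      have "(\<lambda>S. of_nat (card (S \<inter> C)) :: ennreal) \<in> borel_measurable config_algebra"
        by (rule measurable_compose[OF measurable_card_Int[OF C]]) simp
      then show "(\<lambda>S. of_nat (card (S \<inter> C)) * indicator {S. locally_finite_set S \<and> S \<inter> V = {}} S :: ennreal) \<in>
          borel_measurable (distr M config_algebra X)"
        using void_in_sets[OF V] by (simp add: borel_measurable_times_ennreal)
    qed
    also have "\<dots> = (\<integral>\<^sup>+\<omega>. (\<Sum>k. of_nat k * indicator (?E k) \<omega>) \<partial>M)"
    proof (intro nn_integral_cong)
      fix \<omega> assume \<omega>: "\<omega> \<in> space M"
      have "(\<Sum>k. of_nat k * indicator (?E k) \<omega> :: ennreal) =
        (\<Sum>k\<in>{card (X \<omega> \<inter> C)}. of_nat k * indicator (?E k) \<omega>)"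
        by (rule suminf_finite) auto
      then show "of_nat (card (X \<omega> \<inter> C)) * indicator {S. locally_finite_set S \<and> S \<inter> V = {}} (X \<omega>) =
        (\<Sum>k. of_nat k * indicator (?E k) \<omega> :: ennreal)"
        using \<omega> zero_iff[OF \<omega> V(2)] lf[OF \<omega>] by (simp add: indicator_def)
    qed
    also have "\<dots> = (\<Sum>k. \<integral>\<^sup>+\<omega>. of_nat k * indicator (?E k) \<omega> \<partial>M)"
      using E by (intro nn_integral_suminf) simp
    also have "\<dots> = (\<Sum>k. ennreal (real k * ((\<gamma> * measure lborel C) ^ k / fact k * exp (- (\<gamma> * measure lborel C))) *
        exp (- (\<gamma> * measure lborel V))))"
      using E \<gamma> by (simp add: nn_integral_cmult_indicator M.emeasure_eq_measure prob_E
        ennreal_of_nat_eq_real_of_nat ennreal_mult[symmetric] mult.assoc)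
    also have "\<dots> = ennreal (\<gamma> * measure lborel C * exp (- (\<gamma> * measure lborel V)))"
      using \<gamma> by (intro suminf_ennreal_eq sums_mult2 poisson_mean_sums) simp
    finally show "(\<integral>\<^sup>+S. of_nat (card (S \<inter> C)) * indicator {S. locally_finite_set S \<and> S \<inter> V = {}} S \<partial>distr M config_algebra X) =
      ennreal (\<gamma> * measure lborel C * exp (- (\<gamma> * measure lborel V)))" .
  qed
qed

section \<open>The Mecke formula for pairs and triples\<close>

lemma nn_integral_count_space_insert:
  assumes "f x = 0"
  shows "(\<integral>\<^sup>+y. f y \<partial>count_space (insert x S)) = (\<integral>\<^sup>+y. f y \<partial>count_space S)"
  using assms by (intro nn_integral_count_space_eq) auto

context poisson_law
begin

text \<open>The one-point formula is applied twice. After the first use the inner sum runs over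
  \<open>insert x S\<close>; since \<open>f\<close> vanishes on the diagonal, the added point drops
  out and the formula applies to the sum over \<open>S\<close> again.\<close>

lemma mecke2:
  assumes f [measurable]: "f \<in> borel_measurable ((config_algebra \<Otimes>\<^sub>M borel) \<Otimes>\<^sub>M borel)"
    and diag: "\<And>S x. f ((S, x), x) = 0"
  shows "(\<integral>\<^sup>+S. \<integral>\<^sup>+x. \<integral>\<^sup>+y. f ((S, x), y) \<partial>count_space S \<partial>count_space S \<partial>P) =
    (ennreal \<gamma>)\<^sup>2 * (\<integral>\<^sup>+x. \<integral>\<^sup>+y. \<integral>\<^sup>+S. f ((insert y (insert x S), x), y) \<partial>P \<partial>lborel \<partial>lborel)"
proof -
  have "(\<integral>\<^sup>+S. \<integral>\<^sup>+x. \<integral>\<^sup>+y. f ((S, x), y) \<partial>count_space S \<partial>count_space S \<partial>P) =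
    ennreal \<gamma> * (\<integral>\<^sup>+x. \<integral>\<^sup>+S. \<integral>\<^sup>+y. f ((insert x S, x), y) \<partial>count_space (insert x S) \<partial>P \<partial>lborel)"
    using mecke[OF borel_measurable_sum_config[OF f measurable_fst]] by simp
  also have "(\<integral>\<^sup>+x. \<integral>\<^sup>+S. \<integral>\<^sup>+y. f ((insert x S, x), y) \<partial>count_space (insert x S) \<partial>P \<partial>lborel) =
    (\<integral>\<^sup>+x. \<integral>\<^sup>+S. \<integral>\<^sup>+y. f ((insert x S, x), y) \<partial>count_space S \<partial>P \<partial>lborel)"
    using diag by (simp add: nn_integral_count_space_insert)
  also have "\<dots> = (\<integral>\<^sup>+x. ennreal \<gamma> * (\<integral>\<^sup>+y. \<integral>\<^sup>+S. f ((insert x (insert y S), x), y) \<partial>P \<partial>lborel) \<partial>lborel)"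
  proof (intro nn_integral_cong)
    fix x
    have "(\<lambda>(S, y). f ((insert x S, x), y)) \<in> borel_measurable (config_algebra \<Otimes>\<^sub>M borel)"
      unfolding split_beta
      by (intro measurable_compose[OF _ f] measurable_Pair measurable_insert_config) simp_all
    from mecke[OF this]
    show "(\<integral>\<^sup>+S. \<integral>\<^sup>+y. f ((insert x S, x), y) \<partial>count_space S \<partial>P) =
      ennreal \<gamma> * (\<integral>\<^sup>+y. \<integral>\<^sup>+S. f ((insert x (insert y S), x), y) \<partial>P \<partial>lborel)" by simp
  qed
  also have "\<dots> = ennreal \<gamma> * (\<integral>\<^sup>+x. \<integral>\<^sup>+y. \<integral>\<^sup>+S. f ((insert x (insert y S), x), y) \<partial>P \<partial>lborel \<partial>lborel)"
  proof (rule nn_integral_cmult)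
    have "(\<lambda>((x, y), S). f ((insert x (insert y S), x), y)) \<in> borel_measurable ((lborel \<Otimes>\<^sub>M lborel) \<Otimes>\<^sub>M P)"
      unfolding split_beta
      by (intro measurable_compose[OF _ f] measurable_Pair measurable_insert_config
          measurable_compose[OF measurable_snd measurable_config_ident]) simp_all
    from borel_measurable_nn_integral[OF this]
    have "(\<lambda>(x, y). \<integral>\<^sup>+S. f ((insert x (insert y S), x), y) \<partial>P) \<in> borel_measurable (lborel \<Otimes>\<^sub>M lborel)"
      by (simp add: case_prod_unfold)
    from lborel.borel_measurable_nn_integral[OF this]
    show "(\<lambda>x. \<integral>\<^sup>+y. \<integral>\<^sup>+S. f ((insert x (insert y S), x), y) \<partial>P \<partial>lborel) \<in> borel_measurable lborel" .
  qed
  finally show ?thesis by (simp add: power2_eq_square mult.assoc insert_commute)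
qed

text \<open>The innermost sum is itself a measurable functional of the configuration, so
  \<open>mecke2\<close> handles the two outer sums and one more use of \<open>mecke\<close> the
  inner one. The three diagonal conditions remove the two points already added.\<close>

lemma mecke3:
  assumes f [measurable]: "f \<in> borel_measurable (((config_algebra \<Otimes>\<^sub>M borel) \<Otimes>\<^sub>M borel) \<Otimes>\<^sub>M borel)"
    and diag: "\<And>S x y. f (((S, x), x), y) = 0" "\<And>S x y. f (((S, x), y), x) = 0" "\<And>S x y. f (((S, x), y), y) = 0"
  shows "(\<integral>\<^sup>+S. \<integral>\<^sup>+x. \<integral>\<^sup>+y. \<integral>\<^sup>+z. f (((S, x), y), z) \<partial>count_space S \<partial>count_space S \<partial>count_space S \<partial>P) =
    (ennreal \<gamma>)^3 * (\<integral>\<^sup>+x. \<integral>\<^sup>+y. \<integral>\<^sup>+z. \<integral>\<^sup>+S. f (((insert z (insert y (insert x S)), x), y), z) \<partial>P \<partial>lborel \<partial>lborel \<partial>lborel)"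
proof -
  have "(\<integral>\<^sup>+S. \<integral>\<^sup>+x. \<integral>\<^sup>+y. \<integral>\<^sup>+z. f (((S, x), y), z) \<partial>count_space S \<partial>count_space S \<partial>count_space S \<partial>P) =
    (ennreal \<gamma>)\<^sup>2 * (\<integral>\<^sup>+x. \<integral>\<^sup>+y. \<integral>\<^sup>+S. \<integral>\<^sup>+z. f (((insert y (insert x S), x), y), z)
      \<partial>count_space (insert y (insert x S)) \<partial>P \<partial>lborel \<partial>lborel)"
    using mecke2[OF borel_measurable_sum_config[OF f measurable_compose[OF measurable_fst measurable_fst]]] diag by simp
  also have "(\<integral>\<^sup>+x. \<integral>\<^sup>+y. \<integral>\<^sup>+S. \<integral>\<^sup>+z. f (((insert y (insert x S), x), y), z)
      \<partial>count_space (insert y (insert x S)) \<partial>P \<partial>lborel \<partial>lborel) =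
    (\<integral>\<^sup>+x. \<integral>\<^sup>+y. \<integral>\<^sup>+S. \<integral>\<^sup>+z. f (((insert y (insert x S), x), y), z) \<partial>count_space S \<partial>P \<partial>lborel \<partial>lborel)"
    using diag by (simp add: nn_integral_count_space_insert)
  also have "\<dots> = (\<integral>\<^sup>+x. \<integral>\<^sup>+y. ennreal \<gamma> * (\<integral>\<^sup>+z. \<integral>\<^sup>+S. f (((insert y (insert x (insert z S)), x), y), z) \<partial>P \<partial>lborel) \<partial>lborel \<partial>lborel)"
  proof (intro nn_integral_cong)
    fix x y
    have "(\<lambda>(S, z). f (((insert y (insert x S), x), y), z)) \<in> borel_measurable (config_algebra \<Otimes>\<^sub>M borel)"
      unfolding split_beta
      by (intro measurable_compose[OF _ f] measurable_Pair measurable_insert_config) simp_all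
    from mecke[OF this]
    show "(\<integral>\<^sup>+S. \<integral>\<^sup>+z. f (((insert y (insert x S), x), y), z) \<partial>count_space S \<partial>P) =
      ennreal \<gamma> * (\<integral>\<^sup>+z. \<integral>\<^sup>+S. f (((insert y (insert x (insert z S)), x), y), z) \<partial>P \<partial>lborel)" by simp
  qed
  also have "\<dots> = ennreal \<gamma> * (\<integral>\<^sup>+x. \<integral>\<^sup>+y. \<integral>\<^sup>+z. \<integral>\<^sup>+S. f (((insert y (insert x (insert z S)), x), y), z) \<partial>P \<partial>lborel \<partial>lborel \<partial>lborel)"
  proof -
    have "(\<lambda>(((x, y), z), S). f (((insert y (insert x (insert z S)), x), y), z)) \<in>
        borel_measurable (((lborel \<Otimes>\<^sub>M lborel) \<Otimes>\<^sub>M lborel) \<Otimes>\<^sub>M P)"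
      unfolding split_beta
      by (intro measurable_compose[OF _ f] measurable_Pair measurable_insert_config
          measurable_compose[OF measurable_snd measurable_config_ident]) simp_all
    from borel_measurable_nn_integral[OF this]
    have "(\<lambda>((x, y), z). \<integral>\<^sup>+S. f (((insert y (insert x (insert z S)), x), y), z) \<partial>P) \<in>
        borel_measurable ((lborel \<Otimes>\<^sub>M lborel) \<Otimes>\<^sub>M lborel)"
      by (simp add: case_prod_unfold)
    from lborel.borel_measurable_nn_integral[OF this]
    have 1: "(\<lambda>(x, y). \<integral>\<^sup>+z. \<integral>\<^sup>+S. f (((insert y (insert x (insert z S)), x), y), z) \<partial>P \<partial>lborel) \<in>
        borel_measurable (lborel \<Otimes>\<^sub>M lborel)"
      by (simp add: case_prod_unfold)
    have 2: "(\<lambda>y. \<integral>\<^sup>+z. \<integral>\<^sup>+S. f (((insert y (insert x (insert z S)), x), y), z) \<partial>P \<partial>lborel) \<in>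
        borel_measurable lborel" for x
      using measurable_Pair2[OF 1, of x] by simp
    note 3 = lborel.borel_measurable_nn_integral[OF 1]
    show ?thesis
      by (subst nn_integral_cmult[OF 3, symmetric], intro nn_integral_cong nn_integral_cmult 2)
  qed
  finally show ?thesis by (simp add: power2_eq_square power3_eq_cube mult.assoc insert_commute)
qed

end

section \<open>Empty disks and Delaunay triangles\<close>

text \<open>The cross product of b - a and p - a, that is twice the signed area of the triangle abp.
  It is positive to the left of the directed line ab.\<close>

definition side :: "real^2 \<Rightarrow> real^2 \<Rightarrow> real^2 \<Rightarrow> real" where
  "side a b p = (b$1 - a$1) * (p$2 - a$2) - (b$2 - a$2) * (p$1 - a$1)"

text \<open>The power of p with respect to the circle with diameter ab, by Thales' theorem negative
  exactly inside it.\<close>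

definition thales :: "real^2 \<Rightarrow> real^2 \<Rightarrow> real^2 \<Rightarrow> real" where
  "thales a b p = (p - a) \<bullet> (p - b)"

text \<open>The disks with \<open>a\<close> and \<open>b\<close> on their boundary are the sets \<open>thales a b p < \<tau> * side a b p\<close>, with
  centre \<open>pencil_centre a b \<tau>\<close>. The parameter of the circle through \<open>c\<close> is \<open>pencil_param a b c\<close>, which is
  meaningful only if \<open>side a b c \<noteq> 0\<close>.\<close>

definition pencil_centre :: "real^2 \<Rightarrow> real^2 \<Rightarrow> real \<Rightarrow> real^2" where
  "pencil_centre a b \<tau> = (1/2) *\<^sub>R (a + b + \<tau> *\<^sub>R vector [a$2 - b$2, b$1 - a$1])"

definition pencil_param :: "real^2 \<Rightarrow> real^2 \<Rightarrow> real^2 \<Rightarrow> real" where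
  "pencil_param a b c = thales a b c / side a b c"

text \<open>The centre with parameter tau has distance |tau| * dist a b / 2 from the midpoint of ab,
  so this is Pythagoras' theorem. If c lies on the line ab, division by zero sets the parameter to 0
  and the value is half the distance of a and b.\<close>

definition circumradius :: "real^2 \<Rightarrow> real^2 \<Rightarrow> real^2 \<Rightarrow> real" where
  "circumradius a b c = dist a b * sqrt (1 + (pencil_param a b c)\<^sup>2) / 2"

lemma inner_real2: "x \<bullet> y = x$1 * y$1 + x$2 * (y$2 :: real)" for x y :: "real^2"
  by (simp add: inner_vec_def sum_2)

lemma eq_real2_iff: "x = y \<longleftrightarrow> x$1 = y$1 \<and> x$2 = y$2" for x y :: "real^2"
  by (simp add: vec_eq_iff forall_2)

lemma thales_coord: "thales a b p = (p$1 - a$1) * (p$1 - b$1) + (p$2 - a$2) * (p$2 - b$2)"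
  by (simp add: thales_def inner_real2)

lemma mem_ball_inner: "r \<ge> 0 \<Longrightarrow> p \<in> ball z r \<longleftrightarrow> (p - z) \<bullet> (p - z) < r\<^sup>2"
  unfolding mem_ball dist_norm norm_minus_commute[of z p] power2_norm_eq_inner[symmetric]
  by (auto intro: power_strict_mono power2_less_imp_less)

lemma mem_sphere_inner: "r \<ge> 0 \<Longrightarrow> p \<in> sphere z r \<longleftrightarrow> (p - z) \<bullet> (p - z) = r\<^sup>2"
  by (simp add: dist_norm norm_minus_commute power2_norm_eq_inner[symmetric] power2_eq_iff_nonneg)

text \<open>The left-hand side is the power of p with respect to the pencil circle. Powers with
  respect to two circles through a and b differ by an affine function vanishing on the line ab,
  hence by a multiple of \<open>side a b p\<close>.\<close>

lemma power_of_point_pencil: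
  "(p - pencil_centre a b \<tau>) \<bullet> (p - pencil_centre a b \<tau>) - (a - pencil_centre a b \<tau>) \<bullet> (a - pencil_centre a b \<tau>)
    = thales a b p - \<tau> * side a b p"
  unfolding inner_real2 thales_coord side_def pencil_centre_def
  by (simp add: field_simps)

lemma dist_pencil_centre:
  "(a - pencil_centre a b \<tau>) \<bullet> (a - pencil_centre a b \<tau>) = (dist a b)\<^sup>2 * (1 + \<tau>\<^sup>2) / 4"
  unfolding dist_norm power2_norm_eq_inner inner_real2 pencil_centre_def
  by (simp add: field_simps power2_eq_square)

lemma sphere_eq_pencil:
  assumes "a \<noteq> b" "a \<in> sphere z r" "b \<in> sphere z r"
  shows "\<exists>\<tau>. z = pencil_centre a b \<tau>"
proof -
  \<comment> \<open>Both points being at distance \<open>r\<close> puts \<open>z\<close> on the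
    perpendicular bisector. The parameter is the coefficient of 2 z - a - b along the normal of
    ab.\<close>
  define \<tau> where "\<tau> = ((2 * z$1 - a$1 - b$1) * (a$2 - b$2) + (2 * z$2 - a$2 - b$2) * (b$1 - a$1)) /
    ((b$1 - a$1)\<^sup>2 + (b$2 - a$2)\<^sup>2)"
  have nz: "(b$1 - a$1)\<^sup>2 + (b$2 - a$2)\<^sup>2 \<noteq> 0"
    using assms(1) by (auto simp: eq_real2_iff sum_power2_eq_zero_iff)
  have "r \<ge> 0" using assms(2) by auto
  then have "(a - z) \<bullet> (a - z) = (b - z) \<bullet> (b - z)" using assms by (simp add: mem_sphere_inner del: mem_sphere)
  then have orth: "(b$1 - a$1) * (2 * z$1 - a$1 - b$1) + (b$2 - a$2) * (2 * z$2 - a$2 - b$2) = 0"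
    unfolding inner_real2 by (simp add: algebra_simps)
  have 1: "\<tau> * ((b$1 - a$1)\<^sup>2 + (b$2 - a$2)\<^sup>2) =
      (2 * z$1 - a$1 - b$1) * (a$2 - b$2) + (2 * z$2 - a$2 - b$2) * (b$1 - a$1)"
    unfolding \<tau>_def using nz by simp
  have "((b$1 - a$1)\<^sup>2 + (b$2 - a$2)\<^sup>2) * (\<tau> * (a$2 - b$2)) = ((b$1 - a$1)\<^sup>2 + (b$2 - a$2)\<^sup>2) * (2 * z$1 - a$1 - b$1)"
    using 1 orth by algebra
  moreover have "((b$1 - a$1)\<^sup>2 + (b$2 - a$2)\<^sup>2) * (\<tau> * (b$1 - a$1)) = ((b$1 - a$1)\<^sup>2 + (b$2 - a$2)\<^sup>2) * (2 * z$2 - a$2 - b$2)"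
    using 1 orth by algebra
  ultimately have "\<tau> * (a$2 - b$2) = 2 * z$1 - a$1 - b$1" "\<tau> * (b$1 - a$1) = 2 * z$2 - a$2 - b$2"
    using nz by auto
  then have "z = pencil_centre a b \<tau>" unfolding eq_real2_iff pencil_centre_def by (simp add: field_simps)
  then show ?thesis ..
qed

lemma mem_ball_pencil:
  assumes "a \<in> sphere (pencil_centre a b \<tau>) r"
  shows "p \<in> ball (pencil_centre a b \<tau>) r \<longleftrightarrow> thales a b p < \<tau> * side a b p"
    and "p \<in> sphere (pencil_centre a b \<tau>) r \<longleftrightarrow> thales a b p = \<tau> * side a b p"
    and "p \<in> cball (pencil_centre a b \<tau>) r \<longleftrightarrow> thales a b p \<le> \<tau> * side a b p"
proof -
  have r: "r \<ge> 0" using assms by auto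
  then have r2: "(a - pencil_centre a b \<tau>) \<bullet> (a - pencil_centre a b \<tau>) = r\<^sup>2"
    using assms by (simp add: mem_sphere_inner del: mem_sphere)
  show 1: "p \<in> ball (pencil_centre a b \<tau>) r \<longleftrightarrow> thales a b p < \<tau> * side a b p"
    unfolding mem_ball_inner[OF r] using power_of_point_pencil[of p a b \<tau>] r2 by linarith
  show 2: "p \<in> sphere (pencil_centre a b \<tau>) r \<longleftrightarrow> thales a b p = \<tau> * side a b p"
    unfolding mem_sphere_inner[OF r] using power_of_point_pencil[of p a b \<tau>] r2 by linarith
  show "p \<in> cball (pencil_centre a b \<tau>) r \<longleftrightarrow> thales a b p \<le> \<tau> * side a b p"
    using 1 2 by (auto simp: less_le)
qed

lemma sphere_pencil_param:
  shows "a \<in> sphere (pencil_centre a b (pencil_param a b c)) (circumradius a b c)"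
    and "b \<in> sphere (pencil_centre a b (pencil_param a b c)) (circumradius a b c)"
    and "side a b c \<noteq> 0 \<Longrightarrow> c \<in> sphere (pencil_centre a b (pencil_param a b c)) (circumradius a b c)"
proof -
  have r: "circumradius a b c \<ge> 0" by (simp add: circumradius_def)
  show a: "a \<in> sphere (pencil_centre a b (pencil_param a b c)) (circumradius a b c)"
    unfolding mem_sphere_inner[OF r] dist_pencil_centre by (simp add: circumradius_def power_mult_distrib power_divide)
  show "b \<in> sphere (pencil_centre a b (pencil_param a b c)) (circumradius a b c)"
    unfolding mem_ball_pencil[OF a] by (simp add: thales_coord side_def)
  show "c \<in> sphere (pencil_centre a b (pencil_param a b c)) (circumradius a b c)" if "side a b c \<noteq> 0"
    unfolding mem_ball_pencil[OF a] using that by (simp add: pencil_param_def)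
qed

lemma collinear_iff_side: "collinear {a, b, c} \<longleftrightarrow> side a b c = 0"
proof (cases "a = b")
  case True
  then show ?thesis by (simp add: side_def)
next
  case False
  have "collinear {a, b, c} \<longleftrightarrow> collinear {b, a, c}" by (simp add: insert_commute)
  also have "\<dots> \<longleftrightarrow> collinear {0, b - a, c - a}" by (subst collinear_3) simp_all
  also have "\<dots> \<longleftrightarrow> (\<exists>k. c - a = k *\<^sub>R (b - a))"
    unfolding collinear_lemma using False by (metis eq_iff_diff_eq_0 scale_zero_left)
  also have "\<dots> \<longleftrightarrow> side a b c = 0"
  proof
    assume "\<exists>k. c - a = k *\<^sub>R (b - a)"
    then obtain k where "c - a = k *\<^sub>R (b - a)" ..
    then have "c$1 - a$1 = k * (b$1 - a$1)" "c$2 - a$2 = k * (b$2 - a$2)"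
      by (metis vector_minus_component vector_scaleR_component real_scaleR_def)+
    then show "side a b c = 0" by (simp add: side_def)
  next
    assume s: "side a b c = 0"
    \<comment> \<open>The coefficient of the orthogonal projection of c - a onto b - a. Vanishing of
      \<open>side\<close> says that the normal component is zero, so the projection is
      exact.\<close>
    define k where "k = ((c$1 - a$1) * (b$1 - a$1) + (c$2 - a$2) * (b$2 - a$2)) / ((b$1 - a$1)\<^sup>2 + (b$2 - a$2)\<^sup>2)"
    have nz: "(b$1 - a$1)\<^sup>2 + (b$2 - a$2)\<^sup>2 \<noteq> 0"
      using False by (auto simp: eq_real2_iff sum_power2_eq_zero_iff)
    have 1: "k * ((b$1 - a$1)\<^sup>2 + (b$2 - a$2)\<^sup>2) = (c$1 - a$1) * (b$1 - a$1) + (c$2 - a$2) * (b$2 - a$2)"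
      unfolding k_def using nz by simp
    have "((b$1 - a$1)\<^sup>2 + (b$2 - a$2)\<^sup>2) * (c$1 - a$1) = ((b$1 - a$1)\<^sup>2 + (b$2 - a$2)\<^sup>2) * (k * (b$1 - a$1))"
      using 1 s unfolding side_def by algebra
    moreover have "((b$1 - a$1)\<^sup>2 + (b$2 - a$2)\<^sup>2) * (c$2 - a$2) = ((b$1 - a$1)\<^sup>2 + (b$2 - a$2)\<^sup>2) * (k * (b$2 - a$2))"
      using 1 s unfolding side_def by algebra
    ultimately have "c - a = k *\<^sub>R (b - a)" using nz by (auto simp: eq_real2_iff)
    then show "\<exists>k. c - a = k *\<^sub>R (b - a)" ..
  qed
  finally show ?thesis .
qed

text \<open>The circle through a, b and c is the pencil circle with parameter
  \<open>pencil_param a b c\<close>, which eliminates the existential quantifier over disks. What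
  remains are inequalities quantified only over points of the configuration, a form suitable both
  for measurability and for adding points.\<close>

lemma delaunay_triangle_iff:
  "delaunay_triangle S a b c \<longleftrightarrow> {a, b, c} \<subseteq> S \<and> side a b c \<noteq> 0 \<and>
    (\<forall>p\<in>S. pencil_param a b c * side a b p \<le> thales a b p)"
proof
  assume D: "delaunay_triangle S a b c"
  then obtain z r where zr: "{a, b, c} \<subseteq> sphere z r" "ball z r \<inter> S = {}"
    and S: "{a, b, c} \<subseteq> S" "side a b c \<noteq> 0"
    by (auto simp: delaunay_triangle_def collinear_iff_side)
  have "a \<noteq> b" using S(2) by (auto simp: side_def)
  then obtain \<tau> where z: "z = pencil_centre a b \<tau>" using sphere_eq_pencil[of a b z r] zr(1) by blast
  have a: "a \<in> sphere (pencil_centre a b \<tau>) r" using zr z by auto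
  have "c \<in> sphere (pencil_centre a b \<tau>) r" using zr z by auto
  then have "thales a b c = \<tau> * side a b c" using mem_ball_pencil(2)[OF a] by blast
  then have "\<tau> = pencil_param a b c" using S(2) by (simp add: pencil_param_def)
  moreover have "p \<notin> ball (pencil_centre a b \<tau>) r" if "p \<in> S" for p using zr(2) z that by auto
  ultimately show "{a, b, c} \<subseteq> S \<and> side a b c \<noteq> 0 \<and> (\<forall>p\<in>S. pencil_param a b c * side a b p \<le> thales a b p)"
    using S unfolding mem_ball_pencil[OF a] not_less by blast
next
  assume R: "{a, b, c} \<subseteq> S \<and> side a b c \<noteq> 0 \<and> (\<forall>p\<in>S. pencil_param a b c * side a b p \<le> thales a b p)"
  let ?z = "pencil_centre a b (pencil_param a b c)" and ?r = "circumradius a b c"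
  have "ball ?z ?r \<inter> S = {}"
    using R mem_ball_pencil(1)[OF sphere_pencil_param(1)[of a b c]] by fastforce
  moreover have "{a, b, c} \<subseteq> sphere ?z ?r"
    using R sphere_pencil_param[where a = a and b = b and c = c]
    by (simp only: insert_subset empty_subsetI simp_thms)
  ultimately show "delaunay_triangle S a b c"
    using R unfolding delaunay_triangle_def collinear_iff_side by blast
qed

text \<open>Within the pencil of circles through \<open>a\<close> and \<open>b\<close>, the part of the disk on the positive side grows
  with the parameter and the other part shrinks. Hence an empty disk can be inflated towards the positive
  side until it hits a point.\<close>

lemma empty_disc_imp_triangle:
  assumes S: "locally_finite_set S" and half: "\<exists>c\<in>S. side a b c > 0"
    and ab: "a \<in> S" "b \<in> S" "a \<noteq> b" and zr: "a \<in> sphere z r" "b \<in> sphere z r" "ball z r \<inter> S = {}"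
  shows "\<exists>c. side a b c > 0 \<and> delaunay_triangle S a b c"
proof -
  obtain \<sigma> where z: "z = pencil_centre a b \<sigma>" using sphere_eq_pencil[OF ab(3) zr(1,2)] by blast
  have a: "a \<in> sphere (pencil_centre a b \<sigma>) r" using zr z by auto
  have empty: "\<sigma> * side a b p \<le> thales a b p" if "p \<in> S" for p
    using zr(3) z that mem_ball_pencil(1)[OF a, of p] by auto
  obtain c0 where c0: "c0 \<in> S" "side a b c0 > 0" using half by auto
  \<comment> \<open>The points on the positive side in the closed disk through \<open>c0\<close>.
    They are finitely many by local finiteness, so the first point hit by the growing disk
    exists.\<close>
  define F where "F = {p \<in> S. side a b p > 0 \<and> thales a b p \<le> pencil_param a b c0 * side a b p}"
  have "F \<subseteq> S \<inter> cball (pencil_centre a b (pencil_param a b c0)) (circumradius a b c0)"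
    unfolding F_def using mem_ball_pencil(3)[OF sphere_pencil_param(1)[of a b c0]] by auto
  then have fin: "finite F" by (rule finite_subset) (rule locally_finite_set_Int[OF S bounded_cball])
  have "c0 \<in> F" using c0 by (simp add: F_def pencil_param_def)
  then obtain c where c: "c \<in> F" "\<And>p. p \<in> F \<Longrightarrow> pencil_param a b c \<le> pencil_param a b p"
    using ex_min_if_finite[of "pencil_param a b ` F"] fin by (force simp: not_less)
  have cS: "c \<in> S" "side a b c > 0" using c(1) by (auto simp: F_def)
  have "pencil_param a b c * side a b p \<le> thales a b p" if p: "p \<in> S" for p
  proof (cases "side a b p > 0")
    case True
    show ?thesis
    proof (cases "p \<in> F")
      case p_F: True
      have "pencil_param a b c * side a b p \<le> pencil_param a b p * side a b p"
        using c(2)[OF p_F] True by simp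
      also have "\<dots> = thales a b p" using True by (simp add: pencil_param_def)
      finally show ?thesis .
    next
      case p_F: False
      have "pencil_param a b c * side a b p \<le> pencil_param a b c0 * side a b p"
        using c(2)[OF \<open>c0 \<in> F\<close>] True by simp
      also have "\<dots> \<le> thales a b p" using p_F True p unfolding F_def by simp
      finally show ?thesis .
    qed
  next
    case False
    \<comment> \<open>The apex \<open>c\<close> lies outside the original disk, so its parameter is
      at least \<open>\<sigma>\<close>. Moving to the larger parameter only shrinks the part of the
      disk on the other side.\<close>
    have "\<sigma> \<le> pencil_param a b c" using empty[OF cS(1)] cS(2) by (simp add: pencil_param_def field_simps)
    then have "pencil_param a b c * side a b p \<le> \<sigma> * side a b p" using False by (simp add: mult_right_mono_neg)
    with empty[OF p] show ?thesis by simp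
  qed
  then show ?thesis using ab cS by (intro exI[of _ c]) (auto simp: delaunay_triangle_iff)
qed

text \<open>Each apex lies outside the open disk of the other triangle, which orders the two
  parameters in both directions.\<close>

lemma delaunay_triangle_same_side:
  assumes "delaunay_triangle S a b c" "delaunay_triangle S a b d" "side a b c > 0" "side a b d > 0"
  shows "pencil_param a b c = pencil_param a b d"
proof -
  have "pencil_param a b c * side a b d \<le> thales a b d" "pencil_param a b d * side a b c \<le> thales a b c"
    using assms by (auto simp: delaunay_triangle_iff)
  then show ?thesis using assms(3,4) unfolding pencil_param_def by (intro antisym) (auto simp: field_simps)
qed

section \<open>Small disks at prescribed positions inside a disk\<close>

abbreviation axis_directions :: "(real^2) set" where
  "axis_directions \<equiv> {axis 1 1, - axis 1 1, axis 2 1, - axis 2 1}"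

text \<open>The vector z - x has length r. Because 2 * (7/10)^2 = 98/100 < 1, one of its two
  coordinates has absolute value at least 7/10 r, so some signed axis direction points well into the
  disk.\<close>

lemma ball_subset_disc:
  fixes x z :: "real^2"
  assumes x: "x \<in> sphere z r" and R: "0 \<le> R" "R \<le> r"
  shows "\<exists>u\<in>axis_directions. ball (x + (R / 2) *\<^sub>R u) (R / 4) \<subseteq> ball z r"
proof -
  have r: "r \<ge> 0" using R by simp
  have v: "(z$1 - x$1)\<^sup>2 + (z$2 - x$2)\<^sup>2 = r\<^sup>2"
    using x mem_sphere_inner[OF r, of x z] unfolding inner_real2 by (simp add: power2_eq_square algebra_simps)
  have sub: "ball (x + (R / 2) *\<^sub>R u) (R / 4) \<subseteq> ball z r"
    if u: "u \<bullet> u = 1" "(z - x) \<bullet> u \<ge> 7 / 10 * r" for u :: "real^2"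
  proof -
    have "(x + (R / 2) *\<^sub>R u - z) \<bullet> (x + (R / 2) *\<^sub>R u - z) = (z - x) \<bullet> (z - x) - R * ((z - x) \<bullet> u) + R\<^sup>2 / 4 * (u \<bullet> u)"
      by (simp add: inner_real2 power2_eq_square algebra_simps) 
    also have "(z - x) \<bullet> (z - x) = r\<^sup>2" using v by (simp add: inner_real2 power2_eq_square)
    also have "r\<^sup>2 - R * ((z - x) \<bullet> u) + R\<^sup>2 / 4 * (u \<bullet> u) \<le> r\<^sup>2 - R * (7 / 10 * r) + R\<^sup>2 / 4"
      using u R mult_left_mono[OF u(2) R(1)] by simp
    \<comment> \<open>The difference of the two sides is R r / 5 - 3 R^2 / 16. It is nonnegative
      since R <= r and 1/5 > 3/16.\<close>
    also have "\<dots> \<le> (r - R / 4)\<^sup>2"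
      using mult_left_mono[OF R(2) R(1)] mult_nonneg_nonneg[OF R(1) r]
      unfolding power2_eq_square by (simp add: field_simps)
    finally have "(norm (x + (R / 2) *\<^sub>R u - z))\<^sup>2 \<le> (r - R / 4)\<^sup>2" by (simp add: power2_norm_eq_inner)
    then have "norm (x + (R / 2) *\<^sub>R u - z) \<le> r - R / 4"
      by (rule power2_le_imp_le) (use R in linarith)
    then have "dist (x + (R / 2) *\<^sub>R u) z + R / 4 \<le> r" by (simp add: dist_norm)
    then show ?thesis by (simp add: ball_subset_ball_iff)
  qed
  have "\<bar>z$1 - x$1\<bar> \<ge> 7 / 10 * r \<or> \<bar>z$2 - x$2\<bar> \<ge> 7 / 10 * r"
  proof (rule ccontr)
    assume "\<not> ?thesis"
    then have *: "\<bar>z$1 - x$1\<bar> \<le> 7 / 10 * r" "\<bar>z$2 - x$2\<bar> \<le> 7 / 10 * r" "r > 0"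
      by linarith+
    have "\<bar>z$1 - x$1\<bar>\<^sup>2 \<le> (7 / 10 * r)\<^sup>2" "\<bar>z$2 - x$2\<bar>\<^sup>2 \<le> (7 / 10 * r)\<^sup>2"
      by (rule power_mono[OF *(1) abs_ge_zero] power_mono[OF *(2) abs_ge_zero])+
    then have "(z$1 - x$1)\<^sup>2 \<le> 49 / 100 * r\<^sup>2" "(z$2 - x$2)\<^sup>2 \<le> 49 / 100 * r\<^sup>2"
      by (simp_all add: power_mult_distrib power_divide)
    then have "r\<^sup>2 \<le> 98 / 100 * r\<^sup>2" using v by linarith
    then show False using zero_less_power[OF *(3), of 2] by linarith
  qed
  then consider "z$1 - x$1 \<ge> 7 / 10 * r" | "- (z$1 - x$1) \<ge> 7 / 10 * r" | "z$2 - x$2 \<ge> 7 / 10 * r" | "- (z$2 - x$2) \<ge> 7 / 10 * r"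
    by linarith
  then show ?thesis
  proof cases
    case 1 then show ?thesis using sub[of "axis 1 1"] by (simp add: inner_real2 axis_def)
  next
    case 2 then show ?thesis using sub[of "- axis 1 1"] by (simp add: inner_real2 axis_def)
  next
    case 3 then show ?thesis using sub[of "axis 2 1"] by (simp add: inner_real2 axis_def)
  next
    case 4 then show ?thesis using sub[of "- axis 2 1"] by (simp add: inner_real2 axis_def)
  qed
qed

section \<open>Counting crossing edges\<close>

lemma measurable_sum_config [measurable (raw)]:
  fixes S :: "'k \<Rightarrow> 'a::euclidean_space set"
  assumes "case_prod h \<in> borel_measurable (K \<Otimes>\<^sub>M borel)" "S \<in> measurable K config_algebra"
  shows "(\<lambda>p. \<integral>\<^sup>+y. h p y \<partial>count_space (S p)) \<in> borel_measurable K"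
  using borel_measurable_sum_config[OF assms] by simp

declare measurable_insert_config [measurable (raw)]

text \<open>A property holds at all points of the configuration exactly if the sum over the points
  of the indicator of its negation is 0, and such sums are measurable.\<close>

lemma pred_Ball_config [measurable (raw)]:
  fixes S :: "'k \<Rightarrow> 'a::euclidean_space set"
  assumes Q: "Measurable.pred (K \<Otimes>\<^sub>M borel) (case_prod Q)" and S [measurable]: "S \<in> measurable K config_algebra"
  shows "Measurable.pred K (\<lambda>p. \<forall>y\<in>S p. Q p y)"
proof -
  have [measurable]: "Measurable.pred (K \<Otimes>\<^sub>M borel) (\<lambda>(p, y). \<not> Q p y)"
    using pred_intros_logic(2)[OF Q] by (simp add: case_prod_unfold)
  have "Measurable.pred K (\<lambda>p. (\<integral>\<^sup>+y. (if \<not> Q p y then 1 else 0) \<partial>count_space (S p)) = 0)"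
    by measurable
  moreover have "(\<integral>\<^sup>+y. (if \<not> Q p y then 1 else 0) \<partial>count_space (S p)) = 0 \<longleftrightarrow> (\<forall>y\<in>S p. Q p y)" for p
    by (subst nn_integral_0_iff_AE) (auto simp: AE_count_space split: if_splits)
  ultimately show ?thesis by simp
qed

lemma measurable_vec_nth [measurable (raw)]:
  fixes f :: "'k \<Rightarrow> real ^ 'n"
  assumes "f \<in> borel_measurable K"
  shows "(\<lambda>p. f p $ i) \<in> borel_measurable K"
  by (rule measurable_compose[OF assms]) (intro borel_measurable_continuous_onI continuous_intros)

lemma measurable_side [measurable (raw)]:
  assumes [measurable]: "a \<in> borel_measurable K" "b \<in> borel_measurable K" "c \<in> borel_measurable K"
  shows "(\<lambda>p. side (a p) (b p) (c p)) \<in> borel_measurable K"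
  unfolding side_def by measurable

lemma measurable_thales [measurable (raw)]:
  assumes [measurable]: "a \<in> borel_measurable K" "b \<in> borel_measurable K" "c \<in> borel_measurable K"
  shows "(\<lambda>p. thales (a p) (b p) (c p)) \<in> borel_measurable K"
  unfolding thales_coord by measurable

lemma measurable_pencil_param [measurable (raw)]:
  assumes [measurable]: "a \<in> borel_measurable K" "b \<in> borel_measurable K" "c \<in> borel_measurable K"
  shows "(\<lambda>p. pencil_param (a p) (b p) (c p)) \<in> borel_measurable K"
  unfolding pencil_param_def by measurable

definition crosses :: "real^2 \<Rightarrow> real^2 \<Rightarrow> real^2 \<Rightarrow> real^2 \<Rightarrow> bool" where
  "crosses s t a b \<longleftrightarrow> closed_segment a b \<inter> closed_segment s t \<noteq> {}"

text \<open>The pairs form the projection of a closed set along the compact square of the two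
  segment parameters. Closedness is the source of the measurability of
  \<open>crosses\<close>.\<close>

lemma closed_crosses: "closed {(a, b). crosses s t a b}"
proof -
  let ?T = "{((u :: real, v :: real), (a :: real^2, b :: real^2)). (1 - u) *\<^sub>R a + u *\<^sub>R b = (1 - v) *\<^sub>R s + v *\<^sub>R t}"
  have "closed ?T"
    unfolding case_prod_unfold by (intro closed_Collect_eq continuous_intros)
  then have "closed {y. \<exists>x. x \<in> {0..1} \<times> {0..1} \<and> (x, y) \<in> ?T}"
    by (intro closed_compact_projection compact_Times) auto
  also have "{y. \<exists>x. x \<in> {0..1} \<times> {0..1} \<and> (x, y) \<in> ?T} = {(a, b). crosses s t a b}"
    unfolding crosses_def closed_segment_def by (auto simp: disjoint_iff)
  finally show ?thesis .
qed

lemma pred_crosses [measurable (raw)]: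
  assumes [measurable]: "a \<in> borel_measurable K" "b \<in> borel_measurable K"
  shows "Measurable.pred K (\<lambda>p. crosses s t (a p) (b p))"
proof -
  have "(\<lambda>p. (a p, b p)) \<in> borel_measurable K" by measurable
  from measurable_sets[OF this borel_closed[OF closed_crosses[of s t]]]
  show ?thesis unfolding pred_def by (rule back_subst[of "\<lambda>A. A \<in> sets K"]) auto
qed

lemma crosses_sym: "crosses s t a b \<longleftrightarrow> crosses s t b a"
  by (simp add: crosses_def closed_segment_commute)

text \<open>Edges are recorded with both orientations, so that counting them becomes a double sum
  over the configuration.\<close>

definition crossing_pairs :: "real^2 \<Rightarrow> real^2 \<Rightarrow> (real^2) set \<Rightarrow> ((real^2) \<times> (real^2)) set" where
  "crossing_pairs s t S = {(a, b). (\<exists>c. delaunay_triangle S a b c) \<and> crosses s t a b}"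

lemma delaunay_triangle_swap: "delaunay_triangle S a b c \<Longrightarrow> delaunay_triangle S b a c"
  by (auto simp: delaunay_triangle_def insert_commute)

lemma crossing_pairs_subset: "crossing_pairs s t S \<subseteq> S \<times> S"
  by (auto simp: crossing_pairs_def delaunay_triangle_def)

lemma card_symmetric_pairs:
  fixes E :: "('a \<times> 'a) set"
  assumes sym: "\<And>a b. (a, b) \<in> E \<Longrightarrow> (b, a) \<in> E" and irr: "\<And>a. (a, a) \<notin> E"
  shows "card E = 2 * card ((\<lambda>(a, b). {a, b}) ` E)"
proof (cases "finite E")
  case True
  let ?f = "\<lambda>(a, b). {a, b}"
  have "card {x \<in> E. ?f x = e} = 2" if "e \<in> ?f ` E" for e
  proof -
    from that obtain a b where ab: "(a, b) \<in> E" "e = {a, b}" by auto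
    then have "{x \<in> E. ?f x = e} = {(a, b), (b, a)}" using sym by (auto simp: doubleton_eq_iff)
    moreover have "a \<noteq> b" using ab irr by auto
    ultimately show ?thesis by simp
  qed
  then have "(\<Sum>e\<in>?f ` E. card {x \<in> E. ?f x = e}) = 2 * card (?f ` E)" by simp
  moreover have "card E = (\<Sum>e\<in>?f ` E. card {x \<in> E. ?f x = e})"
    unfolding card_eq_sum using True by (rule sum.image_gen)
  ultimately show ?thesis by simp
next
  case False
  \<comment> \<open>In the infinite case both cardinalities must be 0. An image of finitely many
    doubletons would confine \<open>E\<close> to a finite union of finite squares.\<close>
  have "infinite ((\<lambda>(a, b). {a, b}) ` E)"
  proof
    assume "finite ((\<lambda>(a, b). {a, b}) ` E)"
    then have "finite (\<Union>e\<in>(\<lambda>(a, b). {a, b}) ` E. e \<times> e)" by (intro finite_UN_I) auto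
    moreover have "E \<subseteq> (\<Union>e\<in>(\<lambda>(a, b). {a, b}) ` E. e \<times> e)" by fastforce
    ultimately show False using False finite_subset by blast
  qed
  with False show ?thesis by simp
qed

lemma card_crossing_pairs: "card (crossing_pairs s t S) = 2 * num_crossing_edges S s t"
proof -
  have "(a, a) \<notin> crossing_pairs s t S" for a
    by (auto simp: crossing_pairs_def delaunay_triangle_iff side_def)
  moreover have "(b, a) \<in> crossing_pairs s t S" if "(a, b) \<in> crossing_pairs s t S" for a b
    using that delaunay_triangle_swap crosses_sym unfolding crossing_pairs_def by blast
  ultimately have "card (crossing_pairs s t S) = 2 * card ((\<lambda>(a, b). {a, b}) ` crossing_pairs s t S)"
    by (intro card_symmetric_pairs)
  also have "(\<lambda>(a, b). {a, b}) ` crossing_pairs s t S =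
      {e \<in> delaunay_edges S. convex hull e \<inter> closed_segment s t \<noteq> {}}"
    unfolding crossing_pairs_def delaunay_edges_def crosses_def segment_convex_hull
    by (auto simp: image_iff)
  finally show ?thesis by (simp add: num_crossing_edges_def)
qed

text \<open>Counting measure is used in place of \<open>card\<close>: it turns the count into
  iterated sums over \<open>S\<close>, the form required by the Mecke formula, and it is monotone
  and subadditive also on infinite sets.\<close>

lemma emeasure_count_space_Times_eq:
  assumes "E \<subseteq> S \<times> S"
  shows "emeasure (count_space UNIV) E = (\<integral>\<^sup>+a. \<integral>\<^sup>+b. indicator E (a, b) \<partial>count_space S \<partial>count_space S)"
proof -
  have "emeasure (count_space UNIV) E = (\<integral>\<^sup>+x. indicator E x \<partial>count_space UNIV)" by simp
  also have "\<dots> = (\<integral>\<^sup>+a. \<integral>\<^sup>+b. indicator E (a, b) \<partial>count_space UNIV \<partial>count_space UNIV)"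
    by (rule nn_integral_fst_count_space[symmetric])
  also have "\<dots> = (\<integral>\<^sup>+a. \<integral>\<^sup>+b. indicator E (a, b) \<partial>count_space S \<partial>count_space UNIV)"
    using assms by (intro nn_integral_cong nn_integral_count_space_eq) (auto split: split_indicator)
  also have "\<dots> = (\<integral>\<^sup>+a. \<integral>\<^sup>+b. indicator E (a, b) \<partial>count_space S \<partial>count_space S)"
  proof (rule nn_integral_count_space_eq)
    fix a assume "a \<in> UNIV - S"
    then have "indicator E (a, b) = (0 :: ennreal)" for b using assms by (auto split: split_indicator)
    then show "(\<integral>\<^sup>+b. indicator E (a, b) \<partial>count_space S) = 0" by simp
  qed auto
  finally show ?thesis .
qed

lemma emeasure_count_space_eq_sum:
  assumes "E \<subseteq> S"
  shows "emeasure (count_space UNIV) E = (\<integral>\<^sup>+a. indicator E a \<partial>count_space S)"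
proof -
  have "emeasure (count_space UNIV) E = (\<integral>\<^sup>+x. indicator E x \<partial>count_space UNIV)" by simp
  also have "\<dots> = (\<integral>\<^sup>+a. indicator E a \<partial>count_space S)"
    using assms by (intro nn_integral_count_space_eq) (auto split: split_indicator)
  finally show ?thesis .
qed

lemma measurable_count_crossing_pairs [measurable]:
  "(\<lambda>S. emeasure (count_space UNIV) (crossing_pairs s t S)) \<in> borel_measurable config_algebra"
proof -
  \<comment> \<open>The existence of an apex is written as a negated bounded universal quantifier,
    which is the form covered by \<open>pred_Ball_config\<close>.\<close>
  let ?h = "\<lambda>S a b. if crosses s t a b \<and> \<not> (\<forall>c\<in>S. \<not> (side a b c \<noteq> 0 \<and>
      (\<forall>p\<in>S. pencil_param a b c * side a b p \<le> thales a b p))) then 1 else 0 :: ennreal"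
  have "(\<lambda>S. \<integral>\<^sup>+a. \<integral>\<^sup>+b. ?h S a b \<partial>count_space S \<partial>count_space S) \<in> borel_measurable config_algebra"
    by measurable
  also have "(\<lambda>S. \<integral>\<^sup>+a. \<integral>\<^sup>+b. ?h S a b \<partial>count_space S \<partial>count_space S) =
      (\<lambda>S. emeasure (count_space UNIV) (crossing_pairs s t S))"
    unfolding emeasure_count_space_Times_eq[OF crossing_pairs_subset]
    by (intro ext nn_integral_cong) (auto simp: crossing_pairs_def delaunay_triangle_iff split: split_indicator)
  finally show ?thesis .
qed

text \<open>The conventions for infinite sets agree: \<open>enn2real\<close> sends infinity to 0,
  and \<open>card\<close> of an infinite set is 0.\<close>

lemma num_crossing_edges_eq:
  "real (num_crossing_edges S s t) = enn2real (emeasure (count_space UNIV) (crossing_pairs s t S)) / 2"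
proof -
  have "enn2real (emeasure (count_space UNIV) (crossing_pairs s t S)) = real (card (crossing_pairs s t S))"
    by (cases "finite (crossing_pairs s t S)") (simp_all add: ennreal_of_nat_eq_real_of_nat)
  then show ?thesis by (simp add: card_crossing_pairs)
qed

text \<open>Ordered pairs cover both sides of every line. Under this condition an edge of the
  triangulation always has a point beyond it, so none is a boundary edge.\<close>

definition half_planes_hit :: "(real^2) set \<Rightarrow> bool" where
  "half_planes_hit S \<longleftrightarrow> (\<forall>a b. a \<noteq> b \<longrightarrow> (\<exists>c\<in>S. side a b c > 0))"

text \<open>Among four distinct points of a circle there are two neighbours a and b with both others
  on the positive side of ab. Asking only about c and d on the positive side of ab therefore still
  excludes every cocircular quadruple, in the form in which uniqueness of an apex is used.\<close>

definition no_four_cocircular :: "(real^2) set \<Rightarrow> bool" where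
  "no_four_cocircular S \<longleftrightarrow> (\<forall>a\<in>S. \<forall>b\<in>S. \<forall>c\<in>S. \<forall>d\<in>S. side a b c > 0 \<longrightarrow> side a b d > 0 \<longrightarrow>
     thales a b d = pencil_param a b c * side a b d \<longrightarrow> c = d)"

text \<open>In a generic configuration every edge carries exactly one triangle on each side, so that counting
  ordered edges amounts to counting triangles \<open>abc\<close> with \<open>c\<close> on the positive side of \<open>ab\<close>.\<close>

lemma count_crossing_pairs_eq_triangles:
  assumes S: "locally_finite_set S" "half_planes_hit S" "no_four_cocircular S"
  shows "emeasure (count_space UNIV) (crossing_pairs s t S) =
    (\<integral>\<^sup>+a. \<integral>\<^sup>+b. \<integral>\<^sup>+c. indicator {(a, b, c). crosses s t a b \<and> side a b c > 0 \<and> delaunay_triangle S a b c} (a, b, c)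
      \<partial>count_space S \<partial>count_space S \<partial>count_space S)"
  unfolding emeasure_count_space_Times_eq[OF crossing_pairs_subset]
proof (intro nn_integral_cong)
  fix a b assume "a \<in> space (count_space S)" "b \<in> space (count_space S)"
  then have ab: "a \<in> S" "b \<in> S" by auto
  let ?I = "\<lambda>c. indicator {(a, b, c). crosses s t a b \<and> side a b c > 0 \<and> delaunay_triangle S a b c} (a, b, c) :: ennreal"
  show "indicator (crossing_pairs s t S) (a, b) = (\<integral>\<^sup>+c. ?I c \<partial>count_space S)"
  proof (cases "(a, b) \<in> crossing_pairs s t S")
    case True
    then obtain c' where c': "delaunay_triangle S a b c'" and cr: "crosses s t a b" by (auto simp: crossing_pairs_def)
    then obtain z r where zr: "a \<in> sphere z r" "b \<in> sphere z r" "ball z r \<inter> S = {}"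
      by (auto simp: delaunay_triangle_def)
    have "a \<noteq> b" using c' by (auto simp: delaunay_triangle_iff side_def)
    then obtain c where c: "side a b c > 0" "delaunay_triangle S a b c"
      using empty_disc_imp_triangle[OF S(1) _ ab _ zr] S(2) by (auto simp: half_planes_hit_def)
    have uniq: "d = c" if "d \<in> S" "side a b d > 0" "delaunay_triangle S a b d" for d
    proof -
      have "pencil_param a b d = pencil_param a b c" using delaunay_triangle_same_side[OF that(3) c(2) that(2) c(1)] .
      then have "thales a b d = pencil_param a b c * side a b d" using that(2) by (simp add: pencil_param_def field_simps)
      moreover have "c \<in> S" using c(2) by (simp add: delaunay_triangle_iff)
      ultimately show ?thesis
        using S(3)[unfolded no_four_cocircular_def, rule_format, of a b c d] ab that(1,2) c(1) by simp
    qed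
    have "(\<integral>\<^sup>+d. ?I d \<partial>count_space S) = (\<integral>\<^sup>+d. indicator {c} d \<partial>count_space S)"
    proof (intro nn_integral_cong)
      fix d assume "d \<in> space (count_space S)"
      then show "?I d = indicator {c} d"
        using uniq[of d] c cr by (cases "d = c") (auto split: split_indicator)
    qed
    also have "\<dots> = 1" using c by (subst nn_integral_indicator) (auto simp: emeasure_count_space delaunay_triangle_iff)
    finally show ?thesis using True by simp
  next
    case False
    then have "?I c = 0" for c by (auto simp: crossing_pairs_def split: split_indicator)
    then show ?thesis using False by simp
  qed
qed

section \<open>Edges gained and lost by inserting s and t\<close>

definition disc_neighbours :: "real^2 \<Rightarrow> (real^2) set \<Rightarrow> (real^2) set" where
  "disc_neighbours s S = {x \<in> S. \<exists>z r. s \<in> sphere z r \<and> x \<in> sphere z r \<and> ball z r \<inter> S = {}}"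

definition disc_pairs_around :: "real^2 \<Rightarrow> (real^2) set \<Rightarrow> ((real^2) \<times> (real^2)) set" where
  "disc_pairs_around s S = {(x, y) \<in> S \<times> S. x \<noteq> y \<and>
     (\<exists>z r. x \<in> sphere z r \<and> y \<in> sphere z r \<and> s \<in> cball z r \<and> ball z r \<inter> S = {})}"

text \<open>A disk that is empty for the larger set is empty for \<open>S\<close>. If both ends of
  the edge are in \<open>S\<close>, inflating this disk produces a triangle of \<open>S\<close> on
  the same edge; any other edge has s or t as an end.\<close>

lemma crossing_pairs_insert_subset:
  assumes S: "locally_finite_set S" "half_planes_hit S"
  shows "crossing_pairs s t (S \<union> {s, t}) \<subseteq> crossing_pairs s t S \<union>
    ({s} \<times> disc_neighbours s S \<union> disc_neighbours s S \<times> {s}) \<union>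
    ({t} \<times> disc_neighbours t S \<union> disc_neighbours t S \<times> {t}) \<union> {(s, t), (t, s)}"
proof (rule subrelI)
  fix a b assume "(a, b) \<in> crossing_pairs s t (S \<union> {s, t})"
  then obtain c where c: "delaunay_triangle (S \<union> {s, t}) a b c" and cr: "crosses s t a b"
    by (auto simp: crossing_pairs_def)
  then obtain z r where zr: "a \<in> sphere z r" "b \<in> sphere z r" "ball z r \<inter> S = {}"
    and ab: "a \<in> S \<union> {s, t}" "b \<in> S \<union> {s, t}"
    by (auto simp: delaunay_triangle_def)
  have "a \<noteq> b" using c by (auto simp: delaunay_triangle_iff side_def)
  have 1: "(a, b) \<in> crossing_pairs s t S" if "a \<in> S" "b \<in> S"
    using empty_disc_imp_triangle[OF S(1) _ that \<open>a \<noteq> b\<close> zr] S(2) \<open>a \<noteq> b\<close> cr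
    by (auto simp: half_planes_hit_def crossing_pairs_def)
  have 2: "b \<in> disc_neighbours a S" if "b \<in> S" using that zr unfolding disc_neighbours_def by blast
  have 3: "a \<in> disc_neighbours b S" if "a \<in> S" using that zr unfolding disc_neighbours_def by blast
  show "(a, b) \<in> crossing_pairs s t S \<union>
    ({s} \<times> disc_neighbours s S \<union> disc_neighbours s S \<times> {s}) \<union>
    ({t} \<times> disc_neighbours t S \<union> disc_neighbours t S \<times> {t}) \<union> {(s, t), (t, s)}"
    using 1 2 3 ab \<open>a \<noteq> b\<close> by blast
qed

text \<open>A triangle of \<open>S\<close> survives unless s or t falls into its open circumscribed
  disk, and in that case this disk witnesses membership in \<open>disc_pairs_around\<close>.\<close>

lemma crossing_pairs_subset_insert:
  "crossing_pairs s t S \<subseteq> crossing_pairs s t (S \<union> {s, t}) \<union> disc_pairs_around s S \<union> disc_pairs_around t S"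
proof (rule subrelI)
  fix a b assume "(a, b) \<in> crossing_pairs s t S"
  then obtain c where c: "delaunay_triangle S a b c" and cr: "crosses s t a b"
    by (auto simp: crossing_pairs_def)
  then obtain z r where zr: "{a, b, c} \<subseteq> sphere z r" "ball z r \<inter> S = {}"
    and S: "{a, b, c} \<subseteq> S" "\<not> collinear {a, b, c}"
    by (auto simp: delaunay_triangle_def)
  have "a \<noteq> b" using c by (auto simp: delaunay_triangle_iff side_def)
  show "(a, b) \<in> crossing_pairs s t (S \<union> {s, t}) \<union> disc_pairs_around s S \<union> disc_pairs_around t S"
  proof (cases "s \<in> ball z r \<or> t \<in> ball z r")
    case True
    then have "s \<in> cball z r \<or> t \<in> cball z r" by auto
    then have "(a, b) \<in> disc_pairs_around s S \<or> (a, b) \<in> disc_pairs_around t S"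
      using zr S \<open>a \<noteq> b\<close> unfolding disc_pairs_around_def by blast
    then show ?thesis by blast
  next
    case False
    then have "ball z r \<inter> (S \<union> {s, t}) = {}" using zr(2) by blast
    then have "delaunay_triangle (S \<union> {s, t}) a b c"
      using zr S unfolding delaunay_triangle_def by blast
    then show ?thesis using cr by (auto simp: crossing_pairs_def)
  qed
qed

section \<open>Planar integrals\<close>

definition perp :: "real^2 \<Rightarrow> real^2" where
  "perp v = vector [- v$2, v$1]"

lemma perp_nth [simp]: "perp v $ 1 = - v$2" "perp v $ 2 = v$1"
  by (simp_all add: perp_def)

lemma Basis_real2: "(Basis :: (real^2) set) = {axis 1 1, axis 2 1}"
  by (auto simp: Basis_vec_def UNIV_2)

lemma prod_Basis_real2: "(\<Prod>b\<in>(Basis :: (real^2) set). f b) = f (axis 1 1) * f (axis 2 1)"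
  by (simp add: Basis_real2 axis_eq_axis)

lemma box_real2: "x \<in> box l u \<longleftrightarrow> l$1 < x$1 \<and> x$1 < u$1 \<and> l$2 < x$2 \<and> x$2 < u$2" for x :: "real^2"
  by (auto simp: mem_box_cart forall_2)

lemma measurable_vector2 [measurable]: "(\<lambda>(x, y). vector [x, y] :: real^2) \<in> borel_measurable (borel \<Otimes>\<^sub>M borel)"
proof -
  have "(\<lambda>(x, y). vector [x, y] :: real^2) = (\<lambda>p. fst p *\<^sub>R axis 1 1 + snd p *\<^sub>R axis 2 1)"
    by (auto simp: eq_real2_iff axis_def)
  then show ?thesis by simp
qed

lemma lborel_real2: "lborel = distr (lborel \<Otimes>\<^sub>M lborel) borel (\<lambda>(x, y). vector [x, y] :: real^2)"
proof (rule lborel_eqI)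
  fix l u :: "real^2" assume le: "\<And>b. b \<in> Basis \<Longrightarrow> l \<bullet> b \<le> u \<bullet> b"
  have "(\<lambda>(x, y). vector [x, y] :: real^2) -` box l u \<inter> space (lborel \<Otimes>\<^sub>M lborel) = {l$1<..<u$1} \<times> {l$2<..<u$2}"
    by (auto simp: box_real2 space_pair_measure)
  then have "emeasure (distr (lborel \<Otimes>\<^sub>M lborel) borel (\<lambda>(x, y). vector [x, y] :: real^2)) (box l u) =
      emeasure lborel {l$1<..<u$1} * emeasure lborel {l$2<..<u$2}"
    by (subst emeasure_distr) (simp_all add: lborel.emeasure_pair_measure_Times)
  also have "\<dots> = (\<Prod>b\<in>Basis. (u - l) \<bullet> b)"
    using le[of "axis 1 1"] le[of "axis 2 1"] unfolding prod_Basis_real2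
    by (simp add: Basis_real2 inner_axis emeasure_lborel_Ioo ennreal_mult[symmetric])
  finally show "emeasure (distr (lborel \<Otimes>\<^sub>M lborel) borel (\<lambda>(x, y). vector [x, y] :: real^2)) (box l u) =
      (\<Prod>b\<in>Basis. (u - l) \<bullet> b)" .
qed simp

lemma nn_integral_real2:
  fixes F :: "real^2 \<Rightarrow> ennreal"
  assumes [measurable]: "F \<in> borel_measurable borel"
  shows "(\<integral>\<^sup>+v. F v \<partial>lborel) = (\<integral>\<^sup>+x. \<integral>\<^sup>+y. F (vector [x, y]) \<partial>lborel \<partial>lborel)"
proof -
  have "(\<integral>\<^sup>+v. F v \<partial>lborel) = (\<integral>\<^sup>+z. F ((\<lambda>(x, y). vector [x, y]) z) \<partial>(lborel \<Otimes>\<^sub>M lborel))"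
    by (subst lborel_real2, subst nn_integral_distr) simp_all
  also have "\<dots> = (\<integral>\<^sup>+x. \<integral>\<^sup>+y. F ((\<lambda>(x, y). vector [x, y]) (x, y)) \<partial>lborel \<partial>lborel)"
    by (rule lborel.nn_integral_fst[symmetric]) simp
  finally show ?thesis by simp
qed

lemma lborel_rotate:
  fixes e :: "real^2"
  assumes e: "e \<bullet> e = 1"
  shows "lborel = distr lborel borel (\<lambda>v::real^2. v$1 *\<^sub>R e + v$2 *\<^sub>R perp e)"
proof (rule lborel_eqI)
  let ?f = "\<lambda>v::real^2. v$1 *\<^sub>R e + v$2 *\<^sub>R perp e"
  \<comment> \<open>The coordinates with respect to the orthonormal frame \<open>e\<close>,
    \<open>perp e\<close>. As \<open>?g\<close> inverts \<open>?f\<close>, the preimage of a box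
    under \<open>?f\<close> is its image under the orthogonal map \<open>?g\<close>, which preserves
    area.\<close>
  let ?g = "\<lambda>w::real^2. vector [w \<bullet> e, w \<bullet> perp e] :: real^2"
  have e': "e$1 * e$1 + e$2 * e$2 = 1" using e by (simp add: inner_real2)
  have fg: "?f (?g w) = w" for w
  proof -
    have "(w$1 * e$1 + w$2 * e$2) * e$1 - (w$2 * e$1 - w$1 * e$2) * e$2 = w$1"
      "(w$1 * e$1 + w$2 * e$2) * e$2 + (w$2 * e$1 - w$1 * e$2) * e$1 = w$2"
      using e' by algebra+
    then show ?thesis by (simp add: eq_real2_iff inner_real2 algebra_simps)
  qed
  have gf: "?g (?f w) = w" for w
  proof -
    have "(w$1 * e$1 - w$2 * e$2) * e$1 + (w$1 * e$2 + w$2 * e$1) * e$2 = w$1"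
      "(w$1 * e$2 + w$2 * e$1) * e$1 - (w$1 * e$1 - w$2 * e$2) * e$2 = w$2"
      using e' by algebra+
    then show ?thesis by (simp add: eq_real2_iff inner_real2 algebra_simps)
  qed
  have lin: "linear ?g"
    by (rule linearI) (simp_all add: eq_real2_iff inner_add_left)
  have orth: "orthogonal_transformation ?g"
    unfolding orthogonal_transformation_def
  proof (intro conjI lin allI)
    fix v w :: "real^2"
    have "(v$1 * e$1 + v$2 * e$2) * (w$1 * e$1 + w$2 * e$2) + (v$2 * e$1 - v$1 * e$2) * (w$2 * e$1 - w$1 * e$2) = v$1 * w$1 + v$2 * w$2"
      using e' by algebra
    then show "?g v \<bullet> ?g w = v \<bullet> w" by (simp add: inner_real2 algebra_simps)
  qed
  fix l u :: "real^2" assume le: "\<And>b. b \<in> Basis \<Longrightarrow> l \<bullet> b \<le> u \<bullet> b"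
  have vim: "?f -` box l u = ?g ` box l u"
    using fg gf by (auto simp: image_iff) (metis+)
  have cont: "continuous_on UNIV ?f" by (intro continuous_intros)
  have "emeasure (distr lborel borel ?f) (box l u) = emeasure lborel (?f -` box l u)"
    using cont by (subst emeasure_distr) (auto intro: borel_measurable_continuous_onI)
  also have "\<dots> = emeasure lebesgue (?g ` box l u)"
    unfolding vim[symmetric] using open_vimage[OF open_box cont] by simp
  also have "\<dots> = ennreal (measure lebesgue (?g ` box l u))"
    using measurable_orthogonal_image[OF orth lmeasurable_box] by (rule emeasure_eq_measure2[symmetric, THEN sym])
  also have "measure lebesgue (?g ` box l u) = measure lebesgue (box l u)"
    by (rule measure_orthogonal_image[OF orth lmeasurable_box])
  also have "ennreal \<dots> = emeasure lborel (box l u)" using emeasure_bounded_finite[OF bounded_box, of l u] by (simp add: emeasure_eq_ennreal_measure)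
  also have "\<dots> = (\<Prod>b\<in>Basis. (u - l) \<bullet> b)" using le by (rule emeasure_lborel_box)
  finally show "emeasure (distr lborel borel ?f) (box l u) = (\<Prod>b\<in>Basis. (u - l) \<bullet> b)" .
qed simp

lemma nn_integral_rotate:
  fixes F :: "real^2 \<Rightarrow> ennreal"
  assumes [measurable]: "F \<in> borel_measurable borel" and e: "e \<bullet> e = 1"
  shows "(\<integral>\<^sup>+v. F v \<partial>lborel) = (\<integral>\<^sup>+x. \<integral>\<^sup>+y. F (x *\<^sub>R e + y *\<^sub>R perp e) \<partial>lborel \<partial>lborel)"
proof -
  have [measurable]: "(\<lambda>v::real^2. v$1 *\<^sub>R e + v$2 *\<^sub>R perp e) \<in> borel_measurable borel"
    by (intro borel_measurable_continuous_onI continuous_intros)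
  have "(\<integral>\<^sup>+v. F v \<partial>lborel) = (\<integral>\<^sup>+v. F ((\<lambda>v::real^2. v$1 *\<^sub>R e + v$2 *\<^sub>R perp e) v) \<partial>lborel)"
    by (subst lborel_rotate[OF e], subst nn_integral_distr) simp_all
  also have "\<dots> = (\<integral>\<^sup>+x. \<integral>\<^sup>+y. F (x *\<^sub>R e + y *\<^sub>R perp e) \<partial>lborel \<partial>lborel)"
    by (subst nn_integral_real2) simp_all
  finally show ?thesis .
qed

section \<open>Gaussian integrals and elementary area computations\<close>

lemma nn_integral_lborel_shift:
  fixes F :: "'a::euclidean_space \<Rightarrow> ennreal"
  assumes [measurable]: "F \<in> borel_measurable borel"
  shows "(\<integral>\<^sup>+x. F (a + x) \<partial>lborel) = (\<integral>\<^sup>+x. F x \<partial>lborel)"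
  by (subst (2) lborel_distr_plus[symmetric, of a], subst nn_integral_distr) simp_all

lemma nn_integral_gauss1:
  assumes c: "c > 0"
  shows "(\<integral>\<^sup>+x. ennreal (exp (- c * x\<^sup>2)) \<partial>lborel) = ennreal (sqrt (pi / c))"
proof -
  \<comment> \<open>Variance 1/(2 c) makes the exponent of the normal density equal to - c
    x^2.\<close>
  define \<sigma> where "\<sigma> = sqrt (1 / (2 * c))"
  have \<sigma>: "\<sigma> > 0" "\<sigma>\<^sup>2 = 1 / (2 * c)" using c by (simp_all add: \<sigma>_def)
  have eq: "exp (- c * x\<^sup>2) = sqrt (pi / c) * normal_density 0 \<sigma> x" for x
    using c by (simp add: normal_density_def \<sigma>(2) real_sqrt_divide field_simps)
  have "(\<integral>\<^sup>+x. ennreal (exp (- c * x\<^sup>2)) \<partial>lborel) = ennreal (sqrt (pi / c)) * (\<integral>\<^sup>+x. ennreal (normal_density 0 \<sigma> x) \<partial>lborel)"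
    unfolding eq using c by (subst nn_integral_cmult[symmetric]) (auto simp: ennreal_mult intro!: nn_integral_cong)
  also have "(\<integral>\<^sup>+x. ennreal (normal_density 0 \<sigma> x) \<partial>lborel) = 1"
    using \<sigma>(1) by (subst nn_integral_eq_integral) auto
  finally show ?thesis by simp
qed

lemma nn_integral_gauss2:
  fixes s :: "real^2"
  assumes c: "c > 0"
  shows "(\<integral>\<^sup>+x. ennreal (exp (- c * (dist x s)\<^sup>2)) \<partial>lborel) = ennreal (pi / c)"
proof -
  have "(\<integral>\<^sup>+x. ennreal (exp (- c * (dist x s)\<^sup>2)) \<partial>lborel) = (\<integral>\<^sup>+x. ennreal (exp (- c * (dist (s + x) s)\<^sup>2)) \<partial>lborel)"
    by (rule nn_integral_lborel_shift[symmetric]) simp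
  also have "\<dots> = (\<integral>\<^sup>+x. \<integral>\<^sup>+y. ennreal (exp (- c * (dist (s + vector [x, y]) s)\<^sup>2)) \<partial>lborel \<partial>lborel)"
    by (rule nn_integral_real2) simp
  also have "\<dots> = (\<integral>\<^sup>+x. \<integral>\<^sup>+y. ennreal (exp (- c * x\<^sup>2)) * ennreal (exp (- c * y\<^sup>2)) \<partial>lborel \<partial>lborel)"
  proof (intro nn_integral_cong)
    fix x y :: real
    have "(dist (s + vector [x, y]) s)\<^sup>2 = x\<^sup>2 + y\<^sup>2"
      unfolding dist_norm power2_norm_eq_inner inner_real2 by (simp add: power2_eq_square)
    then show "ennreal (exp (- c * (dist (s + vector [x, y]) s)\<^sup>2)) = ennreal (exp (- c * x\<^sup>2)) * ennreal (exp (- c * y\<^sup>2))"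
      by (simp only:) (simp add: ennreal_mult[symmetric] exp_add[symmetric] algebra_simps)
  qed
  also have "\<dots> = ennreal (sqrt (pi / c)) * ennreal (sqrt (pi / c))"
    using nn_integral_gauss1[OF c] by (simp add: nn_integral_cmult nn_integral_multc)
  also have "\<dots> = ennreal (pi / c)" using c by (simp add: ennreal_mult[symmetric])
  finally show ?thesis .
qed

text \<open>Crossing means a + u v = s + w (t - s) for some u, w in [0, 1]. The admissible a are
  thus the image of the unit square under the affine map s + w (t - s) - u v, and the area is the
  modulus of its determinant, also in the degenerate case.\<close>

lemma emeasure_crosses_translate:
  "emeasure lborel {a. crosses s t a (a + v)} = ennreal \<bar>v$1 * (t - s)$2 - v$2 * (t - s)$1\<bar>"
proof -
  let ?L = "\<lambda>x::real^2. x$2 *\<^sub>R (t - s) - x$1 *\<^sub>R v"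
  have lin: "linear ?L" by (rule linearI) (simp_all add: algebra_simps)
  have "{a. crosses s t a (a + v)} = (\<lambda>x. s + x) ` ?L ` cbox 0 1"
  proof (intro set_eqI iffI)
    fix a assume "a \<in> {a. crosses s t a (a + v)}"
    then obtain u w where u: "0 \<le> u" "u \<le> 1" "0 \<le> w" "w \<le> 1" "(1 - u) *\<^sub>R a + u *\<^sub>R (a + v) = (1 - w) *\<^sub>R s + w *\<^sub>R t"
      by (auto simp: crosses_def closed_segment_def)
    have "a = s + ?L (vector [u, w])" using u(5) by (simp add: algebra_simps)
    moreover have "vector [u, w] \<in> cbox 0 (1 :: real^2)" using u by (simp add: mem_box_cart forall_2)
    ultimately show "a \<in> (\<lambda>x. s + x) ` ?L ` cbox 0 1" by blast
  next
    fix a assume "a \<in> (\<lambda>x. s + x) ` ?L ` cbox 0 1"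
    then obtain x :: "real^2" where x: "a = s + (x$2 *\<^sub>R (t - s) - x$1 *\<^sub>R v)" "0 \<le> x$1" "x$1 \<le> 1" "0 \<le> x$2" "x$2 \<le> 1"
      by (auto simp: mem_box_cart forall_2)
    have "(1 - x$1) *\<^sub>R a + x$1 *\<^sub>R (a + v) = (1 - x$2) *\<^sub>R s + x$2 *\<^sub>R t" unfolding x(1) by (simp add: algebra_simps)
    moreover have "(1 - x$1) *\<^sub>R a + x$1 *\<^sub>R (a + v) \<in> closed_segment a (a + v)"
      "(1 - x$2) *\<^sub>R s + x$2 *\<^sub>R t \<in> closed_segment s t" using x(2-5) by (auto simp: closed_segment_def)
    ultimately show "a \<in> {a. crosses s t a (a + v)}" by (auto simp: crosses_def)
  qed
  moreover have "measure lebesgue ((\<lambda>x. s + x) ` ?L ` cbox 0 1) = \<bar>det (matrix ?L)\<bar> * measure lebesgue (cbox 0 (1 :: real^2))"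
    by (subst measure_translation) (rule measure_linear_image[OF lin lmeasurable_cbox])
  moreover have "measure lebesgue (cbox 0 (1 :: real^2)) = 1"
    by (simp add: content_cbox_cart box_ne_empty prod_Basis_real2 interval_eq_empty_cart)
  moreover have "det (matrix ?L) = v$2 * (t - s)$1 - v$1 * (t - s)$2"
    by (simp add: det_2 matrix_def axis_def)
  ultimately have m: "measure lebesgue {a. crosses s t a (a + v)} = \<bar>v$1 * (t - s)$2 - v$2 * (t - s)$1\<bar>"
    by (simp add: abs_minus_commute)
  have "(\<lambda>x. s + x) ` ?L ` cbox 0 1 \<in> lmeasurable"
    by (intro measurable_translation measurable_linear_image lin lmeasurable_cbox)
  then have "{a. crosses s t a (a + v)} \<in> lmeasurable" using \<open>{a. crosses s t a (a + v)} = _\<close> by simp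
  then have "emeasure lebesgue {a. crosses s t a (a + v)} = ennreal \<bar>v$1 * (t - s)$2 - v$2 * (t - s)$1\<bar>"
    unfolding m[symmetric] by (rule emeasure_eq_measure2)
  moreover have "{a. crosses s t a (a + v)} \<in> sets borel"
  proof -
    have "Measurable.pred borel (\<lambda>a. crosses s t a (a + v))" by measurable
    then show ?thesis by (simp add: pred_def)
  qed
  ultimately show ?thesis by simp
qed

lemma nn_integral_abs_square_less:
  assumes q: "q \<ge> 0"
  shows "(\<integral>\<^sup>+y. ennreal \<bar>y\<bar> * indicator {y. y\<^sup>2 < q} y \<partial>lborel) = ennreal q"
proof -
  define r where "r = sqrt q"
  have r: "r \<ge> 0" "r\<^sup>2 = q" using q by (simp_all add: r_def)
  have half: "(\<integral>\<^sup>+y. ennreal y * indicator {0..r} y \<partial>lborel) = ennreal (q / 2)"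
  proof -
    have "(\<integral>\<^sup>+y. ennreal y * indicator {0..r} y \<partial>lborel) = ennreal (r\<^sup>2 / 2 - 0\<^sup>2 / 2)"
      by (rule nn_integral_FTC_Icc) (use r in \<open>auto intro!: derivative_eq_intros\<close>)
    then show ?thesis using r by simp
  qed
  have half': "(\<integral>\<^sup>+y. ennreal (- y) * indicator {0..r} (- y) \<partial>lborel) = ennreal (q / 2)"
    using nn_integral_real_affine[of "\<lambda>y. ennreal y * indicator {0..r} y" "-1" 0] half by simp
  have iff: "y\<^sup>2 < q \<longleftrightarrow> \<bar>y\<bar> < r" for y
    unfolding r(2)[symmetric] using r(1) by (metis abs_ge_zero abs_le_square_iff abs_of_nonneg not_le)
  have "(\<integral>\<^sup>+y. ennreal \<bar>y\<bar> * indicator {y. y\<^sup>2 < q} y \<partial>lborel) =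
      (\<integral>\<^sup>+y. ennreal y * indicator {0..r} y + ennreal (- y) * indicator {0..r} (- y) \<partial>lborel)"
    using AE_lborel_singleton[of r] AE_lborel_singleton[of "- r"] AE_lborel_singleton[of 0]
    by (intro nn_integral_cong_AE, eventually_elim) (auto simp: iff ennreal_neg split: split_indicator)
  also have "\<dots> = ennreal (q / 2) + ennreal (q / 2)"
    by (subst nn_integral_add) (simp_all add: half half')
  also have "\<dots> = ennreal q" using q by (simp add: ennreal_plus[symmetric] del: ennreal_plus)
  finally show ?thesis .
qed

lemma nn_integral_parabola:
  assumes R: "R \<ge> 0"
  shows "(\<integral>\<^sup>+x. ennreal (R\<^sup>2 - x\<^sup>2) * indicator {x. x\<^sup>2 < R\<^sup>2} x \<partial>lborel) = ennreal (4 / 3 * R ^ 3)"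
    and "(\<integral>\<^sup>+x. ennreal ((R\<^sup>2 - x\<^sup>2)\<^sup>2) * indicator {x. x\<^sup>2 < R\<^sup>2} x \<partial>lborel) = ennreal (16 / 15 * R ^ 5)"
proof -
  have iff: "x \<in> {-R..R} \<longleftrightarrow> x\<^sup>2 \<le> R\<^sup>2" for x
    using R abs_le_square_iff[of x R] by auto
  have ind: "f x * indicator {x. x\<^sup>2 < R\<^sup>2} x = f x * indicator {-R..R} x"
    if "x\<^sup>2 = R\<^sup>2 \<Longrightarrow> f x = 0" for f :: "real \<Rightarrow> ennreal" and x
    using that unfolding indicator_def mem_Collect_eq iff by auto
  have "(\<integral>\<^sup>+x. ennreal (R\<^sup>2 - x\<^sup>2) * indicator {x. x\<^sup>2 < R\<^sup>2} x \<partial>lborel) =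
      (\<integral>\<^sup>+x. ennreal (R\<^sup>2 - x\<^sup>2) * indicator {-R..R} x \<partial>lborel)"
    by (intro nn_integral_cong ind) simp
  also have "\<dots> = ennreal ((R\<^sup>2 * R - R ^ 3 / 3) - (R\<^sup>2 * (-R) - (-R) ^ 3 / 3))"
    using R by (intro nn_integral_FTC_Icc[of _ "-R" R "\<lambda>x. R\<^sup>2 * x - x ^ 3 / 3"])
      (auto intro!: derivative_eq_intros simp: iff[simplified] abs_le_square_iff[symmetric])
  also have "(R\<^sup>2 * R - R ^ 3 / 3) - (R\<^sup>2 * (-R) - (-R) ^ 3 / 3) = 4 / 3 * R ^ 3"
    by (simp add: power2_eq_square power3_eq_cube)
  finally show "(\<integral>\<^sup>+x. ennreal (R\<^sup>2 - x\<^sup>2) * indicator {x. x\<^sup>2 < R\<^sup>2} x \<partial>lborel) = ennreal (4 / 3 * R ^ 3)" .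
  have "(\<integral>\<^sup>+x. ennreal ((R\<^sup>2 - x\<^sup>2)\<^sup>2) * indicator {x. x\<^sup>2 < R\<^sup>2} x \<partial>lborel) =
      (\<integral>\<^sup>+x. ennreal ((R\<^sup>2 - x\<^sup>2)\<^sup>2) * indicator {-R..R} x \<partial>lborel)"
    by (intro nn_integral_cong ind) simp
  also have "\<dots> = ennreal ((R ^ 4 * R - 2 * R\<^sup>2 * R ^ 3 / 3 + R ^ 5 / 5) - (R ^ 4 * (-R) - 2 * R\<^sup>2 * (-R) ^ 3 / 3 + (-R) ^ 5 / 5))"
  proof (rule nn_integral_FTC_Icc)
    show "DERIV (\<lambda>x. R ^ 4 * x - 2 * R\<^sup>2 * x ^ 3 / 3 + x ^ 5 / 5) x :> (R\<^sup>2 - x\<^sup>2)\<^sup>2" for x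
      by (auto intro!: derivative_eq_intros simp: field_simps power2_eq_square power4_eq_xxxx)
  qed (use R in auto)
  also have "(R ^ 4 * R - 2 * R\<^sup>2 * R ^ 3 / 3 + R ^ 5 / 5) - (R ^ 4 * (-R) - 2 * R\<^sup>2 * (-R) ^ 3 / 3 + (-R) ^ 5 / 5) = 16 / 15 * R ^ 5"
    by (simp add: power2_eq_square power3_eq_cube power4_eq_xxxx eval_nat_numeral field_simps)
  finally show "(\<integral>\<^sup>+x. ennreal ((R\<^sup>2 - x\<^sup>2)\<^sup>2) * indicator {x. x\<^sup>2 < R\<^sup>2} x \<partial>lborel) = ennreal (16 / 15 * R ^ 5)" .
qed

section \<open>The integral over the shapes of triangles\<close>

lemma measurable_circumradius [measurable (raw)]:
  assumes [measurable]: "a \<in> borel_measurable K" "b \<in> borel_measurable K" "c \<in> borel_measurable K"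
  shows "(\<lambda>p. circumradius (a p) (b p) (c p)) \<in> borel_measurable K"
  unfolding circumradius_def by measurable

lemma perp_inner [simp]: "e \<bullet> perp e = 0" "perp e \<bullet> e = 0" "perp e \<bullet> perp e = e \<bullet> e"
  by (simp_all add: inner_real2)

lemma inner_sgn_self: "v \<noteq> 0 \<Longrightarrow> sgn v \<bullet> sgn v = 1"
  by (simp add: norm_eq_1[symmetric] norm_sgn)

text \<open>In a frame whose first axis points along \<open>d\<close>, the integrand is norm d *
  |y|. A slice at fixed x contributes norm d * (q - x^2), and the parabola integral
  finishes.\<close>

lemma nn_integral_side_ball:
  assumes q: "q \<ge> 0"
  shows "(\<integral>\<^sup>+v. ennreal \<bar>side 0 v d\<bar> * indicator {v. v \<bullet> v < q} v \<partial>lborel) = ennreal (norm d * (4 / 3) * sqrt q ^ 3)"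
proof (cases "d = 0")
  case True
  then show ?thesis by (simp add: side_def)
next
  case False
  define e where "e = sgn d"
  have e: "e \<bullet> e = 1" using False by (simp add: e_def inner_sgn_self)
  have d: "d = norm d *\<^sub>R e" using False by (simp add: e_def sgn_div_norm)
  have vv: "(x *\<^sub>R e + y *\<^sub>R perp e) \<bullet> (x *\<^sub>R e + y *\<^sub>R perp e) = x\<^sup>2 + y\<^sup>2" for x y
    using e by (simp add: inner_add_left inner_add_right power2_eq_square)
  have sd: "\<bar>side 0 (x *\<^sub>R e + y *\<^sub>R perp e) d\<bar> = norm d * \<bar>y\<bar>" for x y
  proof -
    have "side 0 (x *\<^sub>R e + y *\<^sub>R perp e) (norm d *\<^sub>R e) = - norm d * y * (e \<bullet> e)"
      by (simp add: side_def inner_real2 algebra_simps)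
    then show ?thesis using e d by (simp add: abs_mult)
  qed
  have "(\<integral>\<^sup>+v. ennreal \<bar>side 0 v d\<bar> * indicator {v. v \<bullet> v < q} v \<partial>lborel) =
    (\<integral>\<^sup>+x. \<integral>\<^sup>+y. ennreal \<bar>side 0 (x *\<^sub>R e + y *\<^sub>R perp e) d\<bar> * indicator {v. v \<bullet> v < q} (x *\<^sub>R e + y *\<^sub>R perp e) \<partial>lborel \<partial>lborel)"
    by (rule nn_integral_rotate[OF _ e]) measurable
  also have "\<dots> = (\<integral>\<^sup>+x. ennreal (norm d) * (ennreal ((sqrt q)\<^sup>2 - x\<^sup>2) * indicator {x. x\<^sup>2 < (sqrt q)\<^sup>2} x) \<partial>lborel)"
  proof (intro nn_integral_cong)
    fix x :: real
    have "(\<integral>\<^sup>+y. ennreal \<bar>side 0 (x *\<^sub>R e + y *\<^sub>R perp e) d\<bar> * indicator {v. v \<bullet> v < q} (x *\<^sub>R e + y *\<^sub>R perp e) \<partial>lborel) =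
      (\<integral>\<^sup>+y. ennreal (norm d) * (ennreal \<bar>y\<bar> * indicator {y. y\<^sup>2 < q - x\<^sup>2} y) \<partial>lborel)"
      unfolding sd by (intro nn_integral_cong) (auto simp: vv ennreal_mult split: split_indicator)
    also have "\<dots> = ennreal (norm d) * (\<integral>\<^sup>+y. ennreal \<bar>y\<bar> * indicator {y. y\<^sup>2 < q - x\<^sup>2} y \<partial>lborel)"
      by (rule nn_integral_cmult) simp
    also have "(\<integral>\<^sup>+y. ennreal \<bar>y\<bar> * indicator {y. y\<^sup>2 < q - x\<^sup>2} y \<partial>lborel) =
        ennreal ((sqrt q)\<^sup>2 - x\<^sup>2) * indicator {x. x\<^sup>2 < (sqrt q)\<^sup>2} x"
    proof (cases "x\<^sup>2 < q")
      case True
      then show ?thesis using nn_integral_abs_square_less[of "q - x\<^sup>2"] q by simp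
    next
      case False
      then have "\<not> y\<^sup>2 < q - x\<^sup>2" for y using zero_le_power2[of y] by linarith
      then show ?thesis using False q by simp
    qed
    finally show "(\<integral>\<^sup>+y. ennreal \<bar>side 0 (x *\<^sub>R e + y *\<^sub>R perp e) d\<bar> * indicator {v. v \<bullet> v < q} (x *\<^sub>R e + y *\<^sub>R perp e) \<partial>lborel) =
      ennreal (norm d) * (ennreal ((sqrt q)\<^sup>2 - x\<^sup>2) * indicator {x. x\<^sup>2 < (sqrt q)\<^sup>2} x)" .
  qed
  also have "\<dots> = ennreal (norm d) * ennreal (4 / 3 * sqrt q ^ 3)"
    using nn_integral_parabola(1)[of "sqrt q"] q by (subst nn_integral_cmult) simp_all
  also have "\<dots> = ennreal (norm d * (4 / 3) * sqrt q ^ 3)"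
    using q by (simp add: ennreal_mult[symmetric] mult.assoc)
  finally show ?thesis .
qed

lemma square_less_iff: "0 \<le> a \<Longrightarrow> 0 \<le> b \<Longrightarrow> a\<^sup>2 < b\<^sup>2 \<longleftrightarrow> a < b" for a b :: real
  using power2_less_imp_less[of a b] power_strict_mono[of a b 2] by auto

text \<open>Here y runs along the chord of length l and x across it, from its midpoint. With k =
  sqrt (rho^2 - l^2/4), the distance from the midpoint to the two centres, and s = sqrt (rho^2 -
  y^2), half the length of the slice of either disk, the first set is the interval from |k - s| to k
  + s and the second runs from - min k s to min k s. Both have length 2 * min k s.\<close>

lemma lune_slice:
  fixes y l \<rho> :: real
  assumes l: "l > 0" and \<rho>: "\<rho> \<ge> 0"
  shows "(\<integral>\<^sup>+x. indicator {x. x > 0 \<and> (x\<^sup>2 + y\<^sup>2 - l\<^sup>2 / 4)\<^sup>2 < x\<^sup>2 * (4 * \<rho>\<^sup>2 - l\<^sup>2)} x \<partial>lborel) =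
    (\<integral>\<^sup>+x. indicator {x. x\<^sup>2 + y\<^sup>2 < \<rho>\<^sup>2 \<and> l\<^sup>2 < 4 * (\<rho>\<^sup>2 - x\<^sup>2)} x \<partial>lborel)"
    (is "(\<integral>\<^sup>+x. indicator ?A x \<partial>lborel) = (\<integral>\<^sup>+x. indicator ?B x \<partial>lborel)")
proof (cases "l\<^sup>2 < 4 * \<rho>\<^sup>2 \<and> y\<^sup>2 < \<rho>\<^sup>2")
  case False
  have "x \<notin> ?A" for x
  proof (cases "l\<^sup>2 < 4 * \<rho>\<^sup>2")
    case True
    define k where "k = sqrt (\<rho>\<^sup>2 - l\<^sup>2 / 4)"
    have k: "k\<^sup>2 = \<rho>\<^sup>2 - l\<^sup>2 / 4" using True by (simp add: k_def)
    \<comment> \<open>The factors are the powers of the point with respect to the two circles of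
      radius rho through the ends of the chord. For |y| >= rho neither can be negative.\<close>
    have "(x\<^sup>2 + y\<^sup>2 - l\<^sup>2 / 4)\<^sup>2 - x\<^sup>2 * (4 * \<rho>\<^sup>2 - l\<^sup>2) =
      ((x - k)\<^sup>2 + (y\<^sup>2 - \<rho>\<^sup>2)) * ((x + k)\<^sup>2 + (y\<^sup>2 - \<rho>\<^sup>2))"
      using k by algebra
    moreover have "y\<^sup>2 - \<rho>\<^sup>2 \<ge> 0" using True False by simp
    ultimately have "(x\<^sup>2 + y\<^sup>2 - l\<^sup>2 / 4)\<^sup>2 - x\<^sup>2 * (4 * \<rho>\<^sup>2 - l\<^sup>2) \<ge> 0" by simp
    then show ?thesis by simp
  next
    case False
    then have "x\<^sup>2 * (4 * \<rho>\<^sup>2 - l\<^sup>2) \<le> 0" by (simp add: mult_nonneg_nonpos)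
    moreover have "0 \<le> (x\<^sup>2 + y\<^sup>2 - l\<^sup>2 / 4)\<^sup>2" by simp
    ultimately show ?thesis by (simp only: mem_Collect_eq) linarith
  qed
  moreover have "x \<notin> ?B" for x
  proof
    assume "x \<in> ?B"
    then have "x\<^sup>2 + y\<^sup>2 < \<rho>\<^sup>2" "l\<^sup>2 < 4 * (\<rho>\<^sup>2 - x\<^sup>2)" by auto
    then have "l\<^sup>2 < 4 * \<rho>\<^sup>2" "y\<^sup>2 < \<rho>\<^sup>2" using zero_le_power2[of x] by argo+
    then show False using False by simp
  qed
  ultimately have "?A = {}" "?B = {}" by blast+
  then show ?thesis by simp
next
  case True
  define k where "k = sqrt (\<rho>\<^sup>2 - l\<^sup>2 / 4)"
  define s where "s = sqrt (\<rho>\<^sup>2 - y\<^sup>2)"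
  have k: "k\<^sup>2 = \<rho>\<^sup>2 - l\<^sup>2 / 4" "k > 0" using True by (simp_all add: k_def)
  have s: "s\<^sup>2 = \<rho>\<^sup>2 - y\<^sup>2" "s > 0" using True by (simp_all add: s_def)
  have ks: "(k - s)\<^sup>2 < (k + s)\<^sup>2" using k(2) s(2) by (simp add: power2_eq_square algebra_simps)
  have sq_less: "a\<^sup>2 < b\<^sup>2 \<longleftrightarrow> \<bar>a\<bar> < \<bar>b\<bar>" for a b :: real
    by (meson abs_le_square_iff not_le)
  have "?A = {\<bar>k - s\<bar><..<k + s}"
  proof (intro set_eqI)
    fix x
    have "(x\<^sup>2 + y\<^sup>2 - l\<^sup>2 / 4)\<^sup>2 - x\<^sup>2 * (4 * \<rho>\<^sup>2 - l\<^sup>2) = (x\<^sup>2 - (k - s)\<^sup>2) * (x\<^sup>2 - (k + s)\<^sup>2)"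
      using k(1) s(1) by algebra
    then have "(x\<^sup>2 + y\<^sup>2 - l\<^sup>2 / 4)\<^sup>2 < x\<^sup>2 * (4 * \<rho>\<^sup>2 - l\<^sup>2) \<longleftrightarrow> (x\<^sup>2 - (k - s)\<^sup>2) * (x\<^sup>2 - (k + s)\<^sup>2) < 0"
      by linarith
    also have "\<dots> \<longleftrightarrow> (k - s)\<^sup>2 < x\<^sup>2 \<and> x\<^sup>2 < (k + s)\<^sup>2"
      using ks by (auto simp: mult_less_0_iff)
    also have "\<dots> \<longleftrightarrow> \<bar>k - s\<bar> < \<bar>x\<bar> \<and> \<bar>x\<bar> < k + s" unfolding sq_less using k(2) s(2) by simp
    finally show "x \<in> ?A \<longleftrightarrow> x \<in> {\<bar>k - s\<bar><..<k + s}" by auto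
  qed
  moreover have "?B = {- min k s<..<min k s}"
  proof (intro set_eqI)
    fix x
    have "x \<in> ?B \<longleftrightarrow> x\<^sup>2 < s\<^sup>2 \<and> x\<^sup>2 < k\<^sup>2" using k(1) s(1) by auto
    also have "\<dots> \<longleftrightarrow> \<bar>x\<bar> < s \<and> \<bar>x\<bar> < k" unfolding sq_less using k(2) s(2) by simp
    finally show "x \<in> ?B \<longleftrightarrow> x \<in> {- min k s<..<min k s}" by auto
  qed
  moreover have "k + s - \<bar>k - s\<bar> = min k s - (- min k s)" by (auto simp: min_def)
  ultimately show ?thesis using k(2) s(2) by (simp add: min_def)
qed

text \<open>The apex has coordinates y along and x across the chord, measured from the midpoint.
  Then \<open>thales\<close> becomes x^2 + y^2 - l^2/4 and \<open>side\<close> becomes l x, and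
  squaring removes the root.\<close>

lemma circumradius_less_iff:
  assumes e: "e \<bullet> e = 1" and l: "l > 0" and x: "x > 0" and \<rho>: "\<rho> \<ge> 0"
  shows "circumradius 0 (l *\<^sub>R e) ((l / 2 + y) *\<^sub>R e + x *\<^sub>R perp e) < \<rho> \<longleftrightarrow>
      (x\<^sup>2 + y\<^sup>2 - l\<^sup>2 / 4)\<^sup>2 < x\<^sup>2 * (4 * \<rho>\<^sup>2 - l\<^sup>2)"
    and "side 0 (l *\<^sub>R e) (z *\<^sub>R e + x' *\<^sub>R perp e) = l * x'"
proof -
  have e': "e$1 * e$1 + e$2 * e$2 = 1" using e by (simp add: inner_real2)
  show sd: "side 0 (l *\<^sub>R e) (z *\<^sub>R e + x' *\<^sub>R perp e) = l * x'" for z x'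
  proof -
    have "side 0 (l *\<^sub>R e) (z *\<^sub>R e + x' *\<^sub>R perp e) = l * x' * (e$1 * e$1 + e$2 * e$2)"
      by (simp add: side_def algebra_simps)
    then show ?thesis using e' by simp
  qed
  have th: "thales 0 (l *\<^sub>R e) ((l / 2 + y) *\<^sub>R e + x *\<^sub>R perp e) = x\<^sup>2 + y\<^sup>2 - l\<^sup>2 / 4"
    using e by (simp add: thales_def inner_diff_right inner_add_left inner_add_right power2_eq_square field_simps)
  have d: "dist 0 (l *\<^sub>R e) = l" using e l by (simp add: norm_eq_1)
  let ?B = "x\<^sup>2 + y\<^sup>2 - l\<^sup>2 / 4"
  have "circumradius 0 (l *\<^sub>R e) ((l / 2 + y) *\<^sub>R e + x *\<^sub>R perp e) < \<rho> \<longleftrightarrow>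
      (l * sqrt (1 + (?B / (l * x))\<^sup>2) / 2)\<^sup>2 < \<rho>\<^sup>2"
    unfolding circumradius_def pencil_param_def sd th d using l \<rho>
    by (intro square_less_iff[symmetric]) simp_all
  also have "(l * sqrt (1 + (?B / (l * x))\<^sup>2) / 2)\<^sup>2 = l\<^sup>2 * (1 + (?B / (l * x))\<^sup>2) / 4"
    by (simp add: power_mult_distrib power_divide)
  also have "\<dots> = (l\<^sup>2 + ?B\<^sup>2 / x\<^sup>2) / 4"
    using l x by (simp add: power_divide power_mult_distrib field_simps)
  also have "(l\<^sup>2 + ?B\<^sup>2 / x\<^sup>2) / 4 < \<rho>\<^sup>2 \<longleftrightarrow> ?B\<^sup>2 / x\<^sup>2 < 4 * \<rho>\<^sup>2 - l\<^sup>2" by argo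
  also have "\<dots> \<longleftrightarrow> ?B\<^sup>2 < x\<^sup>2 * (4 * \<rho>\<^sup>2 - l\<^sup>2)"
    using x by (simp add: pos_divide_less_eq mult.commute)
  finally show "circumradius 0 (l *\<^sub>R e) ((l / 2 + y) *\<^sub>R e + x *\<^sub>R perp e) < \<rho> \<longleftrightarrow>
      (x\<^sup>2 + y\<^sup>2 - l\<^sup>2 / 4)\<^sup>2 < x\<^sup>2 * (4 * \<rho>\<^sup>2 - l\<^sup>2)" .
qed

text \<open>The apices \<open>w\<close> on one side of a chord with circumradius below \<open>\<rho>\<close> form a lune, bounded by two
  circles of radius \<open>\<rho>\<close>. It has the same area as the strip cut out of the disk of radius \<open>\<rho>\<close> by the
  two chords of that length.\<close>

lemma nn_integral_lune:
  assumes v: "v \<noteq> 0" and \<rho>: "\<rho> \<ge> 0"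
  shows "(\<integral>\<^sup>+w. indicator {w. side 0 v w > 0 \<and> circumradius 0 v w < \<rho>} w \<partial>lborel) =
    (\<integral>\<^sup>+y. \<integral>\<^sup>+x. indicator {x. x\<^sup>2 + y\<^sup>2 < \<rho>\<^sup>2 \<and> v \<bullet> v < 4 * (\<rho>\<^sup>2 - x\<^sup>2)} x \<partial>lborel \<partial>lborel)"
proof -
  define e where "e = sgn v"
  define l where "l = norm v"
  have e: "e \<bullet> e = 1" using v by (simp add: e_def inner_sgn_self)
  have l: "l > 0" using v by (simp add: l_def)
  have ve: "v = l *\<^sub>R e" using v by (simp add: e_def l_def sgn_div_norm)
  have vv: "v \<bullet> v = l\<^sup>2" by (simp add: l_def power2_norm_eq_inner)
  let ?F = "indicator {w. side 0 v w > 0 \<and> circumradius 0 v w < \<rho>} :: real^2 \<Rightarrow> ennreal"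
  have "(\<integral>\<^sup>+w. ?F w \<partial>lborel) = (\<integral>\<^sup>+y. \<integral>\<^sup>+x. ?F (y *\<^sub>R e + x *\<^sub>R perp e) \<partial>lborel \<partial>lborel)"
    by (rule nn_integral_rotate[OF _ e]) measurable
  also have "\<dots> = (\<integral>\<^sup>+y. \<integral>\<^sup>+x. ?F ((l / 2 + y) *\<^sub>R e + x *\<^sub>R perp e) \<partial>lborel \<partial>lborel)"
    by (rule nn_integral_lborel_shift[symmetric]) measurable
  also have "\<dots> = (\<integral>\<^sup>+y. \<integral>\<^sup>+x. indicator {x. x > 0 \<and> (x\<^sup>2 + y\<^sup>2 - l\<^sup>2 / 4)\<^sup>2 < x\<^sup>2 * (4 * \<rho>\<^sup>2 - l\<^sup>2)} x \<partial>lborel \<partial>lborel)"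
  proof (intro nn_integral_cong)
    fix y x
    have "((l / 2 + y) *\<^sub>R e + x *\<^sub>R perp e) \<in> {w. side 0 v w > 0 \<and> circumradius 0 v w < \<rho>} \<longleftrightarrow>
      x \<in> {x. x > 0 \<and> (x\<^sup>2 + y\<^sup>2 - l\<^sup>2 / 4)\<^sup>2 < x\<^sup>2 * (4 * \<rho>\<^sup>2 - l\<^sup>2)}"
      unfolding ve mem_Collect_eq circumradius_less_iff(2)[OF e l zero_less_one order_refl] using circumradius_less_iff(1)[OF e l _ \<rho>] l
      by (auto simp: zero_less_mult_iff)
    then show "?F ((l / 2 + y) *\<^sub>R e + x *\<^sub>R perp e) =
      indicator {x. x > 0 \<and> (x\<^sup>2 + y\<^sup>2 - l\<^sup>2 / 4)\<^sup>2 < x\<^sup>2 * (4 * \<rho>\<^sup>2 - l\<^sup>2)} x"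
      by (simp only: indicator_def)
  qed
  also have "\<dots> = (\<integral>\<^sup>+y. \<integral>\<^sup>+x. indicator {x. x\<^sup>2 + y\<^sup>2 < \<rho>\<^sup>2 \<and> v \<bullet> v < 4 * (\<rho>\<^sup>2 - x\<^sup>2)} x \<partial>lborel \<partial>lborel)"
    unfolding vv by (intro nn_integral_cong lune_slice l \<rho>)
  finally show ?thesis .
qed

text \<open>After the lune is rewritten, v is confined to a centred disk of radius 2 sqrt (rho^2 -
  x^2), so it is integrated first and gives norm d * 4/3 * 8 (rho^2 - x^2)^(3/2). The y-range
  contributes 2 sqrt (rho^2 - x^2), and the x-integral of (rho^2 - x^2)^2 is 16/15 rho^5; the
  constant is 64/3 * 16/15 = 1024/45.\<close>

lemma nn_integral_triangles_circumradius_less: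
  assumes \<rho>: "\<rho> \<ge> 0"
  shows "(\<integral>\<^sup>+v. ennreal \<bar>side 0 v d\<bar> * (\<integral>\<^sup>+w. indicator {w. side 0 v w > 0 \<and> circumradius 0 v w < \<rho>} w \<partial>lborel) \<partial>lborel) =
    ennreal (1024 / 45 * norm d * \<rho> ^ 5)"
proof -
  let ?H = "\<lambda>v y x. ennreal \<bar>side 0 v d\<bar> * indicator {v. v \<bullet> v < 4 * (\<rho>\<^sup>2 - x\<^sup>2)} v * indicator {(x, y). x\<^sup>2 + y\<^sup>2 < \<rho>\<^sup>2} (x, y)"
  have "(\<integral>\<^sup>+v. ennreal \<bar>side 0 v d\<bar> * (\<integral>\<^sup>+w. indicator {w. side 0 v w > 0 \<and> circumradius 0 v w < \<rho>} w \<partial>lborel) \<partial>lborel) =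
    (\<integral>\<^sup>+v. \<integral>\<^sup>+y. \<integral>\<^sup>+x. ?H v y x \<partial>lborel \<partial>lborel \<partial>lborel)"
  proof (intro nn_integral_cong)
    fix v :: "real^2"
    show "ennreal \<bar>side 0 v d\<bar> * (\<integral>\<^sup>+w. indicator {w. side 0 v w > 0 \<and> circumradius 0 v w < \<rho>} w \<partial>lborel) =
      (\<integral>\<^sup>+y. \<integral>\<^sup>+x. ?H v y x \<partial>lborel \<partial>lborel)"
    proof (cases "v = 0")
      case True
      then show ?thesis by (simp add: side_def)
    next
      case False
      have "ennreal \<bar>side 0 v d\<bar> * (\<integral>\<^sup>+w. indicator {w. side 0 v w > 0 \<and> circumradius 0 v w < \<rho>} w \<partial>lborel) =
        (\<integral>\<^sup>+y. ennreal \<bar>side 0 v d\<bar> * (\<integral>\<^sup>+x. indicator {x. x\<^sup>2 + y\<^sup>2 < \<rho>\<^sup>2 \<and> v \<bullet> v < 4 * (\<rho>\<^sup>2 - x\<^sup>2)} x \<partial>lborel) \<partial>lborel)"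
        unfolding nn_integral_lune[OF False \<rho>] by (rule nn_integral_cmult[symmetric]) measurable
      also have "\<dots> = (\<integral>\<^sup>+y. \<integral>\<^sup>+x. ennreal \<bar>side 0 v d\<bar> * indicator {x. x\<^sup>2 + y\<^sup>2 < \<rho>\<^sup>2 \<and> v \<bullet> v < 4 * (\<rho>\<^sup>2 - x\<^sup>2)} x \<partial>lborel \<partial>lborel)"
        by (intro nn_integral_cong nn_integral_cmult[symmetric]) measurable
      also have "\<dots> = (\<integral>\<^sup>+y. \<integral>\<^sup>+x. ?H v y x \<partial>lborel \<partial>lborel)"
        by (intro nn_integral_cong) (auto split: split_indicator)
      finally show ?thesis .
    qed
  qed
  also have "\<dots> = (\<integral>\<^sup>+y. \<integral>\<^sup>+v. \<integral>\<^sup>+x. ?H v y x \<partial>lborel \<partial>lborel \<partial>lborel)"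
    by (rule lborel_pair.Fubini') measurable
  also have "\<dots> = (\<integral>\<^sup>+y. \<integral>\<^sup>+x. \<integral>\<^sup>+v. ?H v y x \<partial>lborel \<partial>lborel \<partial>lborel)"
    by (intro nn_integral_cong lborel_pair.Fubini') measurable
  also have "\<dots> = (\<integral>\<^sup>+y. \<integral>\<^sup>+x. ennreal (norm d * (4 / 3) * sqrt (4 * (\<rho>\<^sup>2 - x\<^sup>2)) ^ 3) * indicator {(x, y). x\<^sup>2 + y\<^sup>2 < \<rho>\<^sup>2} (x, y) \<partial>lborel \<partial>lborel)"
  proof (intro nn_integral_cong)
    fix y x :: real
    have "(\<integral>\<^sup>+v. ?H v y x \<partial>lborel) = (\<integral>\<^sup>+v. ennreal \<bar>side 0 v d\<bar> * indicator {v. v \<bullet> v < 4 * (\<rho>\<^sup>2 - x\<^sup>2)} v \<partial>lborel) *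
        indicator {(x, y). x\<^sup>2 + y\<^sup>2 < \<rho>\<^sup>2} (x, y)"
      by (rule nn_integral_multc) measurable
    also have "\<dots> = ennreal (norm d * (4 / 3) * sqrt (4 * (\<rho>\<^sup>2 - x\<^sup>2)) ^ 3) * indicator {(x, y). x\<^sup>2 + y\<^sup>2 < \<rho>\<^sup>2} (x, y)"
    proof (cases "x\<^sup>2 + y\<^sup>2 < \<rho>\<^sup>2")
      case True
      then have "0 \<le> \<rho>\<^sup>2 - x\<^sup>2" using zero_le_power2[of y] by linarith
      then have "0 \<le> 4 * (\<rho>\<^sup>2 - x\<^sup>2)" by simp
      with True show ?thesis by (simp only: nn_integral_side_ball)
    qed simp
    finally show "(\<integral>\<^sup>+v. ?H v y x \<partial>lborel) = ennreal (norm d * (4 / 3) * sqrt (4 * (\<rho>\<^sup>2 - x\<^sup>2)) ^ 3) * indicator {(x, y). x\<^sup>2 + y\<^sup>2 < \<rho>\<^sup>2} (x, y)" .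
  qed
  also have "\<dots> = (\<integral>\<^sup>+x. \<integral>\<^sup>+y. ennreal (norm d * (4 / 3) * sqrt (4 * (\<rho>\<^sup>2 - x\<^sup>2)) ^ 3) * indicator {(x, y). x\<^sup>2 + y\<^sup>2 < \<rho>\<^sup>2} (x, y) \<partial>lborel \<partial>lborel)"
    by (rule lborel_pair.Fubini') measurable
  also have "\<dots> = (\<integral>\<^sup>+x. ennreal (64 / 3 * norm d) * (ennreal ((\<rho>\<^sup>2 - x\<^sup>2)\<^sup>2) * indicator {x. x\<^sup>2 < \<rho>\<^sup>2} x) \<partial>lborel)"
  proof (intro nn_integral_cong)
    fix x :: real
    have "(\<integral>\<^sup>+y. ennreal (norm d * (4 / 3) * sqrt (4 * (\<rho>\<^sup>2 - x\<^sup>2)) ^ 3) * indicator {(x, y). x\<^sup>2 + y\<^sup>2 < \<rho>\<^sup>2} (x, y) \<partial>lborel) =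
      ennreal (norm d * (4 / 3) * sqrt (4 * (\<rho>\<^sup>2 - x\<^sup>2)) ^ 3) * (\<integral>\<^sup>+y. indicator {(x, y). x\<^sup>2 + y\<^sup>2 < \<rho>\<^sup>2} (x, y) \<partial>lborel)"
      by (rule nn_integral_cmult) measurable
    also have "\<dots> = ennreal (64 / 3 * norm d) * (ennreal ((\<rho>\<^sup>2 - x\<^sup>2)\<^sup>2) * indicator {x. x\<^sup>2 < \<rho>\<^sup>2} x)"
    proof (cases "x\<^sup>2 < \<rho>\<^sup>2")
      case True
      define k where "k = sqrt (\<rho>\<^sup>2 - x\<^sup>2)"
      have k: "k > 0" "k\<^sup>2 = \<rho>\<^sup>2 - x\<^sup>2" using True by (simp_all add: k_def)
      have "x\<^sup>2 + y\<^sup>2 < \<rho>\<^sup>2 \<longleftrightarrow> y \<in> {-k<..<k}" for y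
      proof -
        have "x\<^sup>2 + y\<^sup>2 < \<rho>\<^sup>2 \<longleftrightarrow> y\<^sup>2 < k\<^sup>2" using k(2) by linarith
        also have "\<dots> \<longleftrightarrow> \<bar>y\<bar> < k" using k(1) abs_le_square_iff[of k y] by (auto simp: not_le[symmetric])
        finally show ?thesis by auto
      qed
      then have "(\<integral>\<^sup>+y. indicator {(x, y). x\<^sup>2 + y\<^sup>2 < \<rho>\<^sup>2} (x, y) \<partial>lborel) = (\<integral>\<^sup>+y. indicator {-k<..<k} y \<partial>lborel)"
        by (intro nn_integral_cong) (simp add: indicator_def)
      also have "\<dots> = ennreal (2 * k)" using k(1) by simp
      finally have 1: "(\<integral>\<^sup>+y. indicator {(x, y). x\<^sup>2 + y\<^sup>2 < \<rho>\<^sup>2} (x, y) \<partial>lborel) = ennreal (2 * k)" .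
      have 2: "sqrt (4 * (\<rho>\<^sup>2 - x\<^sup>2)) = 2 * k" unfolding k_def by (subst real_sqrt_mult) simp
      have "norm d * (4 / 3) * (2 * k) ^ 3 * (2 * k) = 64 / 3 * norm d * (k\<^sup>2)\<^sup>2"
        by (simp add: power2_eq_square power3_eq_cube)
      then show ?thesis using True k(1) unfolding 1 2
        by (simp add: ennreal_mult[symmetric] k(2))
    next
      case False
      then have "\<not> x\<^sup>2 + y\<^sup>2 < \<rho>\<^sup>2" for y using zero_le_power2[of y] by linarith
      then show ?thesis using False by simp
    qed
    finally show "(\<integral>\<^sup>+y. ennreal (norm d * (4 / 3) * sqrt (4 * (\<rho>\<^sup>2 - x\<^sup>2)) ^ 3) * indicator {(x, y). x\<^sup>2 + y\<^sup>2 < \<rho>\<^sup>2} (x, y) \<partial>lborel) =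
      ennreal (64 / 3 * norm d) * (ennreal ((\<rho>\<^sup>2 - x\<^sup>2)\<^sup>2) * indicator {x. x\<^sup>2 < \<rho>\<^sup>2} x)" .
  qed
  also have "\<dots> = ennreal (64 / 3 * norm d) * ennreal (16 / 15 * \<rho> ^ 5)"
    using nn_integral_parabola(2)[OF \<rho>] by (subst nn_integral_cmult) simp_all
  also have "\<dots> = ennreal (1024 / 45 * norm d * \<rho> ^ 5)"
    using \<rho> by (simp add: ennreal_mult[symmetric])
  finally show ?thesis .
qed

lemma nn_integral_gauss_moment6:
  assumes a: "a > 0"
  shows "(\<integral>\<^sup>+x. ennreal (x ^ 6 * exp (- a * x\<^sup>2)) * indicator {0..} x \<partial>lborel) = ennreal (15 * sqrt pi / (16 * a ^ 3 * sqrt a))"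
proof -
  \<comment> \<open>The half-line moment of order 2 k is sqrt pi / 2 * (2 k)! / (4^k k!). For k = 3
    this is 15/16 sqrt pi, and rescaling by sqrt a then supplies the factor a^(-7/2).\<close>
  have 1: "(\<integral>\<^sup>+x. ennreal (indicator {0..} x *\<^sub>R (exp (- x\<^sup>2) * x ^ 6)) \<partial>lborel) = ennreal (15 * sqrt pi / 16)"
    using gaussian_moment_even_pos[of 3]
    by (subst nn_integral_eq_integral) (auto simp: has_bochner_integral_iff fact_numeral)
  have "(\<integral>\<^sup>+x. ennreal (indicator {0..} x *\<^sub>R (exp (- x\<^sup>2) * x ^ 6)) \<partial>lborel) =
    ennreal (sqrt a) * (\<integral>\<^sup>+x. ennreal (indicator {0..} (sqrt a * x) *\<^sub>R (exp (- (sqrt a * x)\<^sup>2) * (sqrt a * x) ^ 6)) \<partial>lborel)"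
    using nn_integral_real_affine[of "\<lambda>x. ennreal (indicator {0..} x *\<^sub>R (exp (- x\<^sup>2) * x ^ 6))" "sqrt a" 0] a by simp
  also have "(\<integral>\<^sup>+x. ennreal (indicator {0..} (sqrt a * x) *\<^sub>R (exp (- (sqrt a * x)\<^sup>2) * (sqrt a * x) ^ 6)) \<partial>lborel) =
    (\<integral>\<^sup>+x. ennreal (a ^ 3) * (ennreal (x ^ 6 * exp (- a * x\<^sup>2)) * indicator {0..} x) \<partial>lborel)"
  proof (intro nn_integral_cong)
    fix x :: real
    have "sqrt a ^ 6 = a ^ 3" using a power_mult[of "sqrt a" 2 3] by simp
    then show "ennreal (indicator {0..} (sqrt a * x) *\<^sub>R (exp (- (sqrt a * x)\<^sup>2) * (sqrt a * x) ^ 6)) =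
      ennreal (a ^ 3) * (ennreal (x ^ 6 * exp (- a * x\<^sup>2)) * indicator {0..} x)"
      using a by (auto simp: power_mult_distrib ennreal_mult[symmetric] zero_le_mult_iff ac_simps split: split_indicator)
  qed
  also have "\<dots> = ennreal (a ^ 3) * (\<integral>\<^sup>+x. ennreal (x ^ 6 * exp (- a * x\<^sup>2)) * indicator {0..} x \<partial>lborel)"
    by (rule nn_integral_cmult) simp
  finally have "ennreal (a ^ 3 * sqrt a) * (\<integral>\<^sup>+x. ennreal (x ^ 6 * exp (- a * x\<^sup>2)) * indicator {0..} x \<partial>lborel) = ennreal (15 * sqrt pi / 16)"
    using 1 a by (simp add: ennreal_mult ac_simps)
  then have "ennreal (1 / (a ^ 3 * sqrt a)) * (ennreal (a ^ 3 * sqrt a) * (\<integral>\<^sup>+x. ennreal (x ^ 6 * exp (- a * x\<^sup>2)) * indicator {0..} x \<partial>lborel)) =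
    ennreal (1 / (a ^ 3 * sqrt a)) * ennreal (15 * sqrt pi / 16)" by simp
  then show ?thesis using a
    by (simp add: mult.assoc[symmetric] ennreal_mult[symmetric] del: ennreal_1) (simp add: field_simps)
qed

text \<open>The Gaussian is the tail integral of minus its derivative. The two indicators are kept
  apart so that the weight is nonnegative and free of r, and r enters only through the condition r <
  x.\<close>

lemma exp_square_layer_cake:
  fixes r a :: real
  assumes a: "a > 0" and r: "r \<ge> 0"
  shows "ennreal (exp (- a * r\<^sup>2)) = (\<integral>\<^sup>+x. ennreal (2 * a * x * exp (- a * x\<^sup>2)) * indicator {0..} x * indicator {x. r < x} x \<partial>lborel)"
proof -
  have "(\<integral>\<^sup>+x. ennreal (2 * a * x * exp (- a * x\<^sup>2)) * indicator {r..} x \<partial>lborel) = ennreal (0 - (- exp (- a * r\<^sup>2)))"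
  proof (rule nn_integral_FTC_atLeast)
    show "DERIV (\<lambda>x. - exp (- a * x\<^sup>2)) x :> 2 * a * x * exp (- a * x\<^sup>2)" for x
      by (auto intro!: derivative_eq_intros)
    have "filterlim (\<lambda>x::real. - a * x\<^sup>2) at_bot at_top"
      using a by real_asymp
    then have "((\<lambda>x::real. exp (- a * x\<^sup>2)) \<longlongrightarrow> 0) at_top"
      by (rule filterlim_compose[OF exp_at_bot])
    then show "((\<lambda>x. - exp (- a * x\<^sup>2)) \<longlongrightarrow> 0) at_top" using tendsto_minus by fastforce
  qed (use a r in auto)
  moreover have "(\<integral>\<^sup>+x. ennreal (2 * a * x * exp (- a * x\<^sup>2)) * indicator {r..} x \<partial>lborel) =
     (\<integral>\<^sup>+x. ennreal (2 * a * x * exp (- a * x\<^sup>2)) * indicator {0..} x * indicator {x. r < x} x \<partial>lborel)"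
    using AE_lborel_singleton[of r]
    by (intro nn_integral_cong_AE, eventually_elim) (use r in \<open>auto split: split_indicator\<close>)
  ultimately show ?thesis by simp
qed

text \<open>Interchanging the integrals leaves the weight 2 a x exp (- a x^2) against 1024/45 norm d
  x^5, which is a sixth Gaussian moment. The constant is 2048/45 * 15/16 = 128/3, and the powers of
  a combine to a * a^(-7/2).\<close>

lemma nn_integral_triangles_gauss:
  assumes a: "a > 0"
  shows "(\<integral>\<^sup>+v. ennreal \<bar>side 0 v d\<bar> * (\<integral>\<^sup>+w. indicator {w. side 0 v w > 0} w * ennreal (exp (- a * (circumradius 0 v w)\<^sup>2)) \<partial>lborel) \<partial>lborel) =
    ennreal (128 / 3 * norm d * sqrt pi / (a\<^sup>2 * sqrt a))"
proof -
  let ?g = "\<lambda>x. ennreal (2 * a * x * exp (- a * x\<^sup>2)) * indicator {0..} x"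
  let ?I = "\<lambda>v w x. indicator {(v, w, x). side 0 v w > 0 \<and> circumradius 0 v w < x} (v, w, x) :: ennreal"
  have r: "circumradius 0 v w \<ge> 0" for v w by (simp add: circumradius_def)
  have "(\<integral>\<^sup>+v. ennreal \<bar>side 0 v d\<bar> * (\<integral>\<^sup>+w. indicator {w. side 0 v w > 0} w * ennreal (exp (- a * (circumradius 0 v w)\<^sup>2)) \<partial>lborel) \<partial>lborel) =
    (\<integral>\<^sup>+v. ennreal \<bar>side 0 v d\<bar> * (\<integral>\<^sup>+w. \<integral>\<^sup>+x. ?g x * ?I v w x \<partial>lborel \<partial>lborel) \<partial>lborel)"
    by (intro nn_integral_cong arg_cong2[where f="(*)"] refl, unfold exp_square_layer_cake[OF a r],
        subst nn_integral_cmult[symmetric])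
       (auto intro!: nn_integral_cong split: split_indicator)
  also have "\<dots> = (\<integral>\<^sup>+v. ennreal \<bar>side 0 v d\<bar> * (\<integral>\<^sup>+x. \<integral>\<^sup>+w. ?g x * ?I v w x \<partial>lborel \<partial>lborel) \<partial>lborel)"
    by (intro nn_integral_cong arg_cong2[where f="(*)"] refl lborel_pair.Fubini') measurable
  also have "\<dots> = (\<integral>\<^sup>+v. \<integral>\<^sup>+x. ennreal \<bar>side 0 v d\<bar> * (\<integral>\<^sup>+w. ?g x * ?I v w x \<partial>lborel) \<partial>lborel \<partial>lborel)"
    by (intro nn_integral_cong nn_integral_cmult[symmetric]) measurable
  also have "\<dots> = (\<integral>\<^sup>+x. \<integral>\<^sup>+v. ennreal \<bar>side 0 v d\<bar> * (\<integral>\<^sup>+w. ?g x * ?I v w x \<partial>lborel) \<partial>lborel \<partial>lborel)"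
    by (rule lborel_pair.Fubini') measurable
  also have "\<dots> = (\<integral>\<^sup>+x. ?g x * (\<integral>\<^sup>+v. ennreal \<bar>side 0 v d\<bar> * (\<integral>\<^sup>+w. indicator {w. side 0 v w > 0 \<and> circumradius 0 v w < x} w \<partial>lborel) \<partial>lborel) \<partial>lborel)"
  proof (intro nn_integral_cong)
    fix x :: real
    have "(\<integral>\<^sup>+w. ?g x * ?I v w x \<partial>lborel) = ?g x * (\<integral>\<^sup>+w. indicator {w. side 0 v w > 0 \<and> circumradius 0 v w < x} w \<partial>lborel)" for v
    proof -
      have "?I v w x = indicator {w. side 0 v w > 0 \<and> circumradius 0 v w < x} w" for w by (simp add: indicator_def)
      then show ?thesis by (simp only:) (intro nn_integral_cmult, measurable)
    qed
    then have "(\<integral>\<^sup>+v. ennreal \<bar>side 0 v d\<bar> * (\<integral>\<^sup>+w. ?g x * ?I v w x \<partial>lborel) \<partial>lborel) =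
      (\<integral>\<^sup>+v. ?g x * (ennreal \<bar>side 0 v d\<bar> * (\<integral>\<^sup>+w. indicator {w. side 0 v w > 0 \<and> circumradius 0 v w < x} w \<partial>lborel)) \<partial>lborel)"
      by (simp only: mult.left_commute)
    also have "\<dots> = ?g x * (\<integral>\<^sup>+v. ennreal \<bar>side 0 v d\<bar> * (\<integral>\<^sup>+w. indicator {w. side 0 v w > 0 \<and> circumradius 0 v w < x} w \<partial>lborel) \<partial>lborel)"
      by (rule nn_integral_cmult) measurable
    finally show "(\<integral>\<^sup>+v. ennreal \<bar>side 0 v d\<bar> * (\<integral>\<^sup>+w. ?g x * ?I v w x \<partial>lborel) \<partial>lborel) =
      ?g x * (\<integral>\<^sup>+v. ennreal \<bar>side 0 v d\<bar> * (\<integral>\<^sup>+w. indicator {w. side 0 v w > 0 \<and> circumradius 0 v w < x} w \<partial>lborel) \<partial>lborel)" .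
  qed
  also have "\<dots> = (\<integral>\<^sup>+x. ennreal (2048 / 45 * norm d * a) * (ennreal (x ^ 6 * exp (- a * x\<^sup>2)) * indicator {0..} x) \<partial>lborel)"
  proof (intro nn_integral_cong)
    fix x :: real
    show "?g x * (\<integral>\<^sup>+v. ennreal \<bar>side 0 v d\<bar> * (\<integral>\<^sup>+w. indicator {w. side 0 v w > 0 \<and> circumradius 0 v w < x} w \<partial>lborel) \<partial>lborel) =
      ennreal (2048 / 45 * norm d * a) * (ennreal (x ^ 6 * exp (- a * x\<^sup>2)) * indicator {0..} x)"
    proof (cases "x \<ge> 0")
      case True
      have "?g x * ennreal (1024 / 45 * norm d * x ^ 5) = ennreal (2 * a * x * exp (- a * x\<^sup>2) * (1024 / 45 * norm d * x ^ 5))"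
        using True a by (subst ennreal_mult) simp_all
      also have "2 * a * x * exp (- a * x\<^sup>2) * (1024 / 45 * norm d * x ^ 5) = 2048 / 45 * norm d * a * (x ^ 6 * exp (- a * x\<^sup>2))"
        by (simp add: eval_nat_numeral)
      also have "ennreal \<dots> = ennreal (2048 / 45 * norm d * a) * (ennreal (x ^ 6 * exp (- a * x\<^sup>2)) * indicator {0..} x)"
        using True a by (subst ennreal_mult) simp_all
      finally show ?thesis unfolding nn_integral_triangles_circumradius_less[OF True] .
    qed simp
  qed
  also have "\<dots> = ennreal (2048 / 45 * norm d * a) * ennreal (15 * sqrt pi / (16 * a ^ 3 * sqrt a))"
    using nn_integral_gauss_moment6[OF a] by (subst nn_integral_cmult) simp_all
  also have "\<dots> = ennreal (128 / 3 * norm d * sqrt pi / (a\<^sup>2 * sqrt a))"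
    using a by (simp add: ennreal_mult[symmetric]) (simp add: field_simps power2_eq_square power3_eq_cube)
  finally show ?thesis .
qed

section \<open>Expectations\<close>

lemma measurable_triple_sum_config:
  fixes f :: "(('a::euclidean_space set \<times> 'a) \<times> 'a) \<times> 'a \<Rightarrow> ennreal"
  assumes "f \<in> borel_measurable (((config_algebra \<Otimes>\<^sub>M borel) \<Otimes>\<^sub>M borel) \<Otimes>\<^sub>M borel)"
  shows "(\<lambda>S. \<integral>\<^sup>+a. \<integral>\<^sup>+b. \<integral>\<^sup>+c. f (((S, a), b), c) \<partial>count_space S \<partial>count_space S \<partial>count_space S)
    \<in> borel_measurable config_algebra"
  using borel_measurable_sum_config[OF borel_measurable_sum_config[OF borel_measurable_sum_config[OF assms
    measurable_compose[OF measurable_fst measurable_fst]] measurable_fst] measurable_ident]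
  by simp

locale planar_poisson = poisson_law P \<gamma> for P :: "(real^2) set measure" and \<gamma> +
  assumes intensity_pos: "\<gamma> > 0"
begin

section \<open>Void probabilities and almost sure genericity\<close>

lemma emeasure_ball_real2: "r \<ge> 0 \<Longrightarrow> emeasure lborel (ball (c :: real^2) r) = ennreal (pi * r\<^sup>2)"
  by (simp add: emeasure_ball unit_ball_vol_2)

lemma measure_ball_real2: "r \<ge> 0 \<Longrightarrow> measure lborel (ball (c :: real^2) r) = pi * r\<^sup>2"
  by (simp add: measure_def emeasure_ball_real2)

lemma nn_integral_void_ball:
  assumes "r \<ge> 0"
  shows "(\<integral>\<^sup>+S. (if \<forall>p\<in>S. p \<notin> ball c r then 1 else 0) \<partial>P) = ennreal (exp (- (\<gamma> * pi * r\<^sup>2)))"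
proof -
  have "(\<integral>\<^sup>+S. (if \<forall>p\<in>S. p \<notin> ball c r then 1 else 0) \<partial>P) =
      (\<integral>\<^sup>+S. indicator {S. locally_finite_set S \<and> S \<inter> ball c r = {}} S \<partial>P)"
    by (intro nn_integral_cong) (auto simp: space_P indicator_def)
  also have "\<dots> = emeasure P {S. locally_finite_set S \<and> S \<inter> ball c r = {}}"
    by (rule nn_integral_indicator) (simp add: sets_P void_in_sets)
  also have "\<dots> = ennreal (exp (- (\<gamma> * measure lborel (ball c r))))"
    by (rule emeasure_void) auto
  finally show ?thesis using assms by (simp add: measure_ball_real2 mult.assoc)
qed

text \<open>Every open half-plane contains arbitrarily late members of one of the four families
  \<open>ball (k e) (k / 4)\<close>, where \<open>e\<close> is a signed coordinate vector, and almost surely each family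
  meets the process infinitely often.\<close>

lemma AE_half_planes_hit: "AE S in P. half_planes_hit S"
proof -
  let ?N = "\<lambda>u (K::nat). {S \<in> space P. \<forall>k\<ge>K. \<forall>p\<in>S. p \<notin> ball (real k *\<^sub>R u) (real k / 4)}"
  have null: "AE S in P. \<exists>k\<ge>K. \<exists>p\<in>S. p \<in> ball (real k *\<^sub>R u) (real k / 4)" for u and K :: nat
  proof (rule AE_I[of _ _ "?N u K"])
    have meas: "{S \<in> space P. \<forall>p\<in>S. p \<notin> ball (real k *\<^sub>R u) (real k / 4)} \<in> sets P" for k
    proof -
      have "{S \<in> space P. \<forall>p\<in>S. p \<notin> ball (real k *\<^sub>R u) (real k / 4)} =
          {S. locally_finite_set S \<and> S \<inter> ball (real k *\<^sub>R u) (real k / 4) = {}}"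
        by (auto simp: space_P)
      then show ?thesis by (simp add: sets_P void_in_sets)
    qed
    have eq: "?N u K = (\<Inter>k\<in>{K..}. {S \<in> space P. \<forall>p\<in>S. p \<notin> ball (real k *\<^sub>R u) (real k / 4)})"
      by auto
    show N: "?N u K \<in> sets P" unfolding eq by (rule sets.countable_INT') (auto intro: meas simp del: mem_ball)
    \<comment> \<open>The event lies inside every single void event with k >= K, whose probability
      tends to 0 as k grows.\<close>
    have le: "emeasure P (?N u K) \<le> ennreal (exp (- (\<gamma> * pi * (real k / 4)\<^sup>2)))" if "k \<ge> K" for k
    proof -
      have "emeasure P (?N u K) = (\<integral>\<^sup>+S. indicator (?N u K) S \<partial>P)" by (rule nn_integral_indicator[OF N, symmetric])
      also have "\<dots> \<le> (\<integral>\<^sup>+S. (if \<forall>p\<in>S. p \<notin> ball (real k *\<^sub>R u) (real k / 4) then 1 else 0) \<partial>P)"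
      proof (intro nn_integral_mono)
        fix S
        show "indicator (?N u K) S \<le> (if \<forall>p\<in>S. p \<notin> ball (real k *\<^sub>R u) (real k / 4) then 1 else 0 :: ennreal)"
        proof (cases "S \<in> ?N u K")
          case True
          then have *: "\<forall>p\<in>S. p \<notin> ball (real k *\<^sub>R u) (real k / 4)"
            unfolding mem_Collect_eq by (elim conjE allE[of _ k]) (rule mp[OF _ that])
          show ?thesis by (subst if_P[OF *], simp add: indicator_def)
        qed simp
      qed
      finally show ?thesis unfolding nn_integral_void_ball[OF divide_nonneg_pos[OF of_nat_0_le_iff zero_less_numeral]] .
    qed
    then have ev: "\<forall>\<^sub>F k in sequentially. emeasure P (?N u K) \<le> ennreal (exp (- (\<gamma> * pi * (real k / 4)\<^sup>2)))"
      by (rule eventually_sequentiallyI)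
    have "((\<lambda>k::nat. exp (- (\<gamma> * pi * (real k / 4)\<^sup>2))) \<longlongrightarrow> 0) sequentially"
      using intensity_pos by real_asymp
    then have "((\<lambda>k::nat. ennreal (exp (- (\<gamma> * pi * (real k / 4)\<^sup>2)))) \<longlongrightarrow> ennreal 0) sequentially"
      by (rule tendsto_ennrealI)
    then have "emeasure P (?N u K) \<le> ennreal 0"
      by (rule tendsto_lowerbound[OF _ ev]) simp
    then show "emeasure P (?N u K) = 0" by simp
  qed auto
  have "AE S in P. \<forall>u\<in>axis_directions. \<forall>K::nat. \<exists>k\<ge>K. \<exists>p\<in>S. p \<in> ball (real k *\<^sub>R u) (real k / 4)"
    by (intro AE_ball_countable[THEN iffD2] ballI null AE_all_countable[THEN iffD2] allI) auto
  then show ?thesis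
  proof eventually_elim
    case (elim S)
    show ?case unfolding half_planes_hit_def
    proof (intro allI impI)
      fix a b :: "real^2" assume ab: "a \<noteq> b"
      define \<nu> where "\<nu> = perp (b - a)"
      have nz: "norm \<nu> > 0" using ab by (auto simp: \<nu>_def eq_real2_iff)
      have side: "side a b p = \<nu> \<bullet> (p - a)" for p by (simp add: side_def \<nu>_def inner_real2 algebra_simps)
      \<comment> \<open>The sum of the absolute coordinates is at least the Euclidean norm, so one
        of them reaches half of it.\<close>
      obtain u where u: "u \<in> axis_directions" "\<nu> \<bullet> u \<ge> norm \<nu> / 2"
      proof -
        have "\<bar>\<nu>$1\<bar> \<ge> norm \<nu> / 2 \<or> \<bar>\<nu>$2\<bar> \<ge> norm \<nu> / 2"
          using norm_le_l1_cart[of \<nu>] by (simp add: sum_2) linarith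
        then consider "\<nu>$1 \<ge> norm \<nu> / 2" | "- \<nu>$1 \<ge> norm \<nu> / 2" | "\<nu>$2 \<ge> norm \<nu> / 2" | "- \<nu>$2 \<ge> norm \<nu> / 2"
          by linarith
        then show ?thesis
          by cases (use that[of "axis 1 1"] that[of "- axis 1 1"] that[of "axis 2 1"] that[of "- axis 2 1"]
            in \<open>simp_all add: inner_axis\<close>)
      qed
      \<comment> \<open>For k > 4 * norm a, and up to the factor norm nu, the direction gains at
        least k/2. The deviation of \<open>p\<close> from the centre of its ball and the vector
        \<open>a\<close> each lose less than k/4.\<close>
      obtain K :: nat where K: "4 * norm a < real K" using reals_Archimedean2 by blast
      from elim u(1) obtain k p where kp: "k \<ge> Suc K" "p \<in> S" "p \<in> ball (real k *\<^sub>R u) (real k / 4)" by meson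
      have "norm (p - real k *\<^sub>R u) < real k / 4" using kp(3) by (simp add: dist_norm norm_minus_commute)
      then have "norm \<nu> * norm (p - real k *\<^sub>R u) < norm \<nu> * (real k / 4)" using nz by simp
      moreover have "\<bar>\<nu> \<bullet> (p - real k *\<^sub>R u)\<bar> \<le> norm \<nu> * norm (p - real k *\<^sub>R u)" by (rule Cauchy_Schwarz_ineq2)
      moreover have "\<bar>\<nu> \<bullet> a\<bar> \<le> norm \<nu> * norm a" by (rule Cauchy_Schwarz_ineq2)
      moreover have "norm \<nu> * norm a < norm \<nu> * (real k / 4)" using nz K kp(1) by simp
      moreover have "real k * (\<nu> \<bullet> u) \<ge> real k * (norm \<nu> / 2)" using u(2) by (intro mult_left_mono) auto
      moreover have "\<nu> \<bullet> (p - a) = \<nu> \<bullet> (p - real k *\<^sub>R u) + real k * (\<nu> \<bullet> u) - \<nu> \<bullet> a"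
        by (simp add: inner_diff_right)
      ultimately have "side a b p > 0" unfolding side by (simp add: field_simps)
      then show "\<exists>c\<in>S. side a b c > 0" using kp(2) by blast
    qed
  qed
qed

lemma sum_over_null_set:
  assumes N: "N \<in> null_sets lborel"
  shows "(\<integral>\<^sup>+S. \<integral>\<^sup>+x. indicator N x \<partial>count_space S \<partial>P) = 0"
proof -
  have [measurable]: "N \<in> sets borel" using N by auto
  have "(\<integral>\<^sup>+S. \<integral>\<^sup>+x. indicator N x \<partial>count_space S \<partial>P) = ennreal \<gamma> * (\<integral>\<^sup>+x. \<integral>\<^sup>+S. indicator N x \<partial>P \<partial>lborel)"
    using mecke[of "\<lambda>(S, x). indicator N x"] by simp
  also have "(\<integral>\<^sup>+x. \<integral>\<^sup>+S. indicator N x \<partial>P \<partial>lborel) = emeasure lborel N"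
    by (simp add: emeasure_space_1)
  finally show ?thesis using N by (simp add: null_sets_def)
qed

text \<open>Once three points are fixed, a bad fourth point must lie on their circle, a null set,
  where the expected number of process points is 0. The sum over the fourth point is treated as a
  functional of the configuration and the three others, so that the Mecke formula for triples shows
  the expected number of bad quadruples to vanish.\<close>

lemma AE_no_four_cocircular: "AE S in P. no_four_cocircular S"
proof -
  let ?bad = "\<lambda>a b c d. side a b c > 0 \<and> side a b d > 0 \<and> thales a b d = pencil_param a b c * side a b d \<and> c \<noteq> d"
  let ?f = "\<lambda>p. \<integral>\<^sup>+d. (if ?bad (snd (fst (fst p))) (snd (fst p)) (snd p) d then 1 else 0 :: ennreal) \<partial>count_space (fst (fst (fst p)))"
  have f: "?f \<in> borel_measurable (((config_algebra \<Otimes>\<^sub>M borel) \<Otimes>\<^sub>M borel) \<Otimes>\<^sub>M borel)"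
    by measurable
  have null: "{d. ?bad a b c d} \<in> null_sets lborel" for a b c
  proof -
    let ?s = "sphere (pencil_centre a b (pencil_param a b c)) (circumradius a b c)"
    have "negligible ?s" by (rule negligible_sphere)
    then have "?s \<in> null_sets lebesgue" by (simp add: negligible_iff_null_sets)
    then have "?s \<in> null_sets lborel" by (simp add: null_sets_completion_iff)
    moreover have "{d. ?bad a b c d} \<subseteq> ?s"
      using mem_ball_pencil(2)[OF sphere_pencil_param(1)[of a b c]] by blast
    moreover have "{d. ?bad a b c d} \<in> sets lborel"
      by measurable
    ultimately show ?thesis using null_sets_subset by blast
  qed
  have "(\<integral>\<^sup>+S. \<integral>\<^sup>+a. \<integral>\<^sup>+b. \<integral>\<^sup>+c. ?f (((S, a), b), c) \<partial>count_space S \<partial>count_space S \<partial>count_space S \<partial>P) =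
    (ennreal \<gamma>) ^ 3 * (\<integral>\<^sup>+a. \<integral>\<^sup>+b. \<integral>\<^sup>+c. \<integral>\<^sup>+S. ?f (((insert c (insert b (insert a S)), a), b), c) \<partial>P \<partial>lborel \<partial>lborel \<partial>lborel)"
    by (rule mecke3[OF f]) (simp_all add: side_def)
  also have "(\<integral>\<^sup>+a. \<integral>\<^sup>+b. \<integral>\<^sup>+c. \<integral>\<^sup>+S. ?f (((insert c (insert b (insert a S)), a), b), c) \<partial>P \<partial>lborel \<partial>lborel \<partial>lborel) = 0"
  proof -
    have "(\<integral>\<^sup>+S. ?f (((insert c (insert b (insert a S)), a), b), c) \<partial>P) = 0" for a b c
    proof -
      have "?f (((insert c (insert b (insert a S)), a), b), c) = (\<integral>\<^sup>+d. indicator {d. ?bad a b c d} d \<partial>count_space S)" for S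
      proof -
        have "?f (((insert c (insert b (insert a S)), a), b), c) =
            (\<integral>\<^sup>+d. indicator {d. ?bad a b c d} d \<partial>count_space (insert c (insert b (insert a S))))"
          unfolding fst_conv snd_conv by (intro nn_integral_cong) (simp add: indicator_def)
        \<comment> \<open>The three added points are never bad: \<open>side a b\<close> vanishes at
          a and at b, and a bad point differs from c.\<close>
        also have "\<dots> = (\<integral>\<^sup>+d. indicator {d. ?bad a b c d} d \<partial>count_space S)"
          by (subst nn_integral_count_space_insert, simp add: side_def)+ simp
        finally show ?thesis .
      qed
      then show ?thesis using sum_over_null_set[OF null] by simp
    qed
    then show ?thesis by simp
  qed
  finally have 0: "(\<integral>\<^sup>+S. \<integral>\<^sup>+a. \<integral>\<^sup>+b. \<integral>\<^sup>+c. ?f (((S, a), b), c) \<partial>count_space S \<partial>count_space S \<partial>count_space S \<partial>P) = 0"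
    by simp
  have m: "(\<lambda>S. \<integral>\<^sup>+a. \<integral>\<^sup>+b. \<integral>\<^sup>+c. ?f (((S, a), b), c) \<partial>count_space S \<partial>count_space S \<partial>count_space S) \<in> borel_measurable P"
    using measurable_triple_sum_config[OF f] by (simp only: measurable_cong_sets[OF sets_P refl])
  have "AE S in P. (\<integral>\<^sup>+a. \<integral>\<^sup>+b. \<integral>\<^sup>+c. ?f (((S, a), b), c) \<partial>count_space S \<partial>count_space S \<partial>count_space S) = 0"
    by (rule iffD1[OF nn_integral_0_iff_AE[OF m] 0])
  then show ?thesis
  proof eventually_elim
    case (elim S)
    then have "\<forall>a\<in>S. \<forall>b\<in>S. \<forall>c\<in>S. \<forall>d\<in>S. (if ?bad a b c d then 1 else 0 :: ennreal) = 0"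
      by (simp add: nn_integral_0_iff_AE AE_count_space)
    then have "\<not> ?bad a b c d" if "a \<in> S" "b \<in> S" "c \<in> S" "d \<in> S" for a b c d
      using that by (metis (mono_tags) zero_neq_one)
    then show ?case unfolding no_four_cocircular_def by blast
  qed
qed

end

section \<open>Bounds for the edges affected by s and t\<close>

lemma sum_axis_directions_le: "(\<Sum>u\<in>axis_directions. c) \<le> 4 * (c :: ennreal)"
proof -
  have "card axis_directions \<le> 4" by (simp add: card_insert_if)
  then have "(of_nat (card axis_directions) :: ennreal) \<le> of_nat 4" by (simp only: of_nat_le_iff)
  then have "of_nat (card axis_directions) * c \<le> 4 * c" by (intro mult_right_mono) simp_all
  then show ?thesis by (simp only: sum_constant)
qed

text \<open>A disk with s and x on its boundary has radius at least R = dist x s / 2. These are the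
  four test disks near s for that R, with centres at distance R/2 and radius R/4; a neighbour x
  forces one of them to be empty.\<close>

definition void_count :: "real^2 \<Rightarrow> (real^2) set \<Rightarrow> ennreal" where
  "void_count s S = (\<integral>\<^sup>+x. (\<Sum>u\<in>axis_directions.
     if \<forall>p\<in>S. p \<notin> ball (s + (dist x s / 4) *\<^sub>R u) (dist x s / 8) then 1 else 0) \<partial>count_space S)"

text \<open>The quadratic mean of dist x s / 2 and dist y s / 2, each a lower bound for the radius
  of a disk with x and y on its boundary and s in its closure. The mean of squares makes the void
  probability factor into a Gaussian in x times a Gaussian in y.\<close>

definition mean_dist :: "real^2 \<Rightarrow> real^2 \<Rightarrow> real^2 \<Rightarrow> real" where
  "mean_dist s x y = sqrt (((dist x s)\<^sup>2 + (dist y s)\<^sup>2) / 8)"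

definition void_pair_count :: "real^2 \<Rightarrow> (real^2) set \<Rightarrow> ennreal" where
  "void_pair_count s S = (\<integral>\<^sup>+x. \<integral>\<^sup>+y. (if x \<noteq> y then \<Sum>u\<in>axis_directions.
     if \<forall>p\<in>S. p \<notin> ball (x + (mean_dist s x y / 2) *\<^sub>R u) (mean_dist s x y / 4) then 1 else 0 else 0)
     \<partial>count_space S \<partial>count_space S)"

lemma one_le_sum_indicators:
  assumes "finite U" "u \<in> U" "Q u"
  shows "(1 :: ennreal) \<le> (\<Sum>u\<in>U. if Q u then 1 else 0)"
  using assms member_le_sum[of u U "\<lambda>u. if Q u then 1 else 0 :: ennreal"] by simp

lemma count_disc_neighbours_le:
  "emeasure (count_space UNIV) (disc_neighbours s S) \<le> void_count s S"
proof -
  have sub: "disc_neighbours s S \<subseteq> S" by (auto simp: disc_neighbours_def)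
  show ?thesis
    unfolding emeasure_count_space_eq_sum[OF sub] void_count_def
  proof (intro nn_integral_mono)
    fix x
    show "indicator (disc_neighbours s S) x \<le> (\<Sum>u\<in>axis_directions.
       if \<forall>p\<in>S. p \<notin> ball (s + (dist x s / 4) *\<^sub>R u) (dist x s / 8) then 1 else 0 :: ennreal)"
    proof (cases "x \<in> disc_neighbours s S")
      case True
      then obtain z r where zr: "s \<in> sphere z r" "x \<in> sphere z r" "ball z r \<inter> S = {}"
        by (auto simp: disc_neighbours_def)
      have "dist x s / 2 \<le> r" using zr(1,2) dist_triangle2[of x s z] by (simp add: dist_commute)
      have "0 \<le> dist x s / 2" by simp
      from ball_subset_disc[OF zr(1) this \<open>dist x s / 2 \<le> r\<close>] obtain u where "u \<in> axis_directions"
        "ball (s + (dist x s / 2 / 2) *\<^sub>R u) (dist x s / 2 / 4) \<subseteq> ball z r" by (rule bexE)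
      then have "u \<in> axis_directions" "\<forall>p\<in>S. p \<notin> ball (s + (dist x s / 4) *\<^sub>R u) (dist x s / 8)"
        using zr(3) by (auto simp del: mem_ball)
      with one_le_sum_indicators[of axis_directions u "\<lambda>u. \<forall>p\<in>S. p \<notin> ball (s + (dist x s / 4) *\<^sub>R u) (dist x s / 8)"]
      show ?thesis using True by (simp only: indicator_simps) simp
    qed simp
  qed
qed

lemma count_disc_pairs_around_le:
  "emeasure (count_space UNIV) (disc_pairs_around s S) \<le> void_pair_count s S"
proof -
  have sub: "disc_pairs_around s S \<subseteq> S \<times> S" by (auto simp: disc_pairs_around_def)
  show ?thesis
    unfolding emeasure_count_space_Times_eq[OF sub] void_pair_count_def
  proof (intro nn_integral_mono)
    fix x y
    let ?R = "mean_dist s x y"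
    show "indicator (disc_pairs_around s S) (x, y) \<le> (if x \<noteq> y then \<Sum>u\<in>axis_directions.
       if \<forall>p\<in>S. p \<notin> ball (x + (?R / 2) *\<^sub>R u) (?R / 4) then 1 else 0 else 0 :: ennreal)"
    proof (cases "(x, y) \<in> disc_pairs_around s S")
      case True
      then obtain z r where zr: "x \<in> sphere z r" "y \<in> sphere z r" "s \<in> cball z r" "ball z r \<inter> S = {}"
        and xy: "x \<noteq> y" by (auto simp: disc_pairs_around_def)
      have r: "r \<ge> 0" using zr(1) by auto
      have "dist x s \<le> 2 * r" "dist y s \<le> 2 * r"
        using zr(1-3) dist_triangle2[of x s z] dist_triangle2[of y s z] by (simp_all add: dist_commute)
      then have "(dist x s)\<^sup>2 \<le> (2 * r)\<^sup>2" "(dist y s)\<^sup>2 \<le> (2 * r)\<^sup>2"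
        by (intro power_mono; simp)+
      then have "((dist x s)\<^sup>2 + (dist y s)\<^sup>2) / 8 \<le> r\<^sup>2" by (simp add: power_mult_distrib)
      then have "?R \<le> r" unfolding mean_dist_def using r by (intro real_le_lsqrt) auto
      have "0 \<le> ?R" by (simp add: mean_dist_def)
      from ball_subset_disc[OF zr(1) this \<open>?R \<le> r\<close>] obtain u where "u \<in> axis_directions"
        "ball (x + (?R / 2) *\<^sub>R u) (?R / 4) \<subseteq> ball z r" by (rule bexE)
      then have "u \<in> axis_directions" "\<forall>p\<in>S. p \<notin> ball (x + (?R / 2) *\<^sub>R u) (?R / 4)"
        using zr(4) by blast+
      with one_le_sum_indicators[of axis_directions u "\<lambda>u. \<forall>p\<in>S. p \<notin> ball (x + (?R / 2) *\<^sub>R u) (?R / 4)"]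
      show ?thesis using True xy by (simp only: indicator_simps if_True) simp
    qed simp
  qed
qed

lemma measurable_void_count [measurable]: "void_count s \<in> borel_measurable config_algebra"
  unfolding void_count_def[abs_def] mem_ball by measurable

lemma measurable_mean_dist [measurable (raw)]:
  assumes [measurable]: "x \<in> borel_measurable K" "y \<in> borel_measurable K"
  shows "(\<lambda>p. mean_dist s (x p) (y p)) \<in> borel_measurable K"
  unfolding mean_dist_def by measurable

lemma measurable_void_pair_count [measurable]: "void_pair_count s \<in> borel_measurable config_algebra"
  unfolding void_pair_count_def[abs_def] mem_ball by measurable

context planar_poisson
begin

lemma measurable_config_P: "borel_measurable P = borel_measurable config_algebra"
  by (rule measurable_cong_sets[OF sets_P refl])

lemma nn_integral_void_directions_le:
  assumes "r \<ge> 0"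
  shows "(\<integral>\<^sup>+S. (\<Sum>u\<in>axis_directions. if \<forall>p\<in>S. p \<notin> ball (c u) r then 1 else 0) \<partial>P) \<le>
    4 * ennreal (exp (- (\<gamma> * pi * r\<^sup>2)))"
proof -
  have "(\<integral>\<^sup>+S. (\<Sum>u\<in>axis_directions. if \<forall>p\<in>S. p \<notin> ball (c u) r then 1 else 0) \<partial>P) =
      (\<Sum>u\<in>axis_directions. \<integral>\<^sup>+S. (if \<forall>p\<in>S. p \<notin> ball (c u) r then 1 else 0) \<partial>P)"
    unfolding mem_ball by (intro nn_integral_sum) (simp only: measurable_config_P, measurable)
  also have "\<dots> = (\<Sum>u\<in>axis_directions. ennreal (exp (- (\<gamma> * pi * r\<^sup>2))))"
    by (intro sum.cong refl nn_integral_void_ball assms)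
  finally show ?thesis using sum_axis_directions_le by simp
qed

text \<open>A test disk of radius dist x s / 8 has area pi (dist x s)^2 / 64, and the Gaussian with
  rate gamma pi / 64 integrates to 64 / gamma. With four directions the bound is gamma * 4 * 64 /
  gamma = 256.\<close>

lemma expectation_void_count_le: "(\<integral>\<^sup>+S. void_count s S \<partial>P) \<le> 256"
proof -
  let ?f = "\<lambda>S x. \<Sum>u\<in>axis_directions. if \<forall>p\<in>S. p \<notin> ball (s + (dist x s / 4) *\<^sub>R u) (dist x s / 8) then 1 else 0 :: ennreal"
  have "(\<lambda>z. ?f (fst z) (snd z)) \<in> borel_measurable (config_algebra \<Otimes>\<^sub>M borel)"
    unfolding mem_ball by measurable
  from mecke[OF this] have "(\<integral>\<^sup>+S. void_count s S \<partial>P) = ennreal \<gamma> * (\<integral>\<^sup>+x. \<integral>\<^sup>+S. ?f (insert x S) x \<partial>P \<partial>lborel)"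
    unfolding void_count_def fst_conv snd_conv .
  also have "\<dots> \<le> ennreal \<gamma> * (\<integral>\<^sup>+x. 4 * ennreal (exp (- (\<gamma> * pi / 64) * (dist x s)\<^sup>2)) \<partial>lborel)"
  proof (intro mult_left_mono nn_integral_mono)
    fix x
    \<comment> \<open>Forgetting the added point only weakens the requirement that the test disk be
      empty.\<close>
    have "(\<integral>\<^sup>+S. ?f (insert x S) x \<partial>P) \<le> (\<integral>\<^sup>+S. ?f S x \<partial>P)"
      by (intro nn_integral_mono sum_mono) auto
    also have "\<dots> \<le> 4 * ennreal (exp (- (\<gamma> * pi * (dist x s / 8)\<^sup>2)))"
      by (rule nn_integral_void_directions_le) simp
    also have "- (\<gamma> * pi * (dist x s / 8)\<^sup>2) = - (\<gamma> * pi / 64) * (dist x s)\<^sup>2" by (simp add: power_divide)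
    finally show "(\<integral>\<^sup>+S. ?f (insert x S) x \<partial>P) \<le> 4 * ennreal (exp (- (\<gamma> * pi / 64) * (dist x s)\<^sup>2))" .
  qed simp
  also have "\<dots> = ennreal \<gamma> * (4 * ennreal (pi / (\<gamma> * pi / 64)))"
    using intensity_pos by (subst nn_integral_cmult, simp) (subst nn_integral_gauss2, simp_all)
  also have "\<dots> = ennreal (\<gamma> * (4 * (pi / (\<gamma> * pi / 64))))"
  proof -
    have "ennreal \<gamma> * (4 * ennreal c) = ennreal (\<gamma> * (4 * c))" if "c \<ge> 0" for c
      using that intensity_pos by (simp add: ennreal_mult)
    then show ?thesis using intensity_pos by simp
  qed
  also have "\<gamma> * (4 * (pi / (\<gamma> * pi / 64))) = 256" using intensity_pos by simp
  finally show ?thesis by simp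
qed

text \<open>With radius \<open>mean_dist s x y / 4\<close> each of the two Gaussian factors has rate
  gamma pi / 128 and integrates to 128 / gamma. The bound is gamma^2 * 4 * (128 / gamma)^2 =
  65536.\<close>

lemma expectation_void_pair_count_le: "(\<integral>\<^sup>+S. void_pair_count s S \<partial>P) \<le> 65536"
proof -
  let ?g = "\<lambda>S x y. \<Sum>u\<in>axis_directions.
     if \<forall>p\<in>S. p \<notin> ball (x + (mean_dist s x y / 2) *\<^sub>R u) (mean_dist s x y / 4) then 1 else 0 :: ennreal"
  let ?f = "\<lambda>S x y. if x \<noteq> y then ?g S x y else 0"
  have "(\<lambda>z. ?f (fst (fst z)) (snd (fst z)) (snd z)) \<in> borel_measurable ((config_algebra \<Otimes>\<^sub>M borel) \<Otimes>\<^sub>M borel)"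
    unfolding mem_ball by measurable
  from mecke2[OF this] have "(\<integral>\<^sup>+S. void_pair_count s S \<partial>P) =
      (ennreal \<gamma>)\<^sup>2 * (\<integral>\<^sup>+x. \<integral>\<^sup>+y. \<integral>\<^sup>+S. ?f (insert y (insert x S)) x y \<partial>P \<partial>lborel \<partial>lborel)"
    unfolding void_pair_count_def fst_conv snd_conv by simp
  also have "\<dots> \<le> (ennreal \<gamma>)\<^sup>2 * (\<integral>\<^sup>+x. \<integral>\<^sup>+y. 4 * (ennreal (exp (- (\<gamma> * pi / 128) * (dist x s)\<^sup>2)) *
      ennreal (exp (- (\<gamma> * pi / 128) * (dist y s)\<^sup>2))) \<partial>lborel \<partial>lborel)"
  proof (intro mult_left_mono nn_integral_mono)
    fix x y
    have "(\<integral>\<^sup>+S. ?f (insert y (insert x S)) x y \<partial>P) \<le> (\<integral>\<^sup>+S. ?g S x y \<partial>P)"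
    proof (intro nn_integral_mono)
      fix S
      have "?g (insert y (insert x S)) x y \<le> ?g S x y" by (intro sum_mono) auto
      then show "?f (insert y (insert x S)) x y \<le> ?g S x y" by (cases "x = y") (simp_all only: if_True if_False simp_thms zero_le)
    qed
    also have "\<dots> \<le> 4 * ennreal (exp (- (\<gamma> * pi * (mean_dist s x y / 4)\<^sup>2)))"
      by (rule nn_integral_void_directions_le) (simp add: mean_dist_def)
    also have "- (\<gamma> * pi * (mean_dist s x y / 4)\<^sup>2) = - (\<gamma> * pi / 128) * (dist x s)\<^sup>2 + - (\<gamma> * pi / 128) * (dist y s)\<^sup>2"
      by (simp add: mean_dist_def power_divide field_simps)
    also have "ennreal (exp \<dots>) = ennreal (exp (- (\<gamma> * pi / 128) * (dist x s)\<^sup>2)) * ennreal (exp (- (\<gamma> * pi / 128) * (dist y s)\<^sup>2))"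
      unfolding exp_add by (rule ennreal_mult) simp_all
    finally show "(\<integral>\<^sup>+S. ?f (insert y (insert x S)) x y \<partial>P) \<le> 4 * (ennreal (exp (- (\<gamma> * pi / 128) * (dist x s)\<^sup>2)) *
      ennreal (exp (- (\<gamma> * pi / 128) * (dist y s)\<^sup>2)))" .
  qed simp
  also have "\<dots> = (ennreal \<gamma>)\<^sup>2 * (4 * (ennreal (pi / (\<gamma> * pi / 128)) * ennreal (pi / (\<gamma> * pi / 128))))"
  proof -
    have c: "\<gamma> * pi / 128 > 0" using intensity_pos by simp
    have [measurable]: "(\<lambda>x::real^2. ennreal (exp (- (\<gamma> * pi / 128) * (dist x s)\<^sup>2))) \<in> borel_measurable lborel" by simp
    show ?thesis
      by (subst nn_integral_cmult, measurable, subst nn_integral_cmult, measurable, subst nn_integral_cmult, measurable,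
          subst nn_integral_multc, measurable) (simp only: nn_integral_gauss2[OF c])
  qed
  also have "\<dots> = ennreal (\<gamma>\<^sup>2 * (4 * ((pi / (\<gamma> * pi / 128)) * (pi / (\<gamma> * pi / 128)))))"
  proof -
    have "(ennreal \<gamma>)\<^sup>2 * (4 * (ennreal c * ennreal c)) = ennreal (\<gamma>\<^sup>2 * (4 * (c * c)))" if "c \<ge> 0" for c
      using that intensity_pos by (simp add: ennreal_mult ennreal_power)
    then show ?thesis using intensity_pos by (simp only: divide_nonneg_nonneg pi_ge_zero mult_nonneg_nonneg less_imp_le zero_le_numeral)
  qed
  also have "\<gamma>\<^sup>2 * (4 * ((pi / (\<gamma> * pi / 128)) * (pi / (\<gamma> * pi / 128)))) = 65536"
    using intensity_pos by (simp add: power2_eq_square)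
  finally show ?thesis by simp
qed

theorem expectation_crossing_pairs:
  "(\<integral>\<^sup>+S. emeasure (count_space UNIV) (crossing_pairs s t S) \<partial>P) =
    ennreal (128 / (3 * pi\<^sup>2) * sqrt \<gamma> * norm (t - s))"
proof -
  let ?f = "\<lambda>S a b c. if crosses s t a b \<and> side a b c > 0 \<and>
      (\<forall>p\<in>S. pencil_param a b c * side a b p \<le> thales a b p) then 1 else 0 :: ennreal"
  have f: "(\<lambda>z. ?f (fst (fst (fst z))) (snd (fst (fst z))) (snd (fst z)) (snd z))
      \<in> borel_measurable (((config_algebra \<Otimes>\<^sub>M borel) \<Otimes>\<^sub>M borel) \<Otimes>\<^sub>M borel)"
    by measurable
  let ?h = "\<lambda>v w. indicator {w. side 0 v w > 0} w * ennreal (exp (- (\<gamma> * pi) * (circumradius 0 v w)\<^sup>2))"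
  have "(\<integral>\<^sup>+S. emeasure (count_space UNIV) (crossing_pairs s t S) \<partial>P) =
    (\<integral>\<^sup>+S. \<integral>\<^sup>+a. \<integral>\<^sup>+b. \<integral>\<^sup>+c. ?f S a b c \<partial>count_space S \<partial>count_space S \<partial>count_space S \<partial>P)"
  proof (rule nn_integral_cong_AE)
    show "AE S in P. emeasure (count_space UNIV) (crossing_pairs s t S) =
        (\<integral>\<^sup>+a. \<integral>\<^sup>+b. \<integral>\<^sup>+c. ?f S a b c \<partial>count_space S \<partial>count_space S \<partial>count_space S)"
      using AE_half_planes_hit AE_no_four_cocircular AE_space
    proof eventually_elim
      case (elim S)
      then have "locally_finite_set S" by (simp add: space_P)
      note count_crossing_pairs_eq_triangles[OF this elim(1,2), of s t]
      also have "(\<integral>\<^sup>+a. \<integral>\<^sup>+b. \<integral>\<^sup>+c. indicator {(a, b, c). crosses s t a b \<and> side a b c > 0 \<and> delaunay_triangle S a b c} (a, b, c)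
          \<partial>count_space S \<partial>count_space S \<partial>count_space S) =
        (\<integral>\<^sup>+a. \<integral>\<^sup>+b. \<integral>\<^sup>+c. ?f S a b c \<partial>count_space S \<partial>count_space S \<partial>count_space S)"
        by (intro nn_integral_cong) (auto simp: indicator_def delaunay_triangle_iff)
      finally show ?case .
    qed
  qed
  also have "\<dots> = ennreal \<gamma> ^ 3 * (\<integral>\<^sup>+a. \<integral>\<^sup>+b. \<integral>\<^sup>+c. \<integral>\<^sup>+S. ?f (insert c (insert b (insert a S))) a b c \<partial>P \<partial>lborel \<partial>lborel \<partial>lborel)"
    using mecke3[OF f, unfolded fst_conv snd_conv] by (simp add: side_def)
  also have "(\<integral>\<^sup>+a. \<integral>\<^sup>+b. \<integral>\<^sup>+c. \<integral>\<^sup>+S. ?f (insert c (insert b (insert a S))) a b c \<partial>P \<partial>lborel \<partial>lborel \<partial>lborel) =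
    (\<integral>\<^sup>+a. \<integral>\<^sup>+b. \<integral>\<^sup>+c. (if crosses s t a b \<and> side a b c > 0 then ennreal (exp (- (\<gamma> * pi) * (circumradius a b c)\<^sup>2)) else 0) \<partial>lborel \<partial>lborel \<partial>lborel)"
  proof (intro nn_integral_cong)
    fix a b c :: "real^2"
    let ?z = "pencil_centre a b (pencil_param a b c)"
    show "(\<integral>\<^sup>+S. ?f (insert c (insert b (insert a S))) a b c \<partial>P) =
      (if crosses s t a b \<and> side a b c > 0 then ennreal (exp (- (\<gamma> * pi) * (circumradius a b c)\<^sup>2)) else 0)"
    proof (cases "crosses s t a b \<and> side a b c > 0")
      case True
      \<comment> \<open>The vertices lie on the boundary of their own disk, so the inequality is an
        equality at the three added points and emptiness concerns \<open>S\<close> alone.\<close>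
      have 0: "thales a b a = 0" "thales a b b = 0" "side a b a = 0" "side a b b = 0" "pencil_param a b c * side a b c = thales a b c"
        using True by (auto simp: thales_coord side_def pencil_param_def)
      have "?f (insert c (insert b (insert a S))) a b c = (if \<forall>p\<in>S. p \<notin> ball ?z (circumradius a b c) then 1 else 0)" for S
        unfolding mem_ball_pencil(1)[OF sphere_pencil_param(1)[of a b c]] not_less using True by (simp add: 0)
      then have "(\<integral>\<^sup>+S. ?f (insert c (insert b (insert a S))) a b c \<partial>P) = ennreal (exp (- (\<gamma> * pi * (circumradius a b c)\<^sup>2)))"
        by (simp only:) (rule nn_integral_void_ball, simp add: circumradius_def)
      then show ?thesis using True by simp
    next
      case False
      then have 0: "?f S a b c = 0" for S by (intro if_not_P) blast
      show ?thesis unfolding 0 using False by simp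
    qed
  qed
  also have "\<dots> = (\<integral>\<^sup>+a. \<integral>\<^sup>+v. \<integral>\<^sup>+w. indicator {a. crosses s t a (a + v)} a * ?h v w \<partial>lborel \<partial>lborel \<partial>lborel)"
  proof (rule nn_integral_cong)
    fix a :: "real^2"
    let ?k = "\<lambda>b c. if crosses s t a b \<and> side a b c > 0 then ennreal (exp (- (\<gamma> * pi) * (circumradius a b c)\<^sup>2)) else 0"
    have "(\<integral>\<^sup>+b. \<integral>\<^sup>+c. ?k b c \<partial>lborel \<partial>lborel) = (\<integral>\<^sup>+v. \<integral>\<^sup>+c. ?k (a + v) c \<partial>lborel \<partial>lborel)"
      by (rule nn_integral_lborel_shift[symmetric]) measurable
    also have "\<dots> = (\<integral>\<^sup>+v. \<integral>\<^sup>+w. ?k (a + v) (a + w) \<partial>lborel \<partial>lborel)"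
      by (intro nn_integral_cong nn_integral_lborel_shift[symmetric]) measurable
    also have "\<dots> = (\<integral>\<^sup>+v. \<integral>\<^sup>+w. indicator {a. crosses s t a (a + v)} a * ?h v w \<partial>lborel \<partial>lborel)"
    proof (intro nn_integral_cong)
      fix v w :: "real^2"
      have "side a (a + v) (a + w) = side 0 v w" "thales a (a + v) (a + w) = thales 0 v w" "dist a (a + v) = dist 0 v"
        by (simp_all add: side_def thales_coord dist_norm)
      then show "?k (a + v) (a + w) = indicator {a. crosses s t a (a + v)} a * ?h v w"
        by (simp add: circumradius_def pencil_param_def indicator_def)
    qed
    finally show "(\<integral>\<^sup>+b. \<integral>\<^sup>+c. ?k b c \<partial>lborel \<partial>lborel) = (\<integral>\<^sup>+v. \<integral>\<^sup>+w. indicator {a. crosses s t a (a + v)} a * ?h v w \<partial>lborel \<partial>lborel)" .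
  qed
  also have "\<dots> = (\<integral>\<^sup>+v. \<integral>\<^sup>+a. \<integral>\<^sup>+w. indicator {a. crosses s t a (a + v)} a * ?h v w \<partial>lborel \<partial>lborel \<partial>lborel)"
    by (rule lborel_pair.Fubini') measurable
  also have "\<dots> = (\<integral>\<^sup>+v. ennreal \<bar>side 0 v (t - s)\<bar> * (\<integral>\<^sup>+w. ?h v w \<partial>lborel) \<partial>lborel)"
  proof (intro nn_integral_cong)
    fix v :: "real^2"
    have "{a. crosses s t a (a + v)} \<in> sets lborel" by measurable
    have "(\<integral>\<^sup>+a. \<integral>\<^sup>+w. indicator {a. crosses s t a (a + v)} a * ?h v w \<partial>lborel \<partial>lborel) =
      (\<integral>\<^sup>+a. indicator {a. crosses s t a (a + v)} a * (\<integral>\<^sup>+w. ?h v w \<partial>lborel) \<partial>lborel)"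
      by (intro nn_integral_cong nn_integral_cmult) measurable
    also have "\<dots> = emeasure lborel {a. crosses s t a (a + v)} * (\<integral>\<^sup>+w. ?h v w \<partial>lborel)"
      using \<open>{a. crosses s t a (a + v)} \<in> sets lborel\<close> by (subst nn_integral_multc) simp_all
    also have "emeasure lborel {a. crosses s t a (a + v)} = ennreal \<bar>side 0 v (t - s)\<bar>"
      unfolding emeasure_crosses_translate by (simp add: side_def)
    finally show "(\<integral>\<^sup>+a. \<integral>\<^sup>+w. indicator {a. crosses s t a (a + v)} a * ?h v w \<partial>lborel \<partial>lborel) =
      ennreal \<bar>side 0 v (t - s)\<bar> * (\<integral>\<^sup>+w. ?h v w \<partial>lborel)" .
  qed
  also have "\<dots> = ennreal (128 / 3 * norm (t - s) * sqrt pi / ((\<gamma> * pi)\<^sup>2 * sqrt (\<gamma> * pi)))"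
    using intensity_pos by (intro nn_integral_triangles_gauss) simp
  also have "ennreal \<gamma> ^ 3 * \<dots> = ennreal (\<gamma> ^ 3 * (128 / 3 * norm (t - s) * sqrt pi / ((\<gamma> * pi)\<^sup>2 * sqrt (\<gamma> * pi))))"
    using intensity_pos by (subst ennreal_power) (auto simp: ennreal_mult[symmetric])
  also have "\<gamma> ^ 3 * (128 / 3 * norm (t - s) * sqrt pi / ((\<gamma> * pi)\<^sup>2 * sqrt (\<gamma> * pi))) =
      128 / (3 * pi\<^sup>2) * sqrt \<gamma> * norm (t - s)"
  proof -
    \<comment> \<open>Substituting gamma = g^2 removes the nested roots and leaves a rational
      identity in g and sqrt pi.\<close>
    define g where "g = sqrt \<gamma>"
    have g: "\<gamma> = g\<^sup>2" "g > 0" using intensity_pos by (simp_all add: g_def)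
    show ?thesis
      unfolding g(1) real_sqrt_mult real_sqrt_unique[OF refl less_imp_le[OF g(2)]] using g(2)
      by (simp add: field_simps power2_eq_square power3_eq_cube)
  qed
  finally show ?thesis .
qed

end

section \<open>Transfer to the configuration containing s and t\<close>

lemma count_crossing_pairs_insert_le:
  assumes "locally_finite_set S" "half_planes_hit S"
  shows "emeasure (count_space UNIV) (crossing_pairs s t (S \<union> {s, t})) \<le>
    emeasure (count_space UNIV) (crossing_pairs s t S) + (2 * void_count s S + 2 * void_count t S + 2)"
proof -
  let ?c = "emeasure (count_space UNIV)"
  have un: "?c (A \<union> B) \<le> ?c A + ?c B" for A B :: "'b set" by (rule emeasure_subadditive) auto
  have cong: "?c (Pair x ` A) = ?c A" "?c ((\<lambda>y. (y, x)) ` A) = ?c A" for x :: "real^2" and A :: "(real^2) set"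
    by (cases "finite A"; simp add: card_image inj_on_def finite_image_iff)+
  have D: "?c ({x} \<times> disc_neighbours x S \<union> disc_neighbours x S \<times> {x}) \<le> 2 * void_count x S" for x
  proof -
    have "?c ({x} \<times> disc_neighbours x S \<union> disc_neighbours x S \<times> {x}) \<le>
        ?c (Pair x ` disc_neighbours x S) + ?c ((\<lambda>y. (y, x)) ` disc_neighbours x S)"
      by (rule order_trans[OF _ un]) (auto intro!: emeasure_mono)
    also have "\<dots> \<le> void_count x S + void_count x S"
      unfolding cong by (intro add_mono count_disc_neighbours_le)
    finally show ?thesis by (simp add: mult_2)
  qed
  have "?c {(s, t), (t, s)} \<le> ?c {(s, t)} + ?c {(t, s)}"
    using un[of "{(s, t)}" "{(t, s)}"] by (simp only: insert_is_Un[symmetric])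
  \<comment> \<open>The edge joining s and t accounts for at most two ordered pairs.\<close>
  then have P: "?c {(s, t), (t, s)} \<le> 2" by simp
  have "?c (crossing_pairs s t (S \<union> {s, t})) \<le> ?c (crossing_pairs s t S \<union>
    ({s} \<times> disc_neighbours s S \<union> disc_neighbours s S \<times> {s}) \<union>
    ({t} \<times> disc_neighbours t S \<union> disc_neighbours t S \<times> {t}) \<union> {(s, t), (t, s)})"
    by (rule emeasure_mono[OF crossing_pairs_insert_subset[OF assms]]) simp
  also have "\<dots> \<le> ?c (crossing_pairs s t S) + 2 * void_count s S + 2 * void_count t S + 2"
    by (intro order_trans[OF un] add_mono order_refl D P)
  finally show ?thesis by (simp add: add.assoc)
qed

lemma count_crossing_pairs_le_insert:
  "emeasure (count_space UNIV) (crossing_pairs s t S) \<le>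
    emeasure (count_space UNIV) (crossing_pairs s t (S \<union> {s, t})) + (void_pair_count s S + void_pair_count t S)"
proof -
  let ?c = "emeasure (count_space UNIV)"
  have un: "?c (A \<union> B) \<le> ?c A + ?c B" for A B :: "'b set" by (rule emeasure_subadditive) auto
  have "?c (crossing_pairs s t S) \<le>
      ?c (crossing_pairs s t (S \<union> {s, t}) \<union> disc_pairs_around s S \<union> disc_pairs_around t S)"
    by (rule emeasure_mono[OF crossing_pairs_subset_insert]) simp
  also have "\<dots> \<le> ?c (crossing_pairs s t (S \<union> {s, t})) + void_pair_count s S + void_pair_count t S"
    by (intro order_trans[OF un] add_mono order_refl count_disc_pairs_around_le)
  finally show ?thesis by (simp add: add.assoc)
qed

lemma measurable_count_crossing_pairs_insert:
  "(\<lambda>S. emeasure (count_space UNIV) (crossing_pairs s t (S \<union> {s, t}))) \<in> borel_measurable config_algebra"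
proof -
  have "(\<lambda>S :: (real^2) set. insert s (insert t S)) \<in> measurable config_algebra config_algebra"
    by measurable
  from measurable_compose[OF this measurable_count_crossing_pairs[of s t]]
  show ?thesis by (simp add: Un_commute)
qed

context planar_poisson
begin

text \<open>Edges at s and at t cost at most 2 * 256 each, the factor 2 coming from orientations,
  and the edge st costs 2, in total 1026. The lost pairs are already ordered in
  \<open>void_pair_count\<close>, so they cost 65536 for each of s and t.\<close>

lemma expectation_crossing_pairs_insert:
  "(\<integral>\<^sup>+S. emeasure (count_space UNIV) (crossing_pairs s t (S \<union> {s, t})) \<partial>P) \<le>
    ennreal (128 / (3 * pi\<^sup>2) * sqrt \<gamma> * norm (t - s)) + 1026"
  "ennreal (128 / (3 * pi\<^sup>2) * sqrt \<gamma> * norm (t - s)) \<le>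
    (\<integral>\<^sup>+S. emeasure (count_space UNIV) (crossing_pairs s t (S \<union> {s, t})) \<partial>P) + 131072"
proof -
  let ?e = "\<lambda>S. emeasure (count_space UNIV) (crossing_pairs s t S)"
  note [measurable] = measurable_count_crossing_pairs_insert
  have [measurable_cong]: "sets P = sets config_algebra" by (rule sets_P)
  have "(\<integral>\<^sup>+S. ?e (S \<union> {s, t}) \<partial>P) \<le> (\<integral>\<^sup>+S. ?e S + (2 * void_count s S + 2 * void_count t S + 2) \<partial>P)"
    using AE_half_planes_hit AE_space
    by (intro nn_integral_mono_AE, eventually_elim) (rule count_crossing_pairs_insert_le, simp_all add: space_P)
  also have "\<dots> = (\<integral>\<^sup>+S. ?e S \<partial>P) + (2 * (\<integral>\<^sup>+S. void_count s S \<partial>P) + 2 * (\<integral>\<^sup>+S. void_count t S \<partial>P) + 2)"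
    by (simp add: nn_integral_add nn_integral_cmult emeasure_space_1)
  also have "\<dots> \<le> (\<integral>\<^sup>+S. ?e S \<partial>P) + (2 * 256 + 2 * 256 + 2)"
    by (intro add_mono mult_left_mono order_refl expectation_void_count_le) simp_all
  finally show "(\<integral>\<^sup>+S. ?e (S \<union> {s, t}) \<partial>P) \<le> ennreal (128 / (3 * pi\<^sup>2) * sqrt \<gamma> * norm (t - s)) + 1026"
    unfolding expectation_crossing_pairs by simp
  have "(\<integral>\<^sup>+S. ?e S \<partial>P) \<le> (\<integral>\<^sup>+S. ?e (S \<union> {s, t}) + (void_pair_count s S + void_pair_count t S) \<partial>P)"
    by (intro nn_integral_mono count_crossing_pairs_le_insert)
  also have "\<dots> = (\<integral>\<^sup>+S. ?e (S \<union> {s, t}) \<partial>P) + ((\<integral>\<^sup>+S. void_pair_count s S \<partial>P) + (\<integral>\<^sup>+S. void_pair_count t S \<partial>P))"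
    by (simp add: nn_integral_add)
  also have "\<dots> \<le> (\<integral>\<^sup>+S. ?e (S \<union> {s, t}) \<partial>P) + (65536 + 65536)"
    by (intro add_mono order_refl expectation_void_pair_count_le)
  finally show "ennreal (128 / (3 * pi\<^sup>2) * sqrt \<gamma> * norm (t - s)) \<le> (\<integral>\<^sup>+S. ?e (S \<union> {s, t}) \<partial>P) + 131072"
    unfolding expectation_crossing_pairs by simp
qed

lemma expectation_num_crossing_edges:
  "\<bar>expectation (\<lambda>S. real (num_crossing_edges (S \<union> {s, t}) s t)) - 64 / (3 * pi\<^sup>2) * sqrt \<gamma> * norm (t - s)\<bar> \<le> 65536"
proof -
  let ?e = "\<lambda>S. emeasure (count_space UNIV) (crossing_pairs s t (S \<union> {s, t}))"
  let ?m = "128 / (3 * pi\<^sup>2) * sqrt \<gamma> * norm (t - s)"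
  have m: "?m \<ge> 0" using intensity_nonneg by simp
  have e_meas: "?e \<in> borel_measurable P"
    using measurable_count_crossing_pairs_insert by (simp only: measurable_config_P)
  define E where "E = (\<integral>\<^sup>+S. ?e S \<partial>P)"
  have le: "E \<le> ennreal ?m + 1026" "ennreal ?m \<le> E + 131072"
    unfolding E_def by (rule expectation_crossing_pairs_insert)+
  \<comment> \<open>Finiteness of the mean makes the count finite almost surely, so
    \<open>enn2real\<close> changes it only on a null set.\<close>
  have fin: "E \<noteq> \<infinity>" using le(1) by (auto simp: top_unique)
  then obtain x where x: "E = ennreal x" "x \<ge> 0" by (cases E) auto
  have "ennreal x \<le> ennreal (?m + 1026)" "ennreal ?m \<le> ennreal (x + 131072)"
    using le x m by (simp_all add: ennreal_plus)
  then have x_le: "x \<le> ?m + 1026" "?m \<le> x + 131072"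
    using m x(2) by (simp_all only: ennreal_le_iff add_nonneg_nonneg zero_le_numeral)
  have "AE S in P. ?e S \<noteq> \<infinity>" using e_meas fin unfolding E_def by (rule nn_integral_PInf_AE)
  then have "(\<integral>\<^sup>+S. ennreal (enn2real (?e S)) \<partial>P) = E"
    unfolding E_def by (intro nn_integral_cong_AE, eventually_elim) (simp add: less_top)
  then have "expectation (\<lambda>S. enn2real (?e S)) = x"
    using e_meas x by (subst integral_eq_nn_integral) simp_all
  moreover have "(\<lambda>S. real (num_crossing_edges (S \<union> {s, t}) s t)) = (\<lambda>S. enn2real (?e S) / 2)"
    by (simp add: num_crossing_edges_eq)
  ultimately have "expectation (\<lambda>S. real (num_crossing_edges (S \<union> {s, t}) s t)) = x / 2"
    by simp
  moreover have "64 / (3 * pi\<^sup>2) * sqrt \<gamma> * norm (t - s) = ?m / 2" by simp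
  \<comment> \<open>Halving passes from ordered pairs to edges. The larger of the halved errors 513
    and 65536 is the final bound.\<close>
  moreover have "\<bar>u / 2 - v / 2\<bar> \<le> 65536" if "u \<le> v + 1026" "v \<le> u + 131072" for u v :: real
    using that by linarith
  ultimately show ?thesis using x_le by simp
qed

end

lemma planar_poisson_distr:
  fixes X :: "'w \<Rightarrow> (real^2) set"
  assumes "homogeneous_poisson_process M \<gamma> X" "\<gamma> > 0"
  shows "planar_poisson (distr M config_algebra X) \<gamma>"
  using poisson_law_distr[OF assms(1)] assms(2)
  by (simp add: planar_poisson_def planar_poisson_axioms_def)

text \<open>The tolerance is half a unit of the last decimal, so 2.1615 is the correctly rounded
  value.\<close>

lemma constant_approx: "\<bar>64 / (3 * pi\<^sup>2) - 2.1615\<bar> \<le> (0.00005 :: real)"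
proof -
  have pi: "3.14159 \<le> pi" "pi \<le> 3.14160" using pi_approx by simp_all
  have "(3.14159 :: real)\<^sup>2 \<le> pi\<^sup>2" "pi\<^sup>2 \<le> (3.14160 :: real)\<^sup>2" using pi by (intro power_mono; simp)+
  then have "9.8695 \<le> pi\<^sup>2" "pi\<^sup>2 \<le> 9.8697" by (simp_all add: power2_eq_square)
  then have "64 / (3 * pi\<^sup>2) \<le> 64 / (3 * 9.8695)" "64 / (3 * 9.8697) \<le> 64 / (3 * pi\<^sup>2)"
    by (intro divide_left_mono; simp)+
  moreover have "\<bar>q - 2.1615\<bar> \<le> 0.00005" if "q \<le> 64 / (3 * 9.8695)" "64 / (3 * 9.8697) \<le> q" for q :: real
    using that unfolding abs_le_iff by simp
  ultimately show ?thesis by blast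
qed

theorem proposition6:
  fixes s t :: "real ^ 2"
    and M :: "real \<Rightarrow> 'w measure"
    and X :: "real \<Rightarrow> 'w \<Rightarrow> (real ^ 2) set"
  assumes "s \<noteq> t"
    and "\<And>n. n > 0 \<Longrightarrow> homogeneous_poisson_process (M n) n (X n)"
  shows "(\<lambda>n. prob_space.expectation (M n)
                (\<lambda>\<omega>. real (num_crossing_edges (X n \<omega> \<union> {s, t}) s t) / norm (s - t))
              - 64 / (3 * pi\<^sup>2) * sqrt n) \<in> O[at_top](\<lambda>_. 1) \<and>
         \<bar>64 / (3 * pi\<^sup>2) - 2.1615\<bar> \<le> 0.00005"
proof (intro conjI constant_approx)
  have L: "norm (s - t) > 0" using assms(1) by simp
  have "\<bar>prob_space.expectation (M n) (\<lambda>\<omega>. real (num_crossing_edges (X n \<omega> \<union> {s, t}) s t) / norm (s - t))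
      - 64 / (3 * pi\<^sup>2) * sqrt n\<bar> \<le> 65536 / norm (s - t)" if n: "n > 0" for n
  proof -
    note X = assms(2)[OF n]
    interpret M: prob_space "M n" using X by (simp add: homogeneous_poisson_process_def)
    interpret P: planar_poisson "distr (M n) config_algebra (X n)" n by (rule planar_poisson_distr[OF X n])
    let ?N = "\<lambda>S. real (num_crossing_edges (S \<union> {s, t}) s t)"
    have "?N \<in> borel_measurable config_algebra"
      using measurable_count_crossing_pairs_insert[of s t]
      unfolding num_crossing_edges_eq by measurable
    then have "P.expectation ?N = M.expectation (\<lambda>\<omega>. ?N (X n \<omega>))"
      by (intro integral_distr measurable_homogeneous_poisson_process[OF X])
    then have "\<bar>M.expectation (\<lambda>\<omega>. ?N (X n \<omega>)) - 64 / (3 * pi\<^sup>2) * sqrt n * norm (s - t)\<bar> \<le> 65536"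
      using P.expectation_num_crossing_edges[of s t] by (simp add: norm_minus_commute)
    then have "\<bar>M.expectation (\<lambda>\<omega>. ?N (X n \<omega>)) - 64 / (3 * pi\<^sup>2) * sqrt n * norm (s - t)\<bar> / norm (s - t) \<le> 65536 / norm (s - t)"
      using L by (intro divide_right_mono) simp_all
    also have "\<bar>M.expectation (\<lambda>\<omega>. ?N (X n \<omega>)) - 64 / (3 * pi\<^sup>2) * sqrt n * norm (s - t)\<bar> / norm (s - t) =
        \<bar>(M.expectation (\<lambda>\<omega>. ?N (X n \<omega>)) - 64 / (3 * pi\<^sup>2) * sqrt n * norm (s - t)) / norm (s - t)\<bar>"
      using L by (simp add: abs_divide)
    also have "(M.expectation (\<lambda>\<omega>. ?N (X n \<omega>)) - 64 / (3 * pi\<^sup>2) * sqrt n * norm (s - t)) / norm (s - t) =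
        M.expectation (\<lambda>\<omega>. ?N (X n \<omega>) / norm (s - t)) - 64 / (3 * pi\<^sup>2) * sqrt n"
      using L by (simp add: diff_divide_distrib)
    finally show ?thesis .
  qed
  \<comment> \<open>The bound 65536 / norm (s - t) depends on the fixed points only and holds for
    every positive n.\<close>
  then show "(\<lambda>n. prob_space.expectation (M n) (\<lambda>\<omega>. real (num_crossing_edges (X n \<omega> \<union> {s, t}) s t) / norm (s - t))
      - 64 / (3 * pi\<^sup>2) * sqrt n) \<in> O[at_top](\<lambda>_. 1)"
    by (intro bigoI[where c = "65536 / norm (s - t)"] eventually_mono[OF eventually_gt_at_top[of 0]]) simp
qed

end
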